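(* Let $(\Omega,\mathcal A,P)$ be a probability space, let $\mathcal M$ be a sub-$\sigma$-algebra of $\mathcal A$, and let $\mathbb S$ be a completely regular Radon topological space whose compact subsets are metrizable. Let $c:\mathbb S\times\mathbb S\to[0,+\infty]$ be a mapping satisfying $$c(x,y)=\sup_{u\in \mathrm{Lip}^{(c)}_{\mathbb S}}|u(x)-u(y)|\qquad\text{for all }x,y\in\mathbb S,$$ where $\mathrm{Lip}^{(c)}_{\mathbb S}$ is the set of bounded continuous functions $u:\mathbb S\to\mathbb R$ such that $|u(x)-u(y)|\le c(x,y)$ for all $x,y\in\mathbb S$. Let $X$ be a random variable on $(\Omega,\mathcal A,P)$ with values in $\mathbb S$, with distribution $P_X$ such that $\int c(x,x_0)\,P_X(dx)<+\infty$ for some $x_0\in\mathbb S$, and let $P_{X|\mathcal M}$ be a regular conditional distribution of $X$ given $\mathcal M$. Assume that there exists a random variable $U$ from $(\Omega,\mathcal A)$ to $([0,1],\mathcal B([0,1]))$, independent of $\sigma(X)\vee\mathcal M$ and uniformly distributed over $[0,1]$. Then there exists a $\sigma(U)\vee\sigma(X)\vee\mathcal M$-measurable random variable $X^*$ with values in $\mathbb S$, independent of $\mathcal M$ and distributed as $X$, such that $$\tau_c(\mathcal M,X)=E\big(c(X,X^* )\big),$$ where $$\tau_c(\mathcal M,X)=\Big\|\sup_{f\in\mathrm{Lip}^{(c)}_{\mathbb S}}\Big|\int f(x)\,P_{X|\mathcal M}(dx)-\int f(x)\,P_X(dx)\Big|\,\Big\|_1 .$$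
   Context: A topological space $\mathbb S$ is completely regular if for every $x\in\mathbb S$ and every closed $F\subset\mathbb S$ with $x\notin F$ there is a continuous $f:\mathbb S\to[0,1]$ with $f(x)=0$ and $f=1$ on $F$. It is Radon if every finite Borel measure on $\mathbb S$ is inner regular with respect to the compact subsets of $\mathbb S$. Random variables with values in $\mathbb S$ are measurable with respect to the Borel $\sigma$-algebra of $\mathbb S$. Regular conditional distributions of $\mathbb S$-valued random variables exist when $\mathbb S$ is Radon with metrizable compact subsets. $\|\cdot\|_1$ is the norm of $L^1(P)$. *)

theory Defs
  imports "HOL-Probability.Probability"
begin

(* No Hausdorff assumption and no Borel measurability of K is required here.  In a space that is
   completely regular and has metrizable compact subsets, two-point sets are metrizable, so the
   space is Hausdorff and its compact sets are closed, hence Borel. *)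
definition radon_space :: "'s::topological_space itself \<Rightarrow> bool" where
  "radon_space _ \<longleftrightarrow>
    (\<forall>\<mu> :: 's measure. finite_measure \<mu> \<and> sets \<mu> = sets borel \<longrightarrow>
      (\<forall>B \<in> sets borel. emeasure \<mu> B = (SUP K \<in> {K. K \<subseteq> B \<and> compact K}. emeasure \<mu> K)))"

definition Lip_c :: "('s::topological_space \<Rightarrow> 's \<Rightarrow> ennreal) \<Rightarrow> ('s \<Rightarrow> real) set" where
  "Lip_c c = {u. continuous_on UNIV u \<and> bounded (range u) \<and>
                 (\<forall>x y. ennreal \<bar>u x - u y\<bar> \<le> c x y)}"

definition sigma_alg_of :: "'w measure \<Rightarrow> ('w \<Rightarrow> 's::topological_space) \<Rightarrow> 'w measure" where
  "sigma_alg_of P X = vimage_algebra (space P) X borel"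

(* Only the underlying measurable space is meaningful. *)
definition sigma_join :: "'w measure \<Rightarrow> 'w measure \<Rightarrow> 'w measure" where
  "sigma_join M N = sigma (space M \<union> space N) (sets M \<union> sets N)"

definition regular_cond_distr ::
  "'w measure \<Rightarrow> 'w measure \<Rightarrow> ('w \<Rightarrow> 's::topological_space) \<Rightarrow> ('w \<Rightarrow> 's measure) \<Rightarrow> bool" where
  "regular_cond_distr P M X \<kappa> \<longleftrightarrow>
    \<kappa> \<in> M \<rightarrow>\<^sub>M prob_algebra borel \<and>
    (\<forall>B \<in> sets borel. AE \<omega> in P.
       measure (\<kappa> \<omega>) B = real_cond_exp P M (indicat_real (X -` B \<inter> space P)) \<omega>)"

definition kr_dist ::
  "('s::topological_space \<Rightarrow> 's \<Rightarrow> ennreal) \<Rightarrow> 's measure \<Rightarrow> 's measure \<Rightarrow> ennreal" where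
  "kr_dist c \<mu> \<nu> = (SUP f \<in> Lip_c c. ennreal \<bar>(\<integral>x. f x \<partial>\<mu>) - (\<integral>x. f x \<partial>\<nu>)\<bar>)"

(* The supremum runs over an uncountable family, so measurability of the integrand is only to be
   expected with respect to the P-completion; the L1 norm is therefore taken there. *)
definition tau_c ::
  "('s::topological_space \<Rightarrow> 's \<Rightarrow> ennreal) \<Rightarrow> 'w measure \<Rightarrow> ('w \<Rightarrow> 's) \<Rightarrow> ('w \<Rightarrow> 's measure)
    \<Rightarrow> ennreal" where
  "tau_c c P X \<kappa> = (\<integral>\<^sup>+\<omega>. kr_dist c (\<kappa> \<omega>) (distr P borel X) \<partial>completion P)"

end

theory Submission
  imports Defs
begin

text \<open>
  By Lindelof arguments there are countably many \<open>f n \<in> Lip_c c\<close> and a \<open>\<sigma>\<close>-compact set \<open>T\<close> of full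
  measure with \<open>c = sup\<^sub>m c\<^sub>m\<close> on \<open>T \<times> T\<close>, where \<open>c\<^sub>m(x, y) = max\<^sub>n\<^sub>\<le>\<^sub>m \<bar>f n x - f n y\<bar>\<close> is bounded.
  For \<open>c\<^sub>m\<close>, a finite partition of \<open>S\<close> into cells of small \<open>c\<^sub>m\<close>-diameter and a finite subalgebra of \<open>M\<close>, linear
  programming duality gives an almost optimal plan, whose dual potentials are minima of
  functions \<open>c\<^sub>m(\<cdot>, s) - r\<close>; up to an error these range over a countable subset of \<open>Lip_c c\<close>.
  The plans are bimeasures, that is, points of a compact product of intervals, and all constraints
  (independence of \<open>M\<close>, marginals, cost at most \<open>\<tau>\<close> for every \<open>c\<^sub>m\<close>) are closed in it. The finite intersection
  property hence yields one bimeasure for the whole of \<open>M\<close> and all \<open>m\<close>, without measurable selections.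
  Being dominated by its marginals it is countably additive in each argument, so it has a density
  with respect to \<open>P\<close>, and the conditional quantile function applied to \<open>U\<close> gives \<open>X\<^sup>*\<close>.
\<close>

section \<open>Penalised finite transport\<close>

text \<open>Neither \<open>P\<close> nor \<open>M\<close> lives on a standard space, so plans on
  \<Omega> \<times> S have no tightness and no topology in which limits of measures could be
  extracted. What survives an arbitrary pointwise limit is finite additivity in each argument, which
  is why a plan is a function of pairs (event, Borel set). Exact finite duality is bypassed: a
  quadratic penalty on the second marginal has a minimiser by compactness, and the remaining
  marginal defect supplies the dual potential. The defect tends to 0 with the penalty parameter, so
  independence holds only approximately before the limit and exactly in it. Since c_m vanishes on
  the diagonal, one potential G serves both marginals, and the dual value over an event E of
  \<open>M\<close> is \<integral> G(X) over E minus P(E) \<integral> G d\<mu>. Hence the only input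
  about \<tau> is an integrated inequality for countably many G. That this countable family computes
  the full supremum over \<open>Lip_c c\<close> does not follow from c = sup c_m alone; it is
  deduced by running the same construction on a single conditional law.\<close>

lemma compact_PiE_UNIV:
  fixes B :: "'i \<Rightarrow> 'b::topological_space set"
  assumes "\<And>i. compact (B i)"
  shows "compact (PiE UNIV B)"
proof -
  have "compactin (product_topology (\<lambda>_. euclidean) UNIV) (PiE UNIV B)"
    using assms by (simp add: compactin_PiE)
  then show ?thesis by (simp add: euclidean_product_topology)
qed

lemma continuous_on_coordinate [continuous_intros]:
  "continuous_on A (\<lambda>x :: 'i \<Rightarrow> 'b::topological_space. x i)"
  by (rule continuous_on_subset[OF continuous_on_product_coordinates]) simp

text \<open>
  The marginal constraint on the second coordinate is replaced by a quadratic penalty.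
  The inequality is the first-order condition at a minimiser, tested against the plan that
  sends all the mass of each \<open>i\<close> to a minimiser of \<open>d i j - h j\<close>.
\<close>
lemma penalised_transport:
  fixes d :: "'i \<Rightarrow> 'j \<Rightarrow> real" and p :: "'i \<Rightarrow> real" and q :: "'j \<Rightarrow> real"
  assumes fin: "finite I" "finite J" "J \<noteq> {}"
    and p: "\<And>i. i \<in> I \<Longrightarrow> 0 \<le> p i" and l: "0 < l"
  obtains w h where "\<And>i j. i \<in> I \<Longrightarrow> j \<in> J \<Longrightarrow> 0 \<le> w i j"
    and "\<And>i. i \<in> I \<Longrightarrow> (\<Sum>j\<in>J. w i j) = p i"
    and "\<And>j. j \<in> J \<Longrightarrow> l * h j = q j - (\<Sum>i\<in>I. w i j)"
    and "(\<Sum>i\<in>I. \<Sum>j\<in>J. w i j * d i j) + l * (\<Sum>j\<in>J. (h j)\<^sup>2)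
      \<le> (\<Sum>i\<in>I. p i * Min ((\<lambda>j. d i j - h j) ` J)) + (\<Sum>j\<in>J. h j * q j)"
proof -
  \<comment> \<open>Coordinates outside \<open>I \<times> J\<close> are pinned to 0. The upper bound
    \<open>p i\<close> follows from the row sums; stating it makes \<open>K\<close> a closed part of
    a product of compact intervals.\<close>
  define K where "K = PiE UNIV (\<lambda>(i, j). if i \<in> I \<and> j \<in> J then {0..p i} else {0}) \<inter>
    (\<Inter>i\<in>I. {w. (\<Sum>j\<in>J. w (i, j)) = p i})"
  \<comment> \<open>The factor 1/(2l) makes minus the derivative of the penalty with respect to the
    mass of column j equal to the \<open>h j\<close> defined below.\<close>
  define F where "F w = (\<Sum>i\<in>I. \<Sum>j\<in>J. w (i, j) * d i j)
    + (\<Sum>j\<in>J. (q j - (\<Sum>i\<in>I. w (i, j)))\<^sup>2) / (2 * l)" for w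
  have K_I: "w \<in> K" if "\<And>i j. i \<in> I \<Longrightarrow> j \<in> J \<Longrightarrow> 0 \<le> w (i, j)"
    "\<And>i. i \<in> I \<Longrightarrow> (\<Sum>j\<in>J. w (i, j)) = p i" "\<And>i j. i \<notin> I \<or> j \<notin> J \<Longrightarrow> w (i, j) = 0" for w
  proof -
    have "w (i, j) \<le> p i" if "i \<in> I" "j \<in> J" for i j
      using that \<open>\<And>i. i \<in> I \<Longrightarrow> (\<Sum>j\<in>J. w (i, j)) = p i\<close>[of i]
        member_le_sum[of j J "\<lambda>j. w (i, j)"] fin \<open>\<And>i j. i \<in> I \<Longrightarrow> j \<in> J \<Longrightarrow> 0 \<le> w (i, j)\<close> by auto
    then show ?thesis using that by (auto simp: K_def)
  qed
  have K_D: "(\<Sum>j\<in>J. w (i, j)) = p i" "j \<in> J \<Longrightarrow> 0 \<le> w (i, j)" if "w \<in> K" "i \<in> I" for w i j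
    using that by (auto simp: K_def PiE_iff split: if_splits dest!: spec[of _ i] spec[of _ j])
  have K_0: "w (i, j) = 0" if "w \<in> K" "i \<notin> I \<or> j \<notin> J" for w i j
    using that by (auto simp: K_def PiE_iff split: if_splits dest!: spec[of _ i] spec[of _ j])
  have "closed (\<Inter>i\<in>I. {w. (\<Sum>j\<in>J. w (i, j)) = p i})"
    by (intro closed_INT ballI closed_Collect_eq continuous_intros)
  then have "compact K"
    unfolding K_def by (intro compact_Int_closed compact_PiE_UNIV) (auto split: prod.split)
  define best where "best h i = (SOME j. j \<in> J \<and> d i j - h j = Min ((\<lambda>j. d i j - h j) ` J))" for h i
  have best: "best h i \<in> J \<and> d i (best h i) - h (best h i) = Min ((\<lambda>j. d i j - h j) ` J)" for h i
  proof -
    have "Min ((\<lambda>j. d i j - h j) ` J) \<in> (\<lambda>j. d i j - h j) ` J" using fin by simp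
    then have "\<exists>j. j \<in> J \<and> d i j - h j = Min ((\<lambda>j. d i j - h j) ` J)" by force
    then show ?thesis unfolding best_def by (rule someI_ex)
  qed
  define greedy where "greedy h = (\<lambda>(i, j). if i \<in> I \<and> j = best h i then p i else 0)" for h
  have greedy: "greedy h \<in> K" for h
    by (rule K_I) (use best[of h] p fin in \<open>auto simp: greedy_def\<close>)
  have "continuous_on K F" unfolding F_def by (intro continuous_intros) (use l in auto)
  with \<open>compact K\<close> greedy obtain w where w: "w \<in> K" "\<And>w'. w' \<in> K \<Longrightarrow> F w \<le> F w'"
    using continuous_attains_inf[of K F] by blast
  define h where "h j = (q j - (\<Sum>i\<in>I. w (i, j))) / l" for j
  \<comment> \<open>\<open>w + t * e\<close> runs from the minimiser to the greedy plan. Along this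
    segment \<open>F\<close> is quadratic, with slope \<open>L\<close> at t = 0.\<close>
  define e where "e x = greedy h x - w x" for x
  define L where "L = (\<Sum>i\<in>I. \<Sum>j\<in>J. e (i, j) * (d i j - h j))"
  define Q where "Q = (\<Sum>j\<in>J. (\<Sum>i\<in>I. e (i, j))\<^sup>2) / (2 * l)"
  have Fexp: "F (\<lambda>x. w x + t * e x) = F w + t * L + t\<^sup>2 * Q" for t
  proof -
    have 1: "(\<Sum>i\<in>I. \<Sum>j\<in>J. (w (i, j) + t * e (i, j)) * d i j) =
      (\<Sum>i\<in>I. \<Sum>j\<in>J. w (i, j) * d i j) + t * (\<Sum>i\<in>I. \<Sum>j\<in>J. e (i, j) * d i j)"
      by (simp add: algebra_simps sum.distrib sum_distrib_left)
    have "(q j - (\<Sum>i\<in>I. w (i, j) + t * e (i, j)))\<^sup>2 / (2 * l) = (q j - (\<Sum>i\<in>I. w (i, j)))\<^sup>2 / (2 * l)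
        - t * (h j * (\<Sum>i\<in>I. e (i, j))) + t\<^sup>2 * ((\<Sum>i\<in>I. e (i, j))\<^sup>2 / (2 * l))" for j
    proof -
      have "(\<Sum>i\<in>I. w (i, j) + t * e (i, j)) = (\<Sum>i\<in>I. w (i, j)) + t * (\<Sum>i\<in>I. e (i, j))"
        by (simp add: sum.distrib sum_distrib_left)
      moreover have "q j = l * h j + (\<Sum>i\<in>I. w (i, j))" using l by (simp add: h_def)
      ultimately show ?thesis using l by (simp add: field_simps power2_eq_square)
    qed
    then have 2: "(\<Sum>j\<in>J. (q j - (\<Sum>i\<in>I. w (i, j) + t * e (i, j)))\<^sup>2) / (2 * l)
       = (\<Sum>j\<in>J. (q j - (\<Sum>i\<in>I. w (i, j)))\<^sup>2) / (2 * l)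
        - t * (\<Sum>j\<in>J. h j * (\<Sum>i\<in>I. e (i, j))) + t\<^sup>2 * Q"
      unfolding Q_def sum_divide_distrib
      by (simp add: sum.distrib sum_subtractf sum_distrib_left)
    have 3: "L = (\<Sum>i\<in>I. \<Sum>j\<in>J. e (i, j) * d i j) - (\<Sum>j\<in>J. h j * (\<Sum>i\<in>I. e (i, j)))"
      unfolding L_def sum_distrib_left
      by (subst (3) sum.swap) (simp add: sum_subtractf algebra_simps)
    show ?thesis unfolding F_def 1 2 3 by (simp add: algebra_simps)
  qed
  \<comment> \<open>Convexity of \<open>K\<close> keeps the segment feasible. Minimality divided by
    t leaves the slope in the limit t to 0.\<close>
  have "0 \<le> L + t * Q" if t: "0 < t" "t \<le> 1" for t
  proof -
    have "(\<lambda>x. w x + t * e x) \<in> K"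
    proof (rule K_I)
      fix i j assume "i \<in> I" "j \<in> J"
      have "w (i, j) + t * e (i, j) = (1 - t) * w (i, j) + t * greedy h (i, j)"
        by (simp add: e_def algebra_simps)
      then show "0 \<le> w (i, j) + t * e (i, j)"
        using K_D(2)[OF w(1) \<open>i \<in> I\<close> \<open>j \<in> J\<close>] K_D(2)[OF greedy \<open>i \<in> I\<close> \<open>j \<in> J\<close>] t by simp
    next
      fix i assume "i \<in> I"
      then show "(\<Sum>j\<in>J. w (i, j) + t * e (i, j)) = p i"
        using K_D(1)[OF w(1)] K_D(1)[OF greedy]
        by (simp add: sum.distrib sum_subtractf e_def flip: sum_distrib_left)
    qed (auto simp: e_def K_0[OF w(1)] K_0[OF greedy])
    from w(2)[OF this] have "0 \<le> t * (L + t * Q)"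
      by (simp add: Fexp power2_eq_square algebra_simps)
    then show ?thesis using t by (simp add: zero_le_mult_iff)
  qed
  moreover have "((\<lambda>t. L + t * Q) \<longlongrightarrow> L + 0 * Q) (at_right 0)"
    by (intro tendsto_intros)
  moreover have "\<forall>\<^sub>F t::real in at_right 0. 0 < t \<and> t \<le> 1"
    unfolding eventually_at_right_field by (rule exI[of _ 1]) auto
  ultimately have "0 \<le> L"
    by (intro tendsto_lowerbound[of "\<lambda>t. L + t * Q" L "at_right 0" 0]) (auto elim!: eventually_mono)
  moreover have "(\<Sum>i\<in>I. \<Sum>j\<in>J. greedy h (i, j) * (d i j - h j)) =
      (\<Sum>i\<in>I. p i * Min ((\<lambda>j. d i j - h j) ` J))"
  proof (rule sum.cong[OF refl])
    fix i assume "i \<in> I"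
    then have "(\<Sum>j\<in>J. greedy h (i, j) * (d i j - h j)) =
        (\<Sum>j\<in>J. if j = best h i then p i * (d i j - h j) else 0)"
      by (intro sum.cong) (auto simp: greedy_def)
    also have "\<dots> = p i * (d i (best h i) - h (best h i))"
      using best[of h i] fin by (simp)
    finally show "(\<Sum>j\<in>J. greedy h (i, j) * (d i j - h j)) = p i * Min ((\<lambda>j. d i j - h j) ` J)"
      using best[of h i] by simp
  qed
  ultimately have ineq: "(\<Sum>i\<in>I. \<Sum>j\<in>J. w (i, j) * (d i j - h j)) \<le>
      (\<Sum>i\<in>I. p i * Min ((\<lambda>j. d i j - h j) ` J))"
    by (simp add: L_def e_def left_diff_distrib sum_subtractf)
  have wh: "(\<Sum>i\<in>I. w (i, j)) = q j - l * h j" for j using l by (simp add: h_def)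
  \<comment> \<open>Column j has mass q j - l h j. This yields the dual term in q and, with a minus
    sign, the penalty term that ends up on the left of the claim.\<close>
  have "(\<Sum>i\<in>I. \<Sum>j\<in>J. w (i, j) * h j) = (\<Sum>j\<in>J. h j * (\<Sum>i\<in>I. w (i, j)))"
    by (subst sum.swap) (simp add: sum_distrib_left mult.commute)
  also have "\<dots> = (\<Sum>j\<in>J. h j * q j) - l * (\<Sum>j\<in>J. (h j)\<^sup>2)"
    unfolding wh by (simp add: algebra_simps sum_subtractf power2_eq_square sum_distrib_left)
  finally have "(\<Sum>i\<in>I. \<Sum>j\<in>J. w (i, j) * d i j) + l * (\<Sum>j\<in>J. (h j)\<^sup>2)
      \<le> (\<Sum>i\<in>I. p i * Min ((\<lambda>j. d i j - h j) ` J)) + (\<Sum>j\<in>J. h j * q j)"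
    using ineq by (simp add: right_diff_distrib sum_subtractf)
  then show thesis
    using K_D[OF w(1)] wh by (intro that[of "\<lambda>i j. w (i, j)" h]) auto
qed

text \<open>Domination transfers continuity at the empty set from \<open>N\<close> to
  \<open>f\<close>, and for a finite, finitely additive set function this continuity gives countable
  additivity. It turns a plan obtained as a mere pointwise limit into a measure in each
  argument.\<close>

lemma dominated_additive_measure:
  fixes f :: "'a set \<Rightarrow> real"
  assumes N: "finite_measure N"
    and nonneg: "\<And>A. A \<in> sets N \<Longrightarrow> 0 \<le> f A"
    and add: "\<And>A B. A \<in> sets N \<Longrightarrow> B \<in> sets N \<Longrightarrow> A \<inter> B = {} \<Longrightarrow> f (A \<union> B) = f A + f B"
    and dom: "\<And>A. A \<in> sets N \<Longrightarrow> f A \<le> measure N A"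
  obtains N' where "finite_measure N'" "sets N' = sets N"
    "absolutely_continuous N N'" "\<And>A. A \<in> sets N \<Longrightarrow> measure N' A = f A"
proof -
  interpret N: finite_measure N by fact
  have f0: "f {} = 0" using dom[of "{}"] nonneg[of "{}"] by simp
  have pos: "positive (sets N) (\<lambda>A. ennreal (f A))" by (simp add: positive_def f0)
  have "countably_additive (sets N) (\<lambda>A. ennreal (f A))"
  proof (rule sets.empty_continuous_imp_countably_additive[OF pos])
    show "additive (sets N) (\<lambda>A. ennreal (f A))"
      by (auto simp: additive_def add nonneg simp flip: ennreal_plus)
    fix A :: "nat \<Rightarrow> 'a set" assume A: "range A \<subseteq> sets N" "decseq A" "(\<Inter>i. A i) = {}"
    then have "(\<lambda>i. measure N (A i)) \<longlonglongrightarrow> 0"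
      using N.finite_Lim_measure_decseq[of A] by simp
    then have "(\<lambda>i. f (A i)) \<longlonglongrightarrow> 0"
      by (rule tendsto_sandwich[OF _ _ tendsto_const, rotated 2])
        (use A(1) nonneg dom in \<open>auto intro!: always_eventually\<close>)
    then show "(\<lambda>i. ennreal (f (A i))) \<longlonglongrightarrow> 0" using tendsto_ennrealI by fastforce
  qed simp
  moreover define N' where "N' = measure_of (space N) (sets N) (\<lambda>A. ennreal (f A))"
  ultimately have e: "emeasure N' A = ennreal (f A)" if "A \<in> sets N" for A
    unfolding N'_def by (intro emeasure_measure_of_sigma sets.sigma_algebra_axioms pos that)
  have s: "sets N' = sets N" "space N' = space N" by (simp_all add: N'_def)
  show thesis
  proof
    show "finite_measure N'" by (rule finite_measureI) (simp add: s e)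
    show "measure N' A = f A" if "A \<in> sets N" for A
      using that by (simp add: measure_def e nonneg)
    show "absolutely_continuous N N'"
    proof (unfold absolutely_continuous_def, rule subsetI)
      fix A assume "A \<in> null_sets N"
      then have "A \<in> sets N" "measure N A = 0" by (auto simp: null_sets_def measure_def)
      then show "A \<in> null_sets N'" using dom[of A] nonneg[of A] by (auto simp: null_sets_def s e)
    qed
  qed (fact s(1))
qed

section \<open>Finite approximations of the cost\<close>

text \<open>The maximum over n \<le> m is written as a recursion so that measurability, continuity
  and the comparison with \<open>c\<close> go by induction on m.\<close>

primrec seq_cost :: "(nat \<Rightarrow> 's \<Rightarrow> real) \<Rightarrow> nat \<Rightarrow> 's \<Rightarrow> 's \<Rightarrow> real" where
  "seq_cost f 0 x y = \<bar>f 0 x - f 0 y\<bar>"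
| "seq_cost f (Suc m) x y = max (seq_cost f m x y) \<bar>f (Suc m) x - f (Suc m) y\<bar>"

lemma seq_cost_le_iff: "seq_cost f m x y \<le> r \<longleftrightarrow> (\<forall>n\<le>m. \<bar>f n x - f n y\<bar> \<le> r)"
  by (induction m) (auto simp: le_Suc_eq)

lemma abs_le_seq_cost: "n \<le> m \<Longrightarrow> \<bar>f n x - f n y\<bar> \<le> seq_cost f m x y"
  using seq_cost_le_iff[of f m x y "seq_cost f m x y"] by simp

lemma seq_cost_nonneg: "0 \<le> seq_cost f m x y"
  using abs_le_seq_cost[of 0 m f x y] by simp

lemma seq_cost_refl [simp]: "seq_cost f m x x = 0"
  by (induction m) auto

lemma seq_cost_commute: "seq_cost f m x y = seq_cost f m y x"
  by (induction m) (auto simp: abs_minus_commute)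

lemma seq_cost_triangle: "seq_cost f m x z \<le> seq_cost f m x y + seq_cost f m y z"
proof (subst seq_cost_le_iff, intro allI impI)
  fix n assume "n \<le> m"
  then show "\<bar>f n x - f n z\<bar> \<le> seq_cost f m x y + seq_cost f m y z"
    using abs_le_seq_cost[of n m f x y] abs_le_seq_cost[of n m f y z] by linarith
qed

lemma seq_cost_perturb:
  "seq_cost f m x y \<le> seq_cost f m x' y' + seq_cost f m x x' + seq_cost f m y y'"
  using seq_cost_triangle[of f m x y x'] seq_cost_triangle[of f m x' y y'] seq_cost_commute[of f m y y']
  by linarith

lemma seq_cost_mono: "m \<le> m' \<Longrightarrow> seq_cost f m x y \<le> seq_cost f m' x y"
  by (auto simp: seq_cost_le_iff intro: abs_le_seq_cost)

lemma borel_measurable_seq_cost [measurable (raw)]: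
  assumes "\<And>n. f n \<in> borel_measurable N" and [measurable]: "g \<in> M \<rightarrow>\<^sub>M N" "h \<in> M \<rightarrow>\<^sub>M N"
  shows "(\<lambda>w. seq_cost f m (g w) (h w)) \<in> borel_measurable M"
proof -
  note [measurable] = assms(1)
  show ?thesis by (induction m) auto
qed

lemma continuous_on_seq_cost:
  assumes "\<And>n. continuous_on A (f n)"
  shows "continuous_on A (\<lambda>x. seq_cost f m x y)"
  by (induction m) (auto intro!: continuous_intros assms)

lemma seq_cost_bounded:
  assumes "\<And>n. bounded (range (f n))"
  obtains B where "\<And>x y. seq_cost f m x y \<le> B"
proof -
  have "\<exists>B. \<forall>x y. \<bar>f n x - f n y\<bar> \<le> B" for n
  proof -
    obtain b where b: "\<bar>f n x\<bar> \<le> b" for x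
      using assms[of n] by (auto simp: bounded_iff)
    have "\<bar>f n x - f n y\<bar> \<le> 2 * b" for x y
      using b[of x] b[of y] by linarith
    then show ?thesis by blast
  qed
  then obtain B where B: "\<bar>f n x - f n y\<bar> \<le> B n" for n x y by metis
  have "seq_cost f m x y \<le> (\<Sum>n\<le>m. B n)" for x y
  proof (subst seq_cost_le_iff, intro allI impI)
    fix n assume "n \<le> m"
    moreover have "0 \<le> B n" for n using B[of n x y] by linarith
    ultimately show "\<bar>f n x - f n y\<bar> \<le> (\<Sum>n\<le>m. B n)"
      using member_le_sum[of n "{..m}" B] B[of n x y] by fastforce
  qed
  then show thesis by (rule that)
qed

text \<open>Rounding the first m+1 functions to a grid of width 1/(k+1). Integer lists are one
  countable label type for all m and k, which keeps the set of representatives of all cells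
  countable.\<close>

definition cell :: "(nat \<Rightarrow> 's \<Rightarrow> real) \<Rightarrow> nat \<Rightarrow> nat \<Rightarrow> 's \<Rightarrow> int list" where
  "cell f m k x = map (\<lambda>n. \<lfloor>real (Suc k) * f n x\<rfloor>) [0..<Suc m]"

definition cell_point :: "(nat \<Rightarrow> 's \<Rightarrow> real) \<Rightarrow> nat \<Rightarrow> nat \<Rightarrow> int list \<Rightarrow> 's" where
  "cell_point f m k i = (SOME x. cell f m k x = i)"

lemma cell_cell_point: "i \<in> range (cell f m k) \<Longrightarrow> cell f m k (cell_point f m k i) = i"
  unfolding cell_point_def by (rule someI_ex) auto

lemma seq_cost_same_cell:
  assumes "cell f m k x = cell f m k y"
  shows "seq_cost f m x y \<le> 1 / real (Suc k)"
proof (subst seq_cost_le_iff, intro allI impI)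
  fix n assume "n \<le> m"
  then have "\<lfloor>real (Suc k) * f n x\<rfloor> = \<lfloor>real (Suc k) * f n y\<rfloor>"
    using assms by (auto simp: cell_def simp del: upt_Suc)
  then have "\<bar>real (Suc k) * f n x - real (Suc k) * f n y\<bar> \<le> 1" by linarith
  then have "\<bar>real (Suc k) * (f n x - f n y)\<bar> \<le> 1" by (simp only: right_diff_distrib)
  then have "real (Suc k) * \<bar>f n x - f n y\<bar> \<le> 1" by (simp only: abs_mult abs_of_nat)
  then show "\<bar>f n x - f n y\<bar> \<le> 1 / real (Suc k)" by (simp add: field_simps)
qed

lemma seq_cost_cell_point:
  "seq_cost f m x (cell_point f m k (cell f m k x)) \<le> 1 / real (Suc k)"
  "seq_cost f m (cell_point f m k (cell f m k x)) x \<le> 1 / real (Suc k)"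
  by (rule seq_cost_same_cell, rule cell_cell_point[symmetric], simp)
    (rule seq_cost_same_cell, rule cell_cell_point, simp)

lemma finite_range_cell:
  assumes "\<And>n. bounded (range (f n))"
  shows "finite (range (cell f m k))"
proof -
  obtain b where b: "\<bar>f n x\<bar> \<le> b n" for n x
    using assms by (simp add: bounded_iff) metis
  define B where "B = (\<Union>n\<le>m. {- \<lceil>real (Suc k) * b n\<rceil> - 1..\<lceil>real (Suc k) * b n\<rceil>})"
  have "cell f m k x \<in> {xs. set xs \<subseteq> B \<and> length xs = Suc m}" for x
  proof -
    have "\<lfloor>real (Suc k) * f n x\<rfloor> \<in> B" if "n \<le> m" for n
    proof -
      have "\<bar>real (Suc k) * f n x\<bar> \<le> real (Suc k) * b n"
        using b[of n x] by (simp only: abs_mult abs_of_nat) (rule mult_left_mono, simp_all)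
      then have "\<lfloor>real (Suc k) * f n x\<rfloor> \<in> {- \<lceil>real (Suc k) * b n\<rceil> - 1..\<lceil>real (Suc k) * b n\<rceil>}"
        unfolding atLeastAtMost_iff by linarith
      then show ?thesis using that by (auto simp: B_def)
    qed
    then show ?thesis by (auto simp: cell_def simp del: upt_Suc)
  qed
  moreover have "finite {xs. set xs \<subseteq> B \<and> length xs = Suc m}"
    by (rule finite_lists_length_eq) (simp add: B_def)
  ultimately show ?thesis by (blast intro: finite_subset)
qed

lemma measurable_cell [measurable]:
  assumes "\<And>n. f n \<in> borel_measurable N"
  shows "cell f m k \<in> N \<rightarrow>\<^sub>M count_space UNIV"
proof (subst measurable_count_space_eq_countable, safe)
  note [measurable] = assms
  fix i
  have "cell f m k -` {i} \<inter> space N = {x \<in> space N. length i = Suc m \<and>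
      (\<forall>n\<in>{..<Suc m}. \<lfloor>real (Suc k) * f n x\<rfloor> = i ! n)}"
    by (auto simp: cell_def list_eq_iff_nth_eq simp del: upt_Suc)
  then show "cell f m k -` {i} \<inter> space N \<in> sets N" by simp
qed auto

lemma Min_perturb:
  fixes a b :: "'i \<Rightarrow> real"
  assumes "finite L" "L \<noteq> {}" and e: "\<And>l. l \<in> L \<Longrightarrow> a l \<le> b l + e"
  shows "Min (a ` L) \<le> Min (b ` L) + e"
proof -
  have "Min (b ` L) \<in> b ` L" using assms by simp
  then obtain l where "l \<in> L" "Min (b ` L) = b l" by auto
  moreover have "Min (a ` L) \<le> a l" using \<open>l \<in> L\<close> assms(1) by simp
  ultimately show ?thesis using e[of l] by linarith
qed

text \<open>These are the c_m-transforms of finitely supported potentials. Centres are cell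
  representatives of arbitrary scale and offsets are rational, which gives countability; a finite
  minimum keeps the c_m-Lipschitz property.\<close>

definition min_costs :: "(nat \<Rightarrow> 's \<Rightarrow> real) \<Rightarrow> ('s \<Rightarrow> real) set" where
  "min_costs f = (\<lambda>(m, L) x. Min ((\<lambda>(s, r). seq_cost f m x s - r) ` L)) `
     (UNIV \<times> {L. finite L \<and> L \<noteq> {} \<and> L \<subseteq> range (\<lambda>(m, k, i). cell_point f m k i) \<times> \<rat>})"

lemma countable_min_costs: "countable (min_costs f)"
proof -
  have "countable (range (\<lambda>(m, k, i). cell_point f m k i) \<times> (\<rat> :: real set))"
    by (simp add: countable_rat)
  from countable_Collect_finite_subset[OF this] show ?thesis
    unfolding min_costs_def
    by (intro countable_image countable_SIGMA countableI_type) (auto elim: countable_subset[rotated])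
qed

lemma min_costsE:
  assumes "G \<in> min_costs f"
  obtains m L where "finite L" "L \<noteq> {}" "G = (\<lambda>x. Min ((\<lambda>(s, r). seq_cost f m x s - r) ` L))"
  using assms by (auto simp: min_costs_def)

lemma min_costs_Lipschitz:
  assumes "G \<in> min_costs f"
  obtains m where "\<And>x y. \<bar>G x - G y\<bar> \<le> seq_cost f m x y"
proof -
  from assms obtain m L where L: "finite L" "L \<noteq> {}"
    and G: "G = (\<lambda>x. Min ((\<lambda>(s, r). seq_cost f m x s - r) ` L))" by (rule min_costsE)
  have "G x \<le> G y + seq_cost f m x y" for x y
    unfolding G by (rule Min_perturb[OF L]) (use seq_cost_triangle[of f m x _ y] in \<open>auto simp: algebra_simps\<close>)
  then have "\<bar>G x - G y\<bar> \<le> seq_cost f m x y" for x y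
    using seq_cost_commute[of f m x y] by (smt (verit))
  then show thesis by (rule that)
qed

lemma min_costs_bounded:
  assumes "G \<in> min_costs f" "\<And>n. bounded (range (f n))"
  shows "bounded (range G)"
proof -
  obtain m where m: "\<bar>G x - G y\<bar> \<le> seq_cost f m x y" for x y
    using min_costs_Lipschitz assms(1) by blast
  obtain B where B: "seq_cost f m x y \<le> B" for x y
    using seq_cost_bounded assms(2) by blast
  have "\<bar>G x\<bar> \<le> B + \<bar>G undefined\<bar>" for x
    using m[of x undefined] B[of x undefined] by linarith
  then show ?thesis by (auto simp: bounded_iff)
qed

lemma min_costs_measurable:
  assumes "G \<in> min_costs f" "\<And>n. f n \<in> borel_measurable N"
  shows "G \<in> borel_measurable N"
proof -
  from assms(1) obtain m L where L: "finite L" "L \<noteq> {}"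
    and G: "G = (\<lambda>x. Min ((\<lambda>(s, r). seq_cost f m x s - r) ` L))" by (rule min_costsE)
  have c: "(\<lambda>x. seq_cost f m x s) \<in> borel_measurable N" for s
  proof -
    note [measurable] = assms(2)
    show ?thesis by (induction m) auto
  qed
  show ?thesis unfolding G using L
    by (induction L rule: finite_ne_induct) (auto intro!: borel_measurable_min borel_measurable_diff c)
qed

lemma min_costs_continuous:
  assumes "G \<in> min_costs f" "\<And>n. continuous_on A (f n)"
  shows "continuous_on A G"
proof -
  from assms(1) obtain m L where L: "finite L" "L \<noteq> {}"
    and G: "G = (\<lambda>x. Min ((\<lambda>(s, r). seq_cost f m x s - r) ` L))" by (rule min_costsE)
  show ?thesis unfolding G using L
    by (induction L rule: finite_ne_induct)
      (auto intro!: continuous_intros continuous_on_seq_cost assms(2))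
qed

text \<open>Lowering each \<open>h j\<close> to a rational number less than \<open>e\<close> below
  it raises every competitor in the minimum by less than \<open>e\<close>.\<close>

lemma min_costs_approx:
  assumes "finite J" "J \<noteq> {}" "0 < e"
  obtains G where "G \<in> min_costs f"
    "\<And>x. \<bar>G x - Min ((\<lambda>j. seq_cost f m x (cell_point f m k j) - h j) ` J)\<bar> \<le> e"
proof -
  have "\<exists>r\<in>\<rat>. h j - e < r \<and> r < h j" for j
    using Rats_dense_in_real[of "h j - e" "h j"] assms(3) by simp
  then obtain r where r: "r j \<in> \<rat>" "h j - e < r j" "r j < h j" for j by metis
  let ?L = "(\<lambda>j. (cell_point f m k j, r j)) ` J"
  let ?G = "\<lambda>x. Min ((\<lambda>(s, r). seq_cost f m x s - r) ` ?L)"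
  have "?G = (\<lambda>(m, L) x. Min ((\<lambda>(s, r). seq_cost f m x s - r) ` L)) (m, ?L)" by simp
  moreover have "(m, ?L) \<in> UNIV \<times> {L. finite L \<and> L \<noteq> {} \<and>
      L \<subseteq> range (\<lambda>(m, k, i). cell_point f m k i) \<times> \<rat>}"
    using assms(1,2) r(1) by (auto intro!: image_eqI[of _ _ "(m, k, _)"])
  ultimately have "?G \<in> min_costs f" unfolding min_costs_def by (rule image_eqI)
  moreover have "\<bar>?G x - Min ((\<lambda>j. seq_cost f m x (cell_point f m k j) - h j) ` J)\<bar> \<le> e" for x
  proof -
    have G: "?G x = Min ((\<lambda>j. seq_cost f m x (cell_point f m k j) - r j) ` J)"
      by (simp add: image_image)
    have "?G x \<le> Min ((\<lambda>j. seq_cost f m x (cell_point f m k j) - h j) ` J) + e"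
      unfolding G by (rule Min_perturb[OF assms(1,2)]) (use r(2) in \<open>simp add: algebra_simps less_imp_le\<close>)
    moreover have "Min ((\<lambda>j. seq_cost f m x (cell_point f m k j) - h j) ` J) \<le> ?G x + 0"
      unfolding G by (rule Min_perturb[OF assms(1,2)]) (use r(3) in \<open>simp add: less_imp_le\<close>)
    ultimately show ?thesis using assms(3) by linarith
  qed
  ultimately show thesis by (rule that)
qed

section \<open>Plans for finite subalgebras\<close>

lemma sum_swap3:
  "(\<Sum>i\<in>A. \<Sum>j\<in>B. \<Sum>k\<in>C. F i j k) = (\<Sum>k\<in>C. \<Sum>i\<in>A. \<Sum>j\<in>B. F i j k)"
proof -
  have "(\<Sum>j\<in>B. \<Sum>k\<in>C. F i j k) = (\<Sum>k\<in>C. \<Sum>j\<in>B. F i j k)" for i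
    by (rule sum.swap)
  then show ?thesis by (simp only:) (rule sum.swap)
qed

lemma integral_cells:
  fixes F :: "'a \<Rightarrow> real"
  assumes "finite I" "\<And>x. x \<in> space N \<Longrightarrow> c x \<in> I"
    and c: "\<And>i. i \<in> I \<Longrightarrow> {x \<in> space N. c x = i} \<in> sets N" and F: "integrable N F"
  shows "(\<integral>x. F x \<partial>N) = (\<Sum>i\<in>I. \<integral>x. indicator {x \<in> space N. c x = i} x * F x \<partial>N)"
proof -
  have "integrable N (\<lambda>x. indicator {x \<in> space N. c x = i} x * F x)" if "i \<in> I" for i
    using integrable_mult_indicator[OF c[OF that] F] by simp
  then have "(\<Sum>i\<in>I. \<integral>x. indicator {x \<in> space N. c x = i} x * F x \<partial>N) =
      (\<integral>x. (\<Sum>i\<in>I. indicator {x \<in> space N. c x = i} x * F x) \<partial>N)"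
    by (subst Bochner_Integration.integral_sum) auto
  also have "\<dots> = (\<integral>x. F x \<partial>N)"
  proof (rule Bochner_Integration.integral_cong[OF refl])
    fix x assume x: "x \<in> space N"
    then have "(\<Sum>i\<in>I. indicator {x \<in> space N. c x = i} x * F x) = (\<Sum>i\<in>I. if i = c x then F x else 0)"
      by (intro sum.cong) (auto simp: indicator_def)
    then show "(\<Sum>i\<in>I. indicator {x \<in> space N. c x = i} x * F x) = F x"
      using assms(1,2) x by simp
  qed
  finally show ?thesis ..
qed

lemma (in finite_measure) integrable_indicator_event [simp]:
  "A \<in> sets M \<Longrightarrow> integrable M (indicat_real A)"
  by (simp add: integrable_indicator_iff less_top[symmetric])

lemma (in finite_measure) measure_cells:
  assumes "finite I" "\<And>x. x \<in> space M \<Longrightarrow> c x \<in> I"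
    and c: "\<And>i. i \<in> I \<Longrightarrow> {x \<in> space M. c x = i} \<in> sets M" and A: "A \<in> sets M"
  shows "measure M A = (\<Sum>i\<in>I. measure M (A \<inter> {x \<in> space M. c x = i}))"
proof -
  have "measure M A = (\<integral>x. indicator A x \<partial>M)" using A by simp
  also have "\<dots> = (\<Sum>i\<in>I. \<integral>x. indicator {x \<in> space M. c x = i} x * indicator A x \<partial>M)"
    by (rule integral_cells[OF assms(1,2) c]) (use A in auto)
  also have "\<dots> = (\<Sum>i\<in>I. measure M (A \<inter> {x \<in> space M. c x = i}))"
  proof (rule sum.cong[OF refl])
    fix i assume "i \<in> I"
    then have "A \<inter> {x \<in> space M. c x = i} \<in> sets M" using A c by auto
    then show "(\<integral>x. indicator {x \<in> space M. c x = i} x * indicator A x \<partial>M) =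
        measure M (A \<inter> {x \<in> space M. c x = i})"
      by (simp add: Int_commute flip: indicator_inter_arith)
  qed
  finally show ?thesis .
qed

text \<open>The left side integrates over \<open>E\<close> a function constant on cells. This is the
  passage from a discrete dual objective to integrals of genuine potentials.\<close>

lemma (in finite_measure) sum_cells_le_integral:
  fixes F :: "'a \<Rightarrow> real"
  assumes "finite I" "\<And>x. x \<in> space M \<Longrightarrow> c x \<in> I"
    and c: "\<And>i. i \<in> I \<Longrightarrow> {x \<in> space M. c x = i} \<in> sets M" and E: "E \<in> sets M" and F: "integrable M F"
    and le: "\<And>x. x \<in> E \<Longrightarrow> a (c x) \<le> F x"
  shows "(\<Sum>i\<in>I. a i * measure M (E \<inter> {x \<in> space M. c x = i})) \<le> (\<integral>x. indicator E x * F x \<partial>M)"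
proof -
  have F': "integrable M (\<lambda>x. indicator E x * F x)"
    using integrable_mult_indicator[OF E F] by simp
  have "a i * measure M (E \<inter> {x \<in> space M. c x = i})
      \<le> (\<integral>x. indicator {x \<in> space M. c x = i} x * (indicator E x * F x) \<partial>M)" if "i \<in> I" for i
  proof -
    have m: "E \<inter> {x \<in> space M. c x = i} \<in> sets M" using E c[OF that] by auto
    then have "a i * measure M (E \<inter> {x \<in> space M. c x = i}) =
        (\<integral>x. a i * indicator (E \<inter> {x \<in> space M. c x = i}) x \<partial>M)" by simp
    also have "\<dots> \<le> (\<integral>x. indicator {x \<in> space M. c x = i} x * (indicator E x * F x) \<partial>M)"
    proof (rule integral_mono)
      show "integrable M (\<lambda>x. a i * indicator (E \<inter> {x \<in> space M. c x = i}) x)" using m by simp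
      show "integrable M (\<lambda>x. indicator {x \<in> space M. c x = i} x * (indicator E x * F x))"
        using integrable_mult_indicator[OF c[OF that] F'] by simp
    qed (use le in \<open>auto simp: indicator_def\<close>)
    finally show ?thesis .
  qed
  then show ?thesis
    by (subst integral_cells[OF assms(1,2) c F']) (auto intro: sum_mono)
qed

text \<open>\<open>budget\<close> is the inequality \<integral> G d\<kappa> - \<integral> G d\<mu>
  \<le> b integrated over events of \<open>M\<close>, written without the kernel \<kappa>. It has no
  absolute value because only this sign occurs in the dual value. The locale serves three instances:
  \<open>b\<close> the distance of the conditional law, \<open>b\<close> constant over the trivial
  \<sigma>-algebra, and the zero cost.\<close>

locale transport_setting = prob_space P + \<mu>: prob_space \<mu>
  for P :: "'w measure" and \<mu> :: "'s::topological_space measure" +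
  fixes M :: "'w measure" and X :: "'w \<Rightarrow> 's" and f :: "nat \<Rightarrow> 's \<Rightarrow> real" and b :: "'w \<Rightarrow> real"
  assumes subalg: "subalgebra P M"
    and X [measurable]: "X \<in> P \<rightarrow>\<^sub>M borel"
    and sets_\<mu> [measurable_cong, simp]: "sets \<mu> = sets borel"
    and f [measurable]: "\<And>n. f n \<in> borel_measurable borel"
    and bounded_f: "\<And>n. bounded (range (f n))"
    and b: "integrable P b"
    and budget: "\<And>G E. G \<in> min_costs f \<Longrightarrow> E \<in> sets M \<Longrightarrow>
      (\<integral>\<omega>. indicator E \<omega> * G (X \<omega>) \<partial>P) - prob E * (\<integral>y. G y \<partial>\<mu>) \<le> (\<integral>\<omega>. indicator E \<omega> * b \<omega> \<partial>P)"
begin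

lemma space_\<mu> [simp]: "space \<mu> = UNIV"
  using sets_eq_imp_space_eq[OF sets_\<mu>] by simp

lemma sets_M: "E \<in> sets M \<Longrightarrow> E \<in> events"
  using subalg by (auto simp: subalgebra_def)

abbreviation "Xcell m k i \<equiv> {\<omega> \<in> space P. cell f m k (X \<omega>) = i}"
abbreviation "Ycell m k i \<equiv> {y. cell f m k y = i}"

lemma cell_sets [measurable]: "Xcell m k i \<in> events" "Ycell m k i \<in> sets borel"
proof -
  have "cell f m k \<in> borel \<rightarrow>\<^sub>M count_space UNIV" by measurable
  from measurable_sets[OF measurable_compose[OF X this], of "{i}"] measurable_sets[OF this, of "{i}"]
  show "Xcell m k i \<in> events" "Ycell m k i \<in> sets borel"
    by (auto simp: vimage_def Int_def conj_commute)
qed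

text \<open>Mass sent to a target cell is later spread by the conditional law of \<mu> given that
  cell, which requires positive mass.\<close>

definition charged :: "nat \<Rightarrow> nat \<Rightarrow> int list set" where
  "charged m k = {j \<in> range (cell f m k). 0 < \<mu>.prob (Ycell m k j)}"

text \<open>\<open>l * h j\<close> is the defect of the second marginal from independence on
  \<open>E\<close>. The tolerance 4e consists, for each of the two marginals, of e for moving to a
  cell representative and e for making the potential rational.\<close>

definition local_plan ::
  "'w set \<Rightarrow> nat \<Rightarrow> nat \<Rightarrow> real \<Rightarrow> real \<Rightarrow> (int list \<Rightarrow> int list \<Rightarrow> real) \<Rightarrow> (int list \<Rightarrow> real) \<Rightarrow> bool" where
  "local_plan E m k e l w h \<longleftrightarrow>
    (\<forall>i\<in>range (cell f m k). \<forall>j\<in>charged m k. 0 \<le> w i j) \<and>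
    (\<forall>i\<in>range (cell f m k). (\<Sum>j\<in>charged m k. w i j) = prob (E \<inter> Xcell m k i)) \<and>
    (\<forall>j\<in>charged m k. l * h j = prob E * \<mu>.prob (Ycell m k j) - (\<Sum>i\<in>range (cell f m k). w i j)) \<and>
    (\<Sum>i\<in>range (cell f m k). \<Sum>j\<in>charged m k.
        w i j * seq_cost f m (cell_point f m k i) (cell_point f m k j)) + l * (\<Sum>j\<in>charged m k. (h j)\<^sup>2)
      \<le> (\<integral>\<omega>. indicator E \<omega> * b \<omega> \<partial>P) + 4 * e * prob E"

text \<open>The minimum \<open>g\<close> of the functions c_m(., s_j) - h j is c_m-Lipschitz, and
  its value at s_j is at most - h j because the cost vanishes on the diagonal. So \<open>g\<close>
  bounds both parts of the dual value, and \<open>budget\<close> applies to a member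
  \<open>G\<close> of \<open>min_costs f\<close> close to it.\<close>

lemma budget_local:
  assumes E: "E \<in> sets M" and e: "0 < e" and k: "1 / real (Suc k) \<le> e" and l: "0 < l"
  shows "\<exists>w h. local_plan E m k e l w h"
proof -
  let ?pt = "cell_point f m k"
  define I J where "I = range (cell f m k)" and "J = charged m k"
  have J_def': "J = {j \<in> I. 0 < \<mu>.prob (Ycell m k j)}" by (simp add: J_def I_def charged_def)
  have [measurable]: "E \<in> events" using E by (rule sets_M)
  have I: "finite I" unfolding I_def by (rule finite_range_cell[OF bounded_f])
  have cellI: "cell f m k x \<in> I" for x by (simp add: I_def)
  have J: "finite J" "J \<subseteq> I" using I by (auto simp: J_def')
  have q: "(\<Sum>j\<in>J. a j * \<mu>.prob (Ycell m k j)) = (\<Sum>j\<in>I. a j * \<mu>.prob (Ycell m k j))" for a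
    using I by (intro sum.mono_neutral_left) (auto simp: J_def' not_less measure_le_0_iff)
  have "\<mu>.prob UNIV = (\<Sum>j\<in>I. \<mu>.prob (UNIV \<inter> Ycell m k j))"
    using \<mu>.measure_cells[OF I, of "cell f m k" UNIV] cellI by simp
  then have "(\<Sum>j\<in>J. 1 * \<mu>.prob (Ycell m k j)) = 1"
    unfolding q using \<mu>.prob_space by simp
  then have "J \<noteq> {}" by force
  obtain w h where wh: "\<And>i j. i \<in> I \<Longrightarrow> j \<in> J \<Longrightarrow> 0 \<le> w i j"
    "\<And>i. i \<in> I \<Longrightarrow> (\<Sum>j\<in>J. w i j) = prob (E \<inter> Xcell m k i)"
    "\<And>j. j \<in> J \<Longrightarrow> l * h j = prob E * \<mu>.prob (Ycell m k j) - (\<Sum>i\<in>I. w i j)"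
    "(\<Sum>i\<in>I. \<Sum>j\<in>J. w i j * seq_cost f m (?pt i) (?pt j)) + l * (\<Sum>j\<in>J. (h j)\<^sup>2)
      \<le> (\<Sum>i\<in>I. prob (E \<inter> Xcell m k i) * Min ((\<lambda>j. seq_cost f m (?pt i) (?pt j) - h j) ` J))
        + (\<Sum>j\<in>J. h j * (prob E * \<mu>.prob (Ycell m k j)))"
    by (rule penalised_transport[OF I J(1) \<open>J \<noteq> {}\<close> _ l,
          of "\<lambda>i. prob (E \<inter> Xcell m k i)" "\<lambda>j. prob E * \<mu>.prob (Ycell m k j)"
             "\<lambda>i j. seq_cost f m (?pt i) (?pt j)"]) auto
  define g where "g x = Min ((\<lambda>j. seq_cost f m x (?pt j) - h j) ` J)" for x
  obtain G where G: "G \<in> min_costs f" "\<bar>G x - g x\<bar> \<le> e" for x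
    unfolding g_def using min_costs_approx[OF J(1) \<open>J \<noteq> {}\<close> e] by blast
  have g_Lip: "g x \<le> g y + seq_cost f m x y" for x y
    unfolding g_def
    by (rule Min_perturb[OF J(1) \<open>J \<noteq> {}\<close>]) (use seq_cost_triangle[of f m x _ y] in \<open>auto simp: algebra_simps\<close>)
  have same: "seq_cost f m (?pt (cell f m k x)) x \<le> e" "seq_cost f m x (?pt (cell f m k x)) \<le> e" for x
    using seq_cost_cell_point(1)[of f m x k] seq_cost_cell_point(2)[of f m k x] k by linarith+
  note [measurable] = min_costs_measurable[OF G(1) f]
  obtain B where B: "\<bar>G x\<bar> \<le> B" for x
    using min_costs_bounded[OF G(1) bounded_f] by (auto simp: bounded_iff)
  have int: "integrable P (\<lambda>\<omega>. G (X \<omega>))" "integrable \<mu> G"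
    by (auto intro!: integrable_const_bound[of _ B] \<mu>.integrable_const_bound[of _ B] simp: B)
  have "(\<Sum>i\<in>I. g (?pt i) * prob (E \<inter> Xcell m k i)) \<le> (\<integral>\<omega>. indicator E \<omega> * (G (X \<omega>) + 2 * e) \<partial>P)"
  proof (rule sum_cells_le_integral[OF I])
    show "g (?pt (cell f m k (X x))) \<le> G (X x) + 2 * e" for x
      using g_Lip[of "?pt (cell f m k (X x))" "X x"] same(1)[of "X x"] G(2)[of "X x"] by linarith
  qed (use int in \<open>auto simp: cellI\<close>)
  also have "\<dots> = (\<integral>\<omega>. indicator E \<omega> * G (X \<omega>) + 2 * e * indicator E \<omega> \<partial>P)"
    by (simp add: algebra_simps)
  also have "\<dots> = (\<integral>\<omega>. indicator E \<omega> * G (X \<omega>) \<partial>P) + 2 * e * prob E"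
    using integrable_mult_indicator[OF _ int(1), of E]
    by (subst Bochner_Integration.integral_add) (auto intro!: integrable_mult_right)
  finally have 1: "(\<Sum>i\<in>I. prob (E \<inter> Xcell m k i) * g (?pt i))
      \<le> (\<integral>\<omega>. indicator E \<omega> * G (X \<omega>) \<partial>P) + 2 * e * prob E" by (simp add: mult.commute)
  have "(\<Sum>j\<in>J. h j * \<mu>.prob (Ycell m k j)) \<le> (\<Sum>j\<in>J. - g (?pt j) * \<mu>.prob (Ycell m k j))"
  proof (intro sum_mono mult_right_mono)
    fix j assume "j \<in> J"
    then have "g (?pt j) \<le> seq_cost f m (?pt j) (?pt j) - h j"
      unfolding g_def using J(1) by (intro Min_le) (auto simp del: seq_cost_refl)
    then show "h j \<le> - g (?pt j)" by simp
  qed simp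
  also have "\<dots> = (\<Sum>j\<in>I. - g (?pt j) * \<mu>.prob (UNIV \<inter> {y \<in> space \<mu>. cell f m k y = j}))"
    unfolding q by simp
  also have "\<dots> \<le> (\<integral>y. indicator UNIV y * (2 * e - G y) \<partial>\<mu>)"
  proof (rule \<mu>.sum_cells_le_integral[OF I])
    show "- g (?pt (cell f m k x)) \<le> 2 * e - G x" for x
      using g_Lip[of x "?pt (cell f m k x)"] same(2)[of x] G(2)[of x] by linarith
  qed (use int in \<open>auto simp: cellI\<close>)
  also have "\<dots> = 2 * e - (\<integral>y. G y \<partial>\<mu>)" using int \<mu>.prob_space by simp
  finally have "prob E * (\<Sum>j\<in>J. h j * \<mu>.prob (Ycell m k j)) \<le> prob E * (2 * e - (\<integral>y. G y \<partial>\<mu>))"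
    by (rule mult_left_mono) simp
  then have "(\<Sum>j\<in>J. h j * (prob E * \<mu>.prob (Ycell m k j))) \<le> 2 * e * prob E - prob E * (\<integral>y. G y \<partial>\<mu>)"
    by (simp add: sum_distrib_left algebra_simps)
  with 1 budget[OF G(1) E] wh(4) have "(\<Sum>i\<in>I. \<Sum>j\<in>J. w i j * seq_cost f m (?pt i) (?pt j)) + l * (\<Sum>j\<in>J. (h j)\<^sup>2)
      \<le> (\<integral>\<omega>. indicator E \<omega> * b \<omega> \<partial>P) + 4 * e * prob E"
    by (simp add: g_def)
  then have "local_plan E m k e l w h"
    unfolding local_plan_def I_def[symmetric] J_def[symmetric] by (intro conjI ballI wh(1-3))
  then show ?thesis by blast
qed

text \<open>Only finite additivity is demanded, since countable additivity is not a closed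
  condition. The argument is a pair, so that a plan is a point of one product space; values at
  non-measurable pairs are free.\<close>

definition biadditive :: "('w set \<times> 's set \<Rightarrow> real) \<Rightarrow> bool" where
  "biadditive \<nu> \<longleftrightarrow>
    (\<forall>A C. A \<in> events \<longrightarrow> C \<in> sets borel \<longrightarrow> 0 \<le> \<nu> (A, C)) \<and>
    (\<forall>A. A \<in> events \<longrightarrow> \<nu> (A, UNIV) = prob A) \<and>
    (\<forall>A B C. A \<in> events \<longrightarrow> B \<in> events \<longrightarrow> C \<in> sets borel \<longrightarrow> A \<inter> B = {} \<longrightarrow>
      \<nu> (A \<union> B, C) = \<nu> (A, C) + \<nu> (B, C)) \<and>
    (\<forall>A C D. A \<in> events \<longrightarrow> C \<in> sets borel \<longrightarrow> D \<in> sets borel \<longrightarrow> C \<inter> D = {} \<longrightarrow>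
      \<nu> (A, C \<union> D) = \<nu> (A, C) + \<nu> (A, D))"

text \<open>A Riemann sum for the integral of c_m against a plan. It makes sense for finitely
  additive plans and involves finitely many coordinates of \<nu>, so that bounding it is a closed
  condition.\<close>

definition cell_cost :: "nat \<Rightarrow> nat \<Rightarrow> ('w set \<times> 's set \<Rightarrow> real) \<Rightarrow> real" where
  "cell_cost m k \<nu> = (\<Sum>i\<in>range (cell f m k). \<Sum>j\<in>range (cell f m k).
    \<nu> (Xcell m k i, Ycell m k j) * seq_cost f m (cell_point f m k i) (cell_point f m k j))"

lemma biadditiveD:
  assumes "biadditive \<nu>"
  shows "A \<in> events \<Longrightarrow> C \<in> sets borel \<Longrightarrow> 0 \<le> \<nu> (A, C)"
    and "A \<in> events \<Longrightarrow> \<nu> (A, UNIV) = prob A"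
    and "A \<in> events \<Longrightarrow> B \<in> events \<Longrightarrow> C \<in> sets borel \<Longrightarrow> A \<inter> B = {} \<Longrightarrow> \<nu> (A \<union> B, C) = \<nu> (A, C) + \<nu> (B, C)"
    and "A \<in> events \<Longrightarrow> C \<in> sets borel \<Longrightarrow> D \<in> sets borel \<Longrightarrow> C \<inter> D = {} \<Longrightarrow> \<nu> (A, C \<union> D) = \<nu> (A, C) + \<nu> (A, D)"
proof -
  note \<nu> = assms[unfolded biadditive_def]
  show "A \<in> events \<Longrightarrow> C \<in> sets borel \<Longrightarrow> 0 \<le> \<nu> (A, C)"
    using \<nu>[THEN conjunct1] by simp
  show "A \<in> events \<Longrightarrow> \<nu> (A, UNIV) = prob A"
    using \<nu>[THEN conjunct2, THEN conjunct1] by simp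
  show "A \<in> events \<Longrightarrow> B \<in> events \<Longrightarrow> C \<in> sets borel \<Longrightarrow> A \<inter> B = {} \<Longrightarrow> \<nu> (A \<union> B, C) = \<nu> (A, C) + \<nu> (B, C)"
    using \<nu>[THEN conjunct2, THEN conjunct2, THEN conjunct1] by simp
  show "A \<in> events \<Longrightarrow> C \<in> sets borel \<Longrightarrow> D \<in> sets borel \<Longrightarrow> C \<inter> D = {} \<Longrightarrow> \<nu> (A, C \<union> D) = \<nu> (A, C) + \<nu> (A, D)"
    using \<nu>[THEN conjunct2, THEN conjunct2, THEN conjunct2] by simp
qed

text \<open>Splitting off the complement in either argument. The first bound gives countable
  additivity in the event, the second in the Borel set.\<close>

lemma biadditive_dominated:
  assumes \<nu>: "biadditive \<nu>" and A: "A \<in> events" and C: "C \<in> sets borel"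
  shows "\<nu> (A, C) \<le> prob A" "\<nu> (A, C) \<le> \<nu> (space P, C)"
proof -
  have C': "- C \<in> sets borel" "C \<inter> - C = {}" using C by auto
  have "\<nu> (A, C) + \<nu> (A, - C) = prob A"
    unfolding biadditiveD(4)[OF \<nu> A C C', symmetric] Compl_partition by (rule biadditiveD(2)[OF \<nu> A])
  with biadditiveD(1)[OF \<nu> A C'(1)] show "\<nu> (A, C) \<le> prob A" by linarith
  have A': "space P - A \<in> events" "A \<inter> (space P - A) = {}" "A \<union> (space P - A) = space P"
    using sets.sets_into_space[OF A] A by auto
  have "\<nu> (space P, C) = \<nu> (A, C) + \<nu> (space P - A, C)"
    using biadditiveD(3)[OF \<nu> A A'(1) C A'(2)] unfolding A'(3) .
  with biadditiveD(1)[OF \<nu> A'(1) C] show "\<nu> (A, C) \<le> \<nu> (space P, C)" by linarith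
qed

text \<open>One local plan is taken on each atom of \<A>, and each of its masses is spread over the
  product of two cells by the conditional laws of \<open>P\<close> and \<mu>. Spreading keeps the
  first marginal exact, and the deviation from independence is a sum of penalty defects. A single
  fine scale for c_m controls all c_m' with m' \<le> m at every scale, because c_m' \<le>
  c_m.\<close>

lemma approximate_plan:
  assumes \<A>: "finite \<A>" "\<A> \<subseteq> sets M" and e: "0 < e"
  obtains \<nu> where "biadditive \<nu>"
    and "\<And>A C. A \<in> \<A> \<Longrightarrow> C \<in> sets borel \<Longrightarrow> \<bar>\<nu> (A, C) - prob A * \<mu>.prob C\<bar> \<le> e"
    and "\<And>m' k. m' \<le> m \<Longrightarrow> cell_cost m' k \<nu> \<le> expectation b + 2 / real (Suc k) + e"
proof -
  \<comment> \<open>Four units \<epsilon> are spent in the local plans, two in comparing points with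
    their representatives at scale \<open>k\<close>.\<close>
  define \<epsilon> where "\<epsilon> = e / 6"
  have \<epsilon>: "0 < \<epsilon>" using e by (simp add: \<epsilon>_def)
  obtain k where k: "1 / real (Suc k) \<le> \<epsilon>"
    using nat_approx_posE[OF \<epsilon>] by (metis less_imp_le)
  define I J where "I = range (cell f m k)" and "J = charged m k"
  have J_def': "J = {j \<in> I. 0 < \<mu>.prob (Ycell m k j)}" by (simp add: J_def I_def charged_def)
  have I: "finite I" unfolding I_def by (rule finite_range_cell[OF bounded_f])
  have cellI: "cell f m k x \<in> I" for x by (simp add: I_def)
  have J: "finite J" "J \<subseteq> I" using I by (auto simp: J_def')
  have q: "(\<Sum>j\<in>J. a j * \<mu>.prob (C \<inter> Ycell m k j)) = (\<Sum>j\<in>I. a j * \<mu>.prob (C \<inter> Ycell m k j))"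
    if [measurable]: "C \<in> sets borel" for C a
  proof (intro sum.mono_neutral_left I J ballI)
    fix j assume "j \<in> I - J"
    moreover have "\<mu>.prob (C \<inter> Ycell m k j) \<le> \<mu>.prob (Ycell m k j)"
      by (intro \<mu>.finite_measure_mono) auto
    ultimately show "a j * \<mu>.prob (C \<inter> Ycell m k j) = 0"
      by (auto simp: J_def' not_less measure_le_0_iff)
  qed
  \<comment> \<open>\<open>R\<close> bounds the cost budget of every atom, hence l times the sum of
    the squares of the potentials. With l = \<delta>^2 / R each defect is then at most \<delta>, and
    \<delta> is small enough for the defects of all atoms and cells to add up to at most
    \<open>e\<close>.\<close>
  define R where "R = (\<integral>\<omega>. \<bar>b \<omega>\<bar> \<partial>P) + 4 * \<epsilon>"
  have R: "0 < R" unfolding R_def using \<epsilon> by (intro add_nonneg_pos) auto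
  define \<delta> where "\<delta> = e / (real (card (Pow \<A>) * card J) + 1)"
  have \<delta>: "0 < \<delta>" unfolding \<delta>_def using e by (intro divide_pos_pos add_nonneg_pos) auto
  define l where "l = \<delta>\<^sup>2 / R"
  have l: "0 < l" using R \<delta> by (simp add: l_def)
  \<comment> \<open>Atoms are indexed by membership patterns, also by those that no point realises,
    so that the index set is simply \<open>Pow \<A>\<close>.\<close>
  define atom where "atom L = {\<omega> \<in> space P. {A \<in> \<A>. \<omega> \<in> A} = L}" for L
  have atom_M: "atom L \<in> sets M" if "L \<in> Pow \<A>" for L
  proof -
    have "atom L = {\<omega> \<in> space M. \<forall>A\<in>\<A>. \<omega> \<in> A \<longleftrightarrow> A \<in> L}"
      using that subalg by (auto simp: atom_def subalgebra_def)
    also have "\<dots> \<in> sets M"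
    proof (rule sets.sets_Collect_finite_All[OF _ \<A>(1)])
      fix A assume "A \<in> \<A>"
      then have "A \<in> sets M" using \<A> by auto
      then show "{\<omega> \<in> space M. (\<omega> \<in> A) = (A \<in> L)} \<in> sets M" by measurable
    qed
    finally show ?thesis .
  qed
  note atom[measurable] = atom_M[THEN sets_M]
  have atomsP: "prob A = (\<Sum>L\<in>Pow \<A>. prob (A \<inter> atom L))" if "A \<in> events" for A
    by (rule measure_cells[of "Pow \<A>" "\<lambda>\<omega>. {A \<in> \<A>. \<omega> \<in> A}" A, folded atom_def])
      (use \<A>(1) atom that in blast)+
  let ?p = "\<lambda>L i. prob (atom L \<inter> Xcell m k i)" and ?q = "\<lambda>j. \<mu>.prob (Ycell m k j)"
  let ?pt = "cell_point f m k"
  let ?d = "\<lambda>i j. seq_cost f m (?pt i) (?pt j)"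
  have "\<forall>L\<in>Pow \<A>. \<exists>w h. local_plan (atom L) m k \<epsilon> l w h"
    using budget_local[OF atom_M \<epsilon> k l] by blast
  then obtain w h where "\<And>L. L \<in> Pow \<A> \<Longrightarrow> local_plan (atom L) m k \<epsilon> l (w L) (h L)" by metis
  note ok = this[unfolded local_plan_def, folded I_def J_def]
  have w0: "0 \<le> w L i j" if "L \<in> Pow \<A>" "i \<in> I" "j \<in> J" for L i j
    by (rule bspec[OF bspec[OF conjunct1[OF ok]]]) (fact that)+
  have w1: "(\<Sum>j\<in>J. w L i j) = ?p L i" if "L \<in> Pow \<A>" "i \<in> I" for L i
    by (rule bspec[OF conjunct1[OF conjunct2[OF ok]]]) (fact that)+
  have h: "l * h L j = prob (atom L) * ?q j - (\<Sum>i\<in>I. w L i j)"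
    if "L \<in> Pow \<A>" "j \<in> J" for L j
    by (rule bspec[OF conjunct1[OF conjunct2[OF conjunct2[OF ok]]]]) (fact that)+
  have wh: "(\<Sum>i\<in>I. \<Sum>j\<in>J. w L i j * ?d i j) + l * (\<Sum>j\<in>J. (h L j)\<^sup>2)
        \<le> (\<integral>\<omega>. indicator (atom L) \<omega> * b \<omega> \<partial>P) + 4 * \<epsilon> * prob (atom L)" if "L \<in> Pow \<A>" for L
    by (rule conjunct2[OF conjunct2[OF conjunct2[OF ok]]]) (fact that)
  have h_small: "\<bar>l * h L j\<bar> \<le> \<delta>" if L: "L \<in> Pow \<A>" and j: "j \<in> J" for L j
  proof -
    have "(\<integral>\<omega>. indicator (atom L) \<omega> * b \<omega> \<partial>P) \<le> (\<integral>\<omega>. \<bar>b \<omega>\<bar> \<partial>P)"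
      using integrable_mult_indicator[OF atom[OF L] b] b
      by (intro integral_mono) (auto simp: indicator_def)
    moreover have "4 * \<epsilon> * prob (atom L) \<le> 4 * \<epsilon>" using \<epsilon> by simp
    moreover have "0 \<le> (\<Sum>i\<in>I. \<Sum>j\<in>J. w L i j * ?d i j)"
      using w0[OF L] by (intro sum_nonneg mult_nonneg_nonneg seq_cost_nonneg)
    ultimately have "l * (\<Sum>j\<in>J. (h L j)\<^sup>2) \<le> R" using wh[OF L] by (simp add: R_def)
    moreover have "(h L j)\<^sup>2 \<le> (\<Sum>j\<in>J. (h L j)\<^sup>2)"
      using j J(1) by (intro member_le_sum) auto
    ultimately have "l * (h L j)\<^sup>2 \<le> R" using l by (meson mult_left_mono order_trans less_imp_le)
    then have "l * (l * (h L j)\<^sup>2) \<le> l * R" using l by (intro mult_left_mono) auto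
    then have "(l * h L j)\<^sup>2 \<le> \<delta>\<^sup>2" using R by (simp add: l_def power2_eq_square algebra_simps)
    then show ?thesis using \<delta> by (simp add: abs_le_square_iff[symmetric])
  qed
  \<comment> \<open>Conditional probabilities given an atom within an \<open>X\<close>-cell, and
    given a target cell. If \<open>?p L i\<close> is 0, division makes \<alpha> equal to 0, and
    \<open>w L i j\<close> is 0 as well by \<open>w_le\<close>; on \<open>J\<close> the denominator
    \<open>?q j\<close> is positive.\<close>
  define \<alpha> where "\<alpha> L i A = prob (A \<inter> (atom L \<inter> Xcell m k i)) / ?p L i" for L i A
  define \<beta> where "\<beta> j C = \<mu>.prob (C \<inter> Ycell m k j) / ?q j" for j C
  define \<nu> where "\<nu> A C = (\<Sum>L\<in>Pow \<A>. \<Sum>i\<in>I. \<Sum>j\<in>J. w L i j * (\<alpha> L i A * \<beta> j C))" for A C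
  have \<alpha>0: "0 \<le> \<alpha> L i A" and \<beta>0: "0 \<le> \<beta> j C" for L i j A C
    by (simp_all add: \<alpha>_def \<beta>_def)
  have \<alpha>_add: "\<alpha> L i (A \<union> B) = \<alpha> L i A + \<alpha> L i B"
    if "A \<in> events" "B \<in> events" "A \<inter> B = {}" "L \<in> Pow \<A>" for L i A B
  proof -
    have "prob ((A \<union> B) \<inter> (atom L \<inter> Xcell m k i)) =
        prob (A \<inter> (atom L \<inter> Xcell m k i)) + prob (B \<inter> (atom L \<inter> Xcell m k i))"
      using that atom[of L] unfolding Int_Un_distrib2 by (intro finite_measure_Union) auto
    then show ?thesis by (simp add: \<alpha>_def add_divide_distrib)
  qed
  have \<beta>_add: "\<beta> j (C \<union> D) = \<beta> j C + \<beta> j D"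
    if "C \<in> sets borel" "D \<in> sets borel" "C \<inter> D = {}" for j C D
  proof -
    have "\<mu>.prob ((C \<union> D) \<inter> Ycell m k j) = \<mu>.prob (C \<inter> Ycell m k j) + \<mu>.prob (D \<inter> Ycell m k j)"
      using that unfolding Int_Un_distrib2 by (intro \<mu>.finite_measure_Union) auto
    then show ?thesis by (simp add: \<beta>_def add_divide_distrib)
  qed
  have \<alpha>_le1: "\<alpha> L i A \<le> 1" if "L \<in> Pow \<A>" for L i A
  proof -
    have "prob (A \<inter> (atom L \<inter> Xcell m k i)) \<le> ?p L i"
      using atom[OF that] by (intro finite_measure_mono) auto
    then show ?thesis by (auto simp: \<alpha>_def divide_le_eq_1 zero_less_measure_iff measure_nonneg less_le)
  qed
  have \<beta>_le1: "\<beta> j C \<le> 1" for j C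
  proof -
    have "\<mu>.prob (C \<inter> Ycell m k j) \<le> ?q j"
      by (intro \<mu>.finite_measure_mono) auto
    then show ?thesis by (auto simp: \<beta>_def divide_le_eq_1 less_le)
  qed
  have w_le: "w L i j \<le> ?p L i" if "L \<in> Pow \<A>" "i \<in> I" "j \<in> J" for L i j
    using member_le_sum[of j J "w L i"] w0 w1 J that by auto
  have sum_w: "(\<Sum>L\<in>Pow \<A>. \<Sum>i\<in>I. \<Sum>j\<in>J. w L i j) = 1"
  proof -
    have "(\<Sum>i\<in>I. \<Sum>j\<in>J. w L i j) = prob (space P \<inter> atom L)" if "L \<in> Pow \<A>" for L
      using that measure_cells[OF I, of "\<lambda>\<omega>. cell f m k (X \<omega>)" "atom L"] atom[OF that] cellI
      by (simp add: w1 Int_absorb1 sets.sets_into_space)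
    then show ?thesis using atomsP[of "space P"] by (simp add: prob_space)
  qed
  have \<nu>_UNIV: "\<nu> A UNIV = prob A" if A: "A \<in> events" for A
  proof -
    have "\<nu> A UNIV = (\<Sum>L\<in>Pow \<A>. \<Sum>i\<in>I. \<alpha> L i A * (\<Sum>j\<in>J. w L i j))"
      unfolding \<nu>_def sum_distrib_left
      by (intro sum.cong refl) (auto simp: \<beta>_def J_def')
    also have "\<dots> = (\<Sum>L\<in>Pow \<A>. \<Sum>i\<in>I. prob (A \<inter> atom L \<inter> Xcell m k i))"
    proof (intro sum.cong refl)
      fix L i assume L: "L \<in> Pow \<A>" and i: "i \<in> I"
      have "prob (A \<inter> (atom L \<inter> Xcell m k i)) \<le> ?p L i"
        using atom[OF L] by (intro finite_measure_mono) auto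
      then show "\<alpha> L i A * (\<Sum>j\<in>J. w L i j) = prob (A \<inter> atom L \<inter> Xcell m k i)"
        using w1[OF L i] by (cases "?p L i = 0") (auto simp: \<alpha>_def Int_assoc measure_le_0_iff)
    qed
    also have "\<dots> = (\<Sum>L\<in>Pow \<A>. prob (A \<inter> atom L))"
      using measure_cells[OF I, of "\<lambda>\<omega>. cell f m k (X \<omega>)"] A atom cellI
      by (intro sum.cong refl) simp
    also have "\<dots> = prob A" using atomsP[OF A] ..
    finally show ?thesis .
  qed
  show thesis
  proof (rule that[of "\<lambda>(A, C). \<nu> A C"])
    show "biadditive (\<lambda>(A, C). \<nu> A C)"
      unfolding biadditive_def prod.case
    proof (intro conjI allI impI)
      show "0 \<le> \<nu> A C" for A C
        unfolding \<nu>_def by (intro sum_nonneg mult_nonneg_nonneg w0 \<alpha>0 \<beta>0)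
      show "\<nu> (A \<union> B) C = \<nu> A C + \<nu> B C" if "A \<in> events" "B \<in> events" "A \<inter> B = {}" for A B C
        unfolding \<nu>_def sum.distrib[symmetric]
        by (intro sum.cong refl) (simp add: \<alpha>_add[OF that] algebra_simps)
      show "\<nu> A (C \<union> D) = \<nu> A C + \<nu> A D" if "C \<in> sets borel" "D \<in> sets borel" "C \<inter> D = {}" for A C D
        unfolding \<nu>_def sum.distrib[symmetric]
        by (intro sum.cong refl) (simp add: \<beta>_add[OF that] algebra_simps)
    qed (rule \<nu>_UNIV)
  next
    fix A and C :: "'s set" assume A: "A \<in> \<A>" and C: "C \<in> sets borel"
    define P\<^sub>A where "P\<^sub>A = {L \<in> Pow \<A>. A \<in> L}"
    have PA: "finite P\<^sub>A" "P\<^sub>A \<subseteq> Pow \<A>" using \<A>(1) by (auto simp: P\<^sub>A_def)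
    \<comment> \<open>An atom lies inside \<open>A\<close> or is disjoint from it. So the sum
      reduces to the atoms inside \<open>A\<close>, where \<alpha> is 1 unless the mass
      \<open>w L i j\<close> vanishes.\<close>
    have Ain: "A \<inter> atom L = (if A \<in> L then atom L else {})" for L
      using A sets.sets_into_space[of A P] sets_M \<A>(2) by (auto simp: atom_def)
    have "\<nu> A C = (\<Sum>L\<in>P\<^sub>A. \<Sum>i\<in>I. \<Sum>j\<in>J. w L i j * \<beta> j C)"
      unfolding \<nu>_def
    proof (rule sum.mono_neutral_cong_right[OF _ PA(2)])
      show "\<forall>L\<in>Pow \<A> - P\<^sub>A. (\<Sum>i\<in>I. \<Sum>j\<in>J. w L i j * (\<alpha> L i A * \<beta> j C)) = 0"
        using Ain by (auto simp: \<alpha>_def P\<^sub>A_def simp flip: Int_assoc)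
      fix L assume L: "L \<in> P\<^sub>A"
      show "(\<Sum>i\<in>I. \<Sum>j\<in>J. w L i j * (\<alpha> L i A * \<beta> j C)) = (\<Sum>i\<in>I. \<Sum>j\<in>J. w L i j * \<beta> j C)"
      proof (intro sum.cong refl)
        fix i j assume ij: "i \<in> I" "j \<in> J"
        have "\<alpha> L i A = ?p L i / ?p L i"
          using L Ain[of L] by (simp add: \<alpha>_def P\<^sub>A_def flip: Int_assoc)
        then show "w L i j * (\<alpha> L i A * \<beta> j C) = w L i j * \<beta> j C"
          using w_le[of L i j] w0[of L i j] ij L PA by (cases "?p L i = 0") auto
      qed
    qed (use \<A>(1) in simp)
    also have "\<dots> = (\<Sum>L\<in>P\<^sub>A. \<Sum>j\<in>J. (\<Sum>i\<in>I. w L i j) * \<beta> j C)"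
      by (rule sum.cong[OF refl]) (subst sum.swap, simp add: sum_distrib_right)
    finally have 1: "\<nu> A C = (\<Sum>L\<in>P\<^sub>A. \<Sum>j\<in>J. (\<Sum>i\<in>I. w L i j) * \<beta> j C)" .
    have "prob A = (\<Sum>L\<in>P\<^sub>A. prob (atom L))"
      unfolding atomsP[OF sets_M[OF subsetD[OF \<A>(2) A]]] using \<A>(1) PA(2)
      by (intro sum.mono_neutral_cong_right) (auto simp: Ain P\<^sub>A_def)
    moreover have "\<mu>.prob C = (\<Sum>j\<in>J. ?q j * \<beta> j C)"
    proof -
      have "\<mu>.prob C = (\<Sum>j\<in>I. 1 * \<mu>.prob (C \<inter> Ycell m k j))"
        using \<mu>.measure_cells[OF I, of "cell f m k" C] cellI C by simp
      also have "\<dots> = (\<Sum>j\<in>J. 1 * \<mu>.prob (C \<inter> Ycell m k j))" by (rule q[OF C, symmetric])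
      also have "\<dots> = (\<Sum>j\<in>J. ?q j * \<beta> j C)"
        by (intro sum.cong refl) (auto simp: \<beta>_def J_def')
      finally show ?thesis .
    qed
    ultimately have "prob A * \<mu>.prob C = (\<Sum>L\<in>P\<^sub>A. \<Sum>j\<in>J. prob (atom L) * (?q j * \<beta> j C))"
      by (simp add: sum_product)
    with 1 have "\<nu> A C - prob A * \<mu>.prob C = (\<Sum>L\<in>P\<^sub>A. \<Sum>j\<in>J. - (l * h L j) * \<beta> j C)"
      unfolding sum_subtractf[symmetric] using PA(2)
      by (auto intro!: sum.cong simp: h subset_iff algebra_simps simp flip: sum_subtractf)
    also have "\<bar>\<dots>\<bar> \<le> (\<Sum>L\<in>P\<^sub>A. \<Sum>j\<in>J. \<delta>)"
    proof (intro order_trans[OF sum_abs] sum_mono)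
      fix L j assume L: "L \<in> P\<^sub>A" and j: "j \<in> J"
      have "\<bar>l * h L j\<bar> * \<beta> j C \<le> \<delta> * 1"
        using L PA by (intro mult_mono h_small[OF _ j] \<beta>_le1 \<beta>0) (use \<delta> in auto)
      then show "\<bar>- (l * h L j) * \<beta> j C\<bar> \<le> \<delta>" by (simp add: abs_mult \<beta>0)
    qed
    also have "\<dots> = real (card P\<^sub>A * card J) * \<delta>" by simp
    also have "\<dots> \<le> (real (card (Pow \<A>) * card J) + 1) * \<delta>"
    proof (rule mult_right_mono)
      have "card P\<^sub>A * card J \<le> card (Pow \<A>) * card J"
        using PA \<A>(1) by (intro mult_right_mono card_mono) auto
      then show "real (card P\<^sub>A * card J) \<le> real (card (Pow \<A>) * card J) + 1" by linarith
    qed (use \<delta> in simp)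
    also have "\<dots> = e" 
    proof -
      have "real (card (Pow \<A>) * card J) + 1 \<noteq> 0" by linarith
      then show ?thesis unfolding \<delta>_def by simp
    qed
    finally show "\<bar>(case (A, C) of (A, C) \<Rightarrow> \<nu> A C) - prob A * \<mu>.prob C\<bar> \<le> e" by simp
  next
    fix m' k' assume m': "m' \<le> m"
    let ?I = "range (cell f m' k')" let ?pt' = "cell_point f m' k'"
    let ?c = "\<lambda>i' j'. seq_cost f m' (?pt' i') (?pt' j')"
    let ?e = "1 / real (Suc k')"
    have I': "finite ?I" by (rule finite_range_cell[OF bounded_f])
    let ?ab = "\<lambda>L i j i' j'. \<alpha> L i (Xcell m' k' i') * \<beta> j (Ycell m' k' j')"
    have one: "(\<Sum>i'\<in>?I. \<Sum>j'\<in>?I. ?ab L i j i' j' * ?c i' j')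
        \<le> ?d i j + 2 * \<epsilon> + 2 * ?e" if L: "L \<in> Pow \<A>" and i: "i \<in> I" and j: "j \<in> J" for L i j
    proof -
      let ?r = "?d i j + 2 * \<epsilon> + 2 * ?e"
      have r: "0 \<le> ?r" using seq_cost_nonneg[of f m "?pt i" "?pt j"] \<epsilon> by simp
      have le: "?ab L i j i' j' * ?c i' j'
          \<le> ?ab L i j i' j' * ?r" for i' j'
      proof (cases "\<alpha> L i (Xcell m' k' i') = 0 \<or> \<beta> j (Ycell m' k' j') = 0")
        case False
        have "\<alpha> L i (Xcell m' k' i') = 0" if "Xcell m' k' i' \<inter> (atom L \<inter> Xcell m k i) = {}"
          unfolding \<alpha>_def that by simp
        moreover have "\<beta> j (Ycell m' k' j') = 0" if "Ycell m' k' j' \<inter> Ycell m k j = {}"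
          unfolding \<beta>_def that by simp
        ultimately have "Xcell m' k' i' \<inter> (atom L \<inter> Xcell m k i) \<noteq> {}" "Ycell m' k' j' \<inter> Ycell m k j \<noteq> {}"
          using False by blast+
        \<comment> \<open>A nonzero term has points \<open>x\<close>, \<open>y\<close> in common
          cells of both partitions. Passing through them costs two meshes of scale k', two of scale
          k, and uses c_m' \<le> c_m in between.\<close>
        then obtain x y where xy: "cell f m' k' x = i'" "cell f m k x = i" "cell f m' k' y = j'" "cell f m k y = j"
          by auto
        have 1: "seq_cost f m' (?pt' i') x \<le> ?e" "seq_cost f m' (?pt' j') y \<le> ?e"
          using seq_cost_cell_point(2)[of f m' k'] xy by auto
        have "seq_cost f m x (?pt i) \<le> 1 / real (Suc k)" "seq_cost f m y (?pt j) \<le> 1 / real (Suc k)"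
          using seq_cost_cell_point(1)[of f m _ k] xy by auto
        then have "?c i' j' \<le> ?r"
          using seq_cost_perturb[of f m' "?pt' i'" "?pt' j'" x y] seq_cost_mono[OF m', of f x y]
            seq_cost_perturb[of f m x y "?pt i" "?pt j"] 1 k by linarith
        then show ?thesis by (intro mult_left_mono) (simp_all add: \<alpha>0 \<beta>0)
      qed auto
      have "(\<Sum>i'\<in>?I. \<alpha> L i (Xcell m' k' i')) \<le> 1"
      proof -
        have "(\<Sum>i'\<in>?I. \<alpha> L i (Xcell m' k' i')) = \<alpha> L i (space P)"
        proof -
          have "?p L i = (\<Sum>i'\<in>?I. prob (atom L \<inter> Xcell m k i \<inter> Xcell m' k' i'))"
            using atom[OF L] by (intro measure_cells[OF I']) auto
          moreover have "space P \<inter> (atom L \<inter> Xcell m k i) = atom L \<inter> Xcell m k i" by auto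
          ultimately show ?thesis by (simp add: \<alpha>_def Int_ac flip: sum_divide_distrib)
        qed
        then show ?thesis using \<alpha>_le1[OF L] by simp
      qed
      moreover have "(\<Sum>j'\<in>?I. \<beta> j (Ycell m' k' j')) \<le> 1"
      proof -
        have "(\<Sum>j'\<in>?I. \<beta> j (Ycell m' k' j')) = \<beta> j UNIV"
        proof -
          have "?q j = (\<Sum>j'\<in>?I. \<mu>.prob (Ycell m k j \<inter> {y \<in> space \<mu>. cell f m' k' y = j'}))"
            by (intro \<mu>.measure_cells[OF I']) auto
          then show ?thesis by (simp add: \<beta>_def Int_ac flip: sum_divide_distrib)
        qed
        then show ?thesis using \<beta>_le1 by simp
      qed
      ultimately have le1: "(\<Sum>i'\<in>?I. \<alpha> L i (Xcell m' k' i')) * (\<Sum>j'\<in>?I. \<beta> j (Ycell m' k' j')) * ?r \<le> 1 * 1 * ?r"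
        by (intro mult_mono r sum_nonneg mult_nonneg_nonneg \<alpha>0 \<beta>0) auto
      have le2: "(\<Sum>i'\<in>?I. \<Sum>j'\<in>?I. ?ab L i j i' j' * ?c i' j') \<le>
          (\<Sum>i'\<in>?I. \<Sum>j'\<in>?I. ?ab L i j i' j' * ?r)"
        by (intro sum_mono le)
      have "(\<Sum>i'\<in>?I. \<alpha> L i (Xcell m' k' i')) * (\<Sum>j'\<in>?I. \<beta> j (Ycell m' k' j')) * ?r =
          (\<Sum>i'\<in>?I. \<Sum>j'\<in>?I. ?ab L i j i' j' * ?r)"
        by (subst sum_product) (simp only: sum_distrib_right)
      from order_trans[OF le2 le1[unfolded this mult_1]] show ?thesis .
    qed
    have "(\<Sum>i'\<in>?I. \<Sum>j'\<in>?I. \<nu> (Xcell m' k' i') (Ycell m' k' j') * ?c i' j') =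
      (\<Sum>L\<in>Pow \<A>. \<Sum>i\<in>I. \<Sum>j\<in>J. w L i j *
        (\<Sum>i'\<in>?I. \<Sum>j'\<in>?I. ?ab L i j i' j' * ?c i' j'))"
      unfolding \<nu>_def sum_distrib_left sum_distrib_right
      by (subst sum_swap3, rule sum.cong[OF refl], subst sum_swap3, rule sum.cong[OF refl],
          subst sum_swap3, rule sum.cong[OF refl]) (simp only: mult.assoc)
    also have "\<dots> \<le> (\<Sum>L\<in>Pow \<A>. \<Sum>i\<in>I. \<Sum>j\<in>J. w L i j * (?d i j + 2 * \<epsilon> + 2 * ?e))"
      by (intro sum_mono mult_left_mono one w0)
    also have "\<dots> = (\<Sum>L\<in>Pow \<A>. \<Sum>i\<in>I. \<Sum>j\<in>J. w L i j * ?d i j)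
        + (\<Sum>L\<in>Pow \<A>. \<Sum>i\<in>I. \<Sum>j\<in>J. w L i j) * (2 * \<epsilon> + 2 * ?e)"
      unfolding sum_distrib_right sum.distrib[symmetric] by (simp add: algebra_simps)
    also have "(\<Sum>L\<in>Pow \<A>. \<Sum>i\<in>I. \<Sum>j\<in>J. w L i j * ?d i j)
        \<le> (\<Sum>L\<in>Pow \<A>. (\<integral>\<omega>. indicator (atom L) \<omega> * b \<omega> \<partial>P) + 4 * \<epsilon> * prob (atom L))"
    proof (rule sum_mono)
      fix L assume L: "L \<in> Pow \<A>"
      have "0 \<le> l * (\<Sum>j\<in>J. (h L j)\<^sup>2)" using l by (intro mult_nonneg_nonneg sum_nonneg) auto
      with wh[OF L] show "(\<Sum>i\<in>I. \<Sum>j\<in>J. w L i j * ?d i j)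
        \<le> (\<integral>\<omega>. indicator (atom L) \<omega> * b \<omega> \<partial>P) + 4 * \<epsilon> * prob (atom L)" by linarith
    qed
    also have "\<dots> = expectation b + 4 * \<epsilon>"
    proof -
      have "expectation b = (\<Sum>L\<in>Pow \<A>. \<integral>\<omega>. indicator (atom L) \<omega> * b \<omega> \<partial>P)"
        by (rule integral_cells[of "Pow \<A>" P "\<lambda>\<omega>. {A \<in> \<A>. \<omega> \<in> A}", folded atom_def])
          (use \<A>(1) atom b in blast)+
      moreover have "(\<Sum>L\<in>Pow \<A>. prob (atom L)) = 1"
      proof -
        have "space P \<inter> atom L = atom L" for L by (auto simp: atom_def)
        then show ?thesis using atomsP[of "space P"] by (simp add: prob_space)
      qed
      ultimately show ?thesis by (simp add: sum.distrib flip: sum_distrib_left)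
    qed
    finally show "cell_cost m' k' (\<lambda>(A, C). \<nu> A C) \<le> expectation b + 2 / real (Suc k') + e"
      unfolding cell_cost_def prod.case using sum_w by (simp add: \<epsilon>_def)
  qed
qed

end

section \<open>Compactness\<close>

context transport_setting begin

definition approx_plans :: "'w set set \<Rightarrow> nat \<Rightarrow> nat \<Rightarrow> ('w set \<times> 's set \<Rightarrow> real) set" where
  "approx_plans \<A> m n = {\<nu>. biadditive \<nu> \<and>
    (\<forall>A C. A \<in> \<A> \<longrightarrow> C \<in> sets borel \<longrightarrow> \<bar>\<nu> (A, C) - prob A * \<mu>.prob C\<bar> \<le> 1 / real (Suc n)) \<and>
    (\<forall>m' k. m' \<le> m \<longrightarrow> cell_cost m' k \<nu> \<le> expectation b + 2 / real (Suc k) + 1 / real (Suc n))}"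

text \<open>Each single condition compares finite combinations of coordinates, which are continuous
  in the product topology; the quantifiers only form intersections.\<close>

lemma closed_approx_plans: "closed (approx_plans \<A> m n)"
  unfolding approx_plans_def biadditive_def cell_cost_def
  by (intro closed_Collect_conj closed_Collect_all closed_Collect_imp open_Collect_const
      closed_Collect_le closed_Collect_eq continuous_intros continuous_on_coordinate)

lemma approx_plans_mono:
  assumes "\<A> \<subseteq> \<A>'" "m \<le> m'" "n \<le> n'"
  shows "approx_plans \<A>' m' n' \<subseteq> approx_plans \<A> m n"
proof
  fix \<nu> assume \<nu>: "\<nu> \<in> approx_plans \<A>' m' n'"
  have le: "1 / real (Suc n') \<le> 1 / real (Suc n)" using assms(3) by (simp add: field_simps)
  have "\<bar>\<nu> (A, C) - prob A * \<mu>.prob C\<bar> \<le> 1 / real (Suc n)" if "A \<in> \<A>" "C \<in> sets borel" for A C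
  proof (rule order_trans[OF _ le])
    show "\<bar>\<nu> (A, C) - prob A * \<mu>.prob C\<bar> \<le> 1 / real (Suc n')"
      using \<nu> that assms(1) unfolding approx_plans_def by blast
  qed
  moreover have "cell_cost j k \<nu> \<le> expectation b + 2 / real (Suc k) + 1 / real (Suc n)"
    if "j \<le> m" for j k
  proof (rule order_trans[OF _ add_left_mono[OF le]])
    show "cell_cost j k \<nu> \<le> expectation b + 2 / real (Suc k) + 1 / real (Suc n')"
      using \<nu> order_trans[OF that assms(2)] unfolding approx_plans_def by blast
  qed
  ultimately show "\<nu> \<in> approx_plans \<A> m n"
    using \<nu> unfolding approx_plans_def by blast
qed

lemma approx_plans_nonempty:
  assumes "finite \<A>" "\<A> \<subseteq> sets M"
  shows "PiE UNIV (\<lambda>_. {0..1}) \<inter> approx_plans \<A> m n \<noteq> {}"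
proof -
  have e: "0 < 1 / real (Suc n)" by simp
  show ?thesis
  proof (rule approximate_plan[OF assms e, of m])
    fix \<nu>
    assume \<nu>: "biadditive \<nu>"
      "\<And>A C. A \<in> \<A> \<Longrightarrow> C \<in> sets borel \<Longrightarrow> \<bar>\<nu> (A, C) - prob A * \<mu>.prob C\<bar> \<le> 1 / real (Suc n)"
      "\<And>m' k. m' \<le> m \<Longrightarrow> cell_cost m' k \<nu> \<le> expectation b + 2 / real (Suc k) + 1 / real (Suc n)"
    \<comment> \<open>Setting the free values at non-measurable pairs to 0 places the plan in the
      cube with sides [0,1], which is compact.\<close>
    define z where "z = (\<lambda>(A, C). if A \<in> events \<and> C \<in> sets borel then \<nu> (A, C) else 0)"
    have z: "z (A, C) = \<nu> (A, C)" if "A \<in> events" "C \<in> sets borel" for A C using that by (simp add: z_def)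
    have "\<nu> (A, C) \<le> 1" if "A \<in> events" "C \<in> sets borel" for A C
      using biadditive_dominated(1)[OF \<nu>(1) that] prob_le_1[of A] by (rule order_trans)
    then have "0 \<le> z x \<and> z x \<le> 1" for x
      by (auto simp: z_def biadditiveD(1)[OF \<nu>(1)] split: prod.split)
    then have "z \<in> PiE UNIV (\<lambda>_. {0..1})" by (simp add: PiE_UNIV_domain)
    moreover have "biadditive z"
      unfolding biadditive_def
    proof (intro conjI allI impI)
      show "z (A \<union> B, C) = z (A, C) + z (B, C)"
        if "A \<in> events" "B \<in> events" "C \<in> sets borel" "A \<inter> B = {}" for A B C
        using biadditiveD(3)[OF \<nu>(1) that] that by (simp add: z)
      show "z (A, C \<union> D) = z (A, C) + z (A, D)"
        if "A \<in> events" "C \<in> sets borel" "D \<in> sets borel" "C \<inter> D = {}" for A C D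
        using biadditiveD(4)[OF \<nu>(1) that] that by (simp add: z)
    qed (simp_all add: z biadditiveD(1,2)[OF \<nu>(1)])
    moreover have "\<bar>z (A, C) - prob A * \<mu>.prob C\<bar> \<le> 1 / real (Suc n)" if "A \<in> \<A>" "C \<in> sets borel" for A C
      using \<nu>(2)[OF that] z[OF sets_M[OF subsetD[OF assms(2) that(1)]] that(2)] by (simp only:)
    moreover have "cell_cost m' k z \<le> expectation b + 2 / real (Suc k) + 1 / real (Suc n)" if "m' \<le> m" for m' k
      using \<nu>(3)[OF that] unfolding cell_cost_def z[OF cell_sets] .
    ultimately show ?thesis unfolding approx_plans_def by blast
  qed
qed

text \<open>The sets \<open>approx_plans\<close> form a directed family: finitely many of them
  contain one with the union of the finite families and the maxima of the indices. A point common to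
  all of them satisfies every constraint with tolerance 0.\<close>

lemma exists_plan:
  obtains \<nu> where "biadditive \<nu>"
    and "\<And>A C. A \<in> sets M \<Longrightarrow> C \<in> sets borel \<Longrightarrow> \<nu> (A, C) = prob A * \<mu>.prob C"
    and "\<And>m k. cell_cost m k \<nu> \<le> expectation b + 2 / real (Suc k)"
proof -
  let ?I = "{\<A>. finite \<A> \<and> \<A> \<subseteq> sets M} \<times> UNIV \<times> UNIV"
  define ap where "ap i = approx_plans (fst i) (fst (snd i)) (snd (snd i))" for i
  have "PiE UNIV (\<lambda>_. {0..1}) \<inter> (\<Inter>i\<in>?I. ap i) \<noteq> {}"
  proof (rule compact_imp_fip_image)
    show "compact (PiE UNIV (\<lambda>_. {0..1}) :: ('w set \<times> 's set \<Rightarrow> real) set)"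
      by (rule compact_PiE_UNIV) simp
    show "closed (ap i)" for i unfolding ap_def by (rule closed_approx_plans)
    fix I' :: "('w set set \<times> nat \<times> nat) set" assume I': "finite I'" "I' \<subseteq> ?I"
    \<comment> \<open>\<open>insert 0\<close> provides a maximum also for an empty
      \<open>I'\<close>.\<close>
    define \<A> m n where "\<A> = (\<Union>i\<in>I'. fst i)" and "m = Max (insert 0 ((fst \<circ> snd) ` I'))"
      and "n = Max (insert 0 ((snd \<circ> snd) ` I'))"
    have "approx_plans \<A> m n \<subseteq> ap i" if i: "i \<in> I'" for i
      unfolding ap_def
    proof (rule approx_plans_mono)
      show "fst i \<subseteq> \<A>" using i by (auto simp: \<A>_def)
      show "fst (snd i) \<le> m" "snd (snd i) \<le> n"
        unfolding m_def n_def using i I'(1) by (auto intro!: Max_ge)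
    qed
    then have sub: "approx_plans \<A> m n \<subseteq> (\<Inter>i\<in>I'. ap i)" by (rule INT_greatest)
    have "PiE UNIV (\<lambda>_. {0..1}) \<inter> approx_plans \<A> m n \<noteq> {}"
    proof (rule approx_plans_nonempty)
      have *: "finite (fst i)" "fst i \<subseteq> sets M" if "i \<in> I'" for i
        using subsetD[OF I'(2) that] by auto
      show "finite \<A>" using I'(1) * by (simp add: \<A>_def)
      show "\<A> \<subseteq> sets M" unfolding \<A>_def by (rule UN_least) (rule *)
    qed
    with sub show "PiE UNIV (\<lambda>_. {0..1}) \<inter> (\<Inter>i\<in>I'. ap i) \<noteq> {}" by blast
  qed
  then obtain z where z': "z \<in> ap i" if "i \<in> ?I" for i by blast
  have z: "z \<in> approx_plans \<A> m n" if "finite \<A>" "\<A> \<subseteq> sets M" for \<A> m n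
    using z'[of "(\<A>, m, n)"] that by (simp add: ap_def)
  have le0: "x \<le> 0" if x: "\<And>n. x \<le> 1 / real (Suc n)" for x :: real
  proof (rule ccontr)
    assume "\<not> x \<le> 0"
    then have "0 < x" by simp
    then obtain n where "1 / real (Suc n) < x" by (rule nat_approx_posE)
    with x[of n] show False by linarith
  qed
  show thesis
  proof
    show "biadditive z" using z[of "{}" 0 0] unfolding approx_plans_def by blast
    fix m k
    have "cell_cost m k z - (expectation b + 2 / real (Suc k)) \<le> 0"
    proof (rule le0)
      fix n
      have "z \<in> approx_plans {} m n" using z by blast
      then have "cell_cost m k z \<le> expectation b + 2 / real (Suc k) + 1 / real (Suc n)"
        unfolding approx_plans_def by blast
      then show "cell_cost m k z - (expectation b + 2 / real (Suc k)) \<le> 1 / real (Suc n)" by linarith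
    qed
    then show "cell_cost m k z \<le> expectation b + 2 / real (Suc k)" by linarith
  next
    fix A and C :: "'s set" assume AC: "A \<in> sets M" "C \<in> sets borel"
    have "\<bar>z (A, C) - prob A * \<mu>.prob C\<bar> \<le> 0"
    proof (rule le0)
      fix n
      have "z \<in> approx_plans {A} 0 n" using z AC by blast
      then show "\<bar>z (A, C) - prob A * \<mu>.prob C\<bar> \<le> 1 / real (Suc n)"
        using AC unfolding approx_plans_def by blast
    qed
    then show "z (A, C) = prob A * \<mu>.prob C" by simp
  qed
qed

end

section \<open>Realising a plan by a random variable\<close>

text \<open>The index set will consist of rationals, which no enumeration lists in order. Continuity
  from below is therefore applied to finite unions along an enumeration; in a chain each of these is
  again a member.\<close>

lemma emeasure_countable_chain:
  assumes D: "countable D" "D \<noteq> {}" and B: "\<And>q. q \<in> D \<Longrightarrow> B q \<in> sets N"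
    and chain: "\<And>p q. p \<in> D \<Longrightarrow> q \<in> D \<Longrightarrow> B p \<subseteq> B q \<or> B q \<subseteq> B p"
  shows "emeasure N (\<Union>q\<in>D. B q) = (SUP q\<in>D. emeasure N (B q))"
proof -
  let ?e = "from_nat_into D"
  define C where "C n = (\<Union>i\<le>n. B (?e i))" for n :: nat
  have e: "?e i \<in> D" for i by (rule from_nat_into[OF D(2)])
  have "\<exists>q\<in>D. C n = B q" for n
  proof (induction n)
    case 0
    show ?case using e[of 0] by (auto simp: C_def)
  next
    case (Suc n)
    then obtain q where q: "q \<in> D" "C n = B q" by blast
    have "C (Suc n) = B q \<union> B (?e (Suc n))" using q(2) by (auto simp: C_def atMost_Suc)
    with chain[OF q(1) e[of "Suc n"]] q(1) e[of "Suc n"] show ?case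
      by (metis Un_absorb1 Un_absorb2)
  qed
  then have C: "C n \<in> sets N" "emeasure N (C n) \<le> (SUP q\<in>D. emeasure N (B q))" for n
    by (metis B, metis SUP_upper)
  have "(\<Union>q\<in>D. B q) = (\<Union>n. C n)"
  proof
    show "(\<Union>q\<in>D. B q) \<subseteq> (\<Union>n. C n)"
    proof
      fix x assume "x \<in> (\<Union>q\<in>D. B q)"
      then obtain q where "q \<in> D" "x \<in> B q" by blast
      moreover then obtain n where "?e n = q" using from_nat_into_surj[OF D(1)] by blast
      ultimately show "x \<in> (\<Union>n. C n)" by (auto simp: C_def)
    qed
  qed (use e in \<open>auto simp: C_def\<close>)
  also have "emeasure N (\<Union>n. C n) = (SUP n. emeasure N (C n))"
  proof (rule SUP_emeasure_incseq[symmetric])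
    show "incseq C" unfolding incseq_def C_def by (intro allI impI UN_mono) auto
  qed (use C(1) in auto)
  finally have "emeasure N (\<Union>q\<in>D. B q) \<le> (SUP q\<in>D. emeasure N (B q))"
    using C(2) by (simp add: SUP_least)
  moreover have "(SUP q\<in>D. emeasure N (B q)) \<le> emeasure N (\<Union>q\<in>D. B q)"
    using D B by (intro SUP_least emeasure_mono sets.countable_UN') auto
  ultimately show ?thesis by (rule antisym)
qed

lemma emeasure_uniform_below:
  "emeasure (uniform_measure lborel {0..1::real}) {u. ennreal u \<le> h} = min 1 h"
proof -
  have [measurable]: "{u. ennreal u \<le> h} \<in> sets borel" by measurable
  have "emeasure lborel ({0..1} \<inter> {u. ennreal u \<le> h}) = min 1 h"
  proof (cases h)
    case (real r)
    then have "{0..1} \<inter> {u. ennreal u \<le> h} = {0..min 1 r}" by (auto simp: ennreal_le_iff)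
    then show ?thesis using real by (simp add: min_def ennreal_le_1 flip: ennreal_1)
  next
    case top
    then show ?thesis by (simp add: min_def)
  qed
  then show ?thesis by (simp add: divide_ennreal_def)
qed

text \<open>By independence the pair of \<open>U\<close> and the identity, read as a map into
  \<Omega> equipped with \<open>G\<close>, has a product law. Fubini then integrates the length of
  the interval from 0 to the smaller of 1 and \<open>H w\<close>.\<close>

lemma (in prob_space) emeasure_uniform_threshold:
  assumes G: "subalgebra M G" and U: "U \<in> borel_measurable M"
    and dU: "distr M lborel U = uniform_measure lborel {0..1::real}"
    and ind: "indep_set (sets (sigma_alg_of M U)) (sets G)"
    and H: "H \<in> borel_measurable G" and A: "A \<in> sets G"
  shows "emeasure M {w \<in> A. ennreal (U w) \<le> H w} = (\<integral>\<^sup>+w. min 1 (H w) * indicator A w \<partial>M)"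
proof -
  define MG where "MG = restr_to_subalg M G"
  have sp: "space MG = space M" and se: "sets MG = sets G"
    by (simp_all add: MG_def space_restr_to_subalg sets_restr_to_subalg[OF G])
  interpret MG: prob_space MG
    unfolding MG_def by (rule prob_space_restr_to_subalg[OF G prob_space_axioms])
  have id: "(\<lambda>w. w) \<in> M \<rightarrow>\<^sub>M MG"
    using G by (auto simp: measurable_def sp se subalgebra_def)
  interpret un: prob_space "uniform_measure lborel {0..1::real}"
    by (rule prob_space_uniform_measure) auto
  interpret pp: pair_prob_space "uniform_measure lborel {0..1::real}" MG ..
  have prod: "uniform_measure lborel {0..1} \<Otimes>\<^sub>M MG = distr M (lborel \<Otimes>\<^sub>M MG) (\<lambda>w. (U w, w))"
  proof (rule pair_measure_eqI)
    fix C B assume C: "C \<in> sets (uniform_measure lborel {0..1::real})" and B: "B \<in> sets MG"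
    have "B \<subseteq> space M" using sets.sets_into_space[OF B] sp by simp
    then have "(\<lambda>w. (U w, w)) -` (C \<times> B) \<inter> space M = (U -` C \<inter> space M) \<inter> B" by auto
    then have "emeasure (distr M (lborel \<Otimes>\<^sub>M MG) (\<lambda>w. (U w, w))) (C \<times> B) = emeasure M ((U -` C \<inter> space M) \<inter> B)"
      using C B id U by (subst emeasure_distr) auto
    also have "\<dots> = ennreal (measure M (U -` C \<inter> space M) * measure M B)"
    proof -
      have "U -` C \<inter> space M \<in> sets (sigma_alg_of M U)"
        using C by (auto simp: sigma_alg_of_def intro!: in_vimage_algebra)
      then show ?thesis using indep_setD[OF ind] B by (simp add: emeasure_eq_measure se)
    qed
    also have "\<dots> = emeasure (distr M lborel U) C * emeasure MG B"
      using C B U by (simp add: emeasure_distr emeasure_eq_measure ennreal_mult)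
        (simp add: MG_def emeasure_restr_to_subalg[OF G] se[unfolded MG_def] emeasure_eq_measure)
    finally show "emeasure (uniform_measure lborel {0..1}) C * emeasure MG B =
      emeasure (distr M (lborel \<Otimes>\<^sub>M MG) (\<lambda>w. (U w, w))) (C \<times> B)" unfolding dU ..
  qed (auto intro: un.sigma_finite_measure_axioms MG.sigma_finite_measure_axioms cong: sets_pair_measure_cong)
  have H': "H \<in> borel_measurable MG" using H by (simp cong: measurable_cong_sets add: se)
  have A': "A \<in> sets MG" using A by (simp add: se)
  define Z where "Z = {x \<in> space (lborel \<Otimes>\<^sub>M MG). snd x \<in> A \<and> ennreal (fst x) \<le> H (snd x)}"
  have Z: "Z \<in> sets (lborel \<Otimes>\<^sub>M MG)"
    unfolding Z_def using H' A' by measurable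
  have "{w \<in> A. ennreal (U w) \<le> H w} = (\<lambda>w. (U w, w)) -` Z \<inter> space M"
    using sets.sets_into_space[OF A'] by (auto simp: Z_def space_pair_measure sp)
  then have "emeasure M {w \<in> A. ennreal (U w) \<le> H w} = emeasure (uniform_measure lborel {0..1} \<Otimes>\<^sub>M MG) Z"
    using U id Z unfolding prod by (subst emeasure_distr) auto
  also have "\<dots> = (\<integral>\<^sup>+w. emeasure (uniform_measure lborel {0..1}) ((\<lambda>u. (u, w)) -` Z) \<partial>MG)"
    using Z by (intro pp.emeasure_pair_measure_alt2) (simp cong: sets_pair_measure_cong)
  also have "\<dots> = (\<integral>\<^sup>+w. min 1 (H w) * indicator A w \<partial>MG)"
  proof (rule nn_integral_cong)
    fix w assume "w \<in> space MG"
    then have "(\<lambda>u. (u, w)) -` Z = (if w \<in> A then {u. ennreal u \<le> H w} else {})"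
      by (auto simp: Z_def space_pair_measure)
    then show "emeasure (uniform_measure lborel {0..1}) ((\<lambda>u. (u, w)) -` Z) = min 1 (H w) * indicator A w"
      by (cases "w \<in> A") (simp_all add: emeasure_uniform_below del: emeasure_uniform_measure)
  qed
  also have "\<dots> = (\<integral>\<^sup>+w. min 1 (H w) * indicator A w \<partial>M)"
    unfolding MG_def by (rule nn_integral_subalgebra2[OF G]) (use H A in measurable)
  finally show ?thesis .
qed

lemma sigma_join_measurable:
  assumes "space M = space P" "space N = space P" 
  shows "f \<in> M \<rightarrow>\<^sub>M R \<Longrightarrow> f \<in> sigma_join M N \<rightarrow>\<^sub>M R" "f \<in> N \<rightarrow>\<^sub>M R \<Longrightarrow> f \<in> sigma_join M N \<rightarrow>\<^sub>M R"
proof -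
  have "sets M \<union> sets N \<subseteq> Pow (space P)"
    using assms sets.space_closed[of M] sets.space_closed[of N] by auto
  then have s: "space (sigma_join M N) = space P" "sets (sigma_join M N) = sigma_sets (space P) (sets M \<union> sets N)"
    using assms by (simp_all add: sigma_join_def)
  show "f \<in> M \<rightarrow>\<^sub>M R \<Longrightarrow> f \<in> sigma_join M N \<rightarrow>\<^sub>M R" "f \<in> N \<rightarrow>\<^sub>M R \<Longrightarrow> f \<in> sigma_join M N \<rightarrow>\<^sub>M R"
    using assms by (auto simp: measurable_def s intro: sigma_sets.Basic)
qed

lemma (in prob_space) subalgebra_sigma_join:
  assumes "subalgebra M F" "subalgebra M G"
  shows "subalgebra M (sigma_join F G)"
proof -
  have "sets F \<union> sets G \<subseteq> Pow (space M)" using assms sets.space_closed[of F] sets.space_closed[of G]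
    by (auto simp: subalgebra_def)
  then show ?thesis using assms unfolding subalgebra_def sigma_join_def
    by (auto simp: sets.sigma_sets_subset subset_iff dest!: sets.sigma_sets_subset[THEN subsetD, rotated])
qed

lemma subalgebra_sigma_alg_of:
  "X \<in> P \<rightarrow>\<^sub>M borel \<Longrightarrow> subalgebra P (sigma_alg_of P X)"
  by (auto simp: subalgebra_def sigma_alg_of_def sets_vimage_algebra2 measurable_sets measurable_space)

lemma measurable_sigma_alg_of:
  "X \<in> sigma_alg_of P X \<rightarrow>\<^sub>M borel"
  unfolding sigma_alg_of_def by (rule measurable_vimage_algebra1) auto

context transport_setting begin

text \<open>For fixed \<open>C\<close> the plan is a measure dominated by \<open>P\<close>; its
  density plays the role of the conditional probability of \<open>C\<close> given \<open>G\<close>.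
  Working on \<open>restr_to_subalg P G\<close> makes the density
  \<open>G\<close>-measurable.\<close>

lemma plan_density:
  assumes \<nu>: "biadditive \<nu>" and G: "subalgebra P G" and C: "C \<in> sets borel"
  obtains F where "F \<in> borel_measurable G"
    "\<And>A. A \<in> sets G \<Longrightarrow> (\<integral>\<^sup>+\<omega>. F \<omega> * indicator A \<omega> \<partial>restr_to_subalg P G) = ennreal (\<nu> (A, C))"
proof -
  let ?PG = "restr_to_subalg P G"
  interpret PG: prob_space ?PG by (rule prob_space_restr_to_subalg[OF G prob_space_axioms])
  have se: "sets ?PG = sets G" by (rule sets_restr_to_subalg[OF G])
  have ev: "A \<in> events" if "A \<in> sets ?PG" for A using that G by (auto simp: subalgebra_def se)
  have dom: "\<nu> (A, C) \<le> measure ?PG A" if "A \<in> sets ?PG" for A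
    using biadditive_dominated(1)[OF \<nu> ev[OF that] C] that
    by (simp add: measure_def emeasure_restr_to_subalg[OF G] se)
  obtain N where N: "finite_measure N" "sets N = sets ?PG" "absolutely_continuous ?PG N"
    "\<And>A. A \<in> sets ?PG \<Longrightarrow> measure N A = \<nu> (A, C)"
  proof (rule dominated_additive_measure[OF PG.finite_measure_axioms, of "\<lambda>A. \<nu> (A, C)"])
    show "0 \<le> \<nu> (A, C)" if "A \<in> sets ?PG" for A
      by (rule biadditiveD(1)[OF \<nu> ev[OF that] C])
    show "\<nu> (A \<union> B, C) = \<nu> (A, C) + \<nu> (B, C)" if "A \<in> sets ?PG" "B \<in> sets ?PG" "A \<inter> B = {}" for A B
      by (rule biadditiveD(3)[OF \<nu> ev[OF that(1)] ev[OF that(2)] C that(3)])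
    show "\<nu> (A, C) \<le> PG.prob A" if "A \<in> sets ?PG" for A by (rule dom[OF that])
  qed (rule that)
  interpret N: finite_measure N by fact
  from PG.Radon_Nikodym[OF N(3,2)] obtain F where F: "F \<in> borel_measurable ?PG" "density ?PG F = N" ..
  show thesis
  proof
    show "F \<in> borel_measurable G" using F(1) by (simp cong: measurable_cong_sets add: se)
    show "(\<integral>\<^sup>+\<omega>. F \<omega> * indicator A \<omega> \<partial>?PG) = ennreal (\<nu> (A, C))" if "A \<in> sets G" for A
    proof -
      have A: "A \<in> sets ?PG" using that by (simp add: se)
      show ?thesis
        unfolding emeasure_density[OF F(1) A, symmetric] F(2) N.emeasure_eq_measure N(4)[OF A] ..
    qed
  qed
qed

text \<open>After coding S into [0,1], the joint law is determined by the conditional tails of the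
  code at rational levels. Densities for countably many sets therefore suffice, and no conditional
  kernel has to be assembled. Thresholding \<open>U\<close> against these tails gives the code of
  \<open>Y\<close>, which \<open>d\<close> decodes.\<close>

lemma realise_plan:
  fixes \<phi> :: "'s \<Rightarrow> real"
  assumes \<nu>: "biadditive \<nu>" and marg: "\<And>C. C \<in> sets borel \<Longrightarrow> \<nu> (space P, C) = \<mu>.prob C"
    and G: "subalgebra P G" and U: "U \<in> borel_measurable P"
    and dU: "distr P lborel U = uniform_measure lborel {0..1::real}"
    and ind: "indep_set (sets (sigma_alg_of P U)) (sets G)"
    and \<phi>: "\<phi> \<in> borel_measurable borel" "\<And>x. \<phi> x \<in> {0..1}"
    and d: "d \<in> borel \<rightarrow>\<^sub>M borel" "AE x in \<mu>. d (\<phi> x) = x"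
  obtains Y where "Y \<in> sigma_join (sigma_alg_of P U) G \<rightarrow>\<^sub>M borel"
    "\<And>A C. A \<in> sets G \<Longrightarrow> C \<in> sets borel \<Longrightarrow> prob (A \<inter> Y -` C) = \<nu> (A, C)"
proof -
  let ?PG = "restr_to_subalg P G"
  interpret PG: prob_space ?PG by (rule prob_space_restr_to_subalg[OF G prob_space_axioms])
  have se: "sets ?PG = sets G" by (rule sets_restr_to_subalg[OF G])
  have spG: "space G = space P" using G by (simp add: subalgebra_def)
  have ev: "A \<in> events" if "A \<in> sets G" for A using that G by (auto simp: subalgebra_def)
  have [measurable]: "{x. q < \<phi> x} \<in> sets borel" for q using \<phi>(1) by measurable
  define dens where "dens C = (SOME F. F \<in> borel_measurable G \<and>
    (\<forall>A\<in>sets G. (\<integral>\<^sup>+\<omega>. F \<omega> * indicator A \<omega> \<partial>?PG) = ennreal (\<nu> (A, C))))" for C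
  have dens: "dens C \<in> borel_measurable G"
    "\<And>A. A \<in> sets G \<Longrightarrow> (\<integral>\<^sup>+\<omega>. dens C \<omega> * indicator A \<omega> \<partial>?PG) = ennreal (\<nu> (A, C))"
    if C: "C \<in> sets borel" for C
  proof -
    have "\<exists>F. F \<in> borel_measurable G \<and>
      (\<forall>A\<in>sets G. (\<integral>\<^sup>+\<omega>. F \<omega> * indicator A \<omega> \<partial>?PG) = ennreal (\<nu> (A, C)))"
      using plan_density[OF \<nu> G C] by metis
    from someI_ex[OF this, folded dens_def] show "dens C \<in> borel_measurable G"
      "\<And>A. A \<in> sets G \<Longrightarrow> (\<integral>\<^sup>+\<omega>. dens C \<omega> * indicator A \<omega> \<partial>?PG) = ennreal (\<nu> (A, C))" by auto
  qed
  have dens_mono: "AE \<omega> in ?PG. dens C \<omega> \<le> dens D \<omega>"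
    if C: "C \<in> sets borel" and D: "D \<in> sets borel" and sub: "C \<subseteq> D" for C D
  proof -
    have DC: "D - C \<in> sets borel" "C \<union> (D - C) = D" "C \<inter> (D - C) = {}" using C D sub by auto
    note [measurable] = dens(1)[OF C] dens(1)[OF D] dens(1)[OF DC(1)]
    have me: "dens C \<in> borel_measurable ?PG" "dens D \<in> borel_measurable ?PG" "dens (D - C) \<in> borel_measurable ?PG"
      by (simp_all cong: measurable_cong_sets add: se)
    have "AE \<omega> in ?PG. dens D \<omega> = dens C \<omega> + dens (D - C) \<omega>"
    proof (rule PG.density_unique_finite_measure)
      fix A assume A: "A \<in> sets ?PG"
      then have A': "A \<in> sets G" by (simp add: se)
      have "(\<integral>\<^sup>+\<omega>. (dens C \<omega> + dens (D - C) \<omega>) * indicator A \<omega> \<partial>?PG) = ennreal (\<nu> (A, C)) + ennreal (\<nu> (A, D - C))"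
        unfolding distrib_right using me A
        by (subst nn_integral_add) (simp_all add: dens(2)[OF C A'] dens(2)[OF DC(1) A'])
      also have "\<dots> = ennreal (\<nu> (A, D))"
        using biadditiveD(4)[OF \<nu> ev[OF A'] C DC(1) DC(3)] biadditiveD(1)[OF \<nu> ev[OF A']] C DC
        by (simp flip: ennreal_plus)
      finally show "(\<integral>\<^sup>+\<omega>. dens D \<omega> * indicator A \<omega> \<partial>?PG) =
        (\<integral>\<^sup>+\<omega>. (dens C \<omega> + dens (D - C) \<omega>) * indicator A \<omega> \<partial>?PG)" using dens(2)[OF D A'] by simp
    qed (use me in auto)
    then show ?thesis by eventually_elim simp
  qed
  define Q where "Q = \<rat> \<inter> {0..1::real}"
  have Q: "countable Q" "1 \<in> Q" by (auto simp: Q_def countable_rat intro: countable_Int1)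
  \<comment> \<open>The densities decrease in the level only almost everywhere. The supremum over
    larger rationals forces monotonicity at every \<omega> and, by \<open>H_AE\<close>, changes
    nothing almost everywhere after truncation at 1.\<close>
  define H where "H q \<omega> = (SUP q'\<in>Q \<inter> {q..}. dens {x. q' < \<phi> x} \<omega>)" for q \<omega>
  have H_meas: "H q \<in> borel_measurable G" for q
    unfolding H_def using Q(1) by (intro borel_measurable_SUP dens(1)) (auto intro: countable_Int1)
  have H_mono: "H q' \<omega> \<le> H q \<omega>" if "q \<le> q'" for q q' \<omega>
    unfolding H_def using that by (intro SUP_subset_mono) auto
  have H_AE: "AE \<omega> in ?PG. min 1 (H q \<omega>) = dens {x. q < \<phi> x} \<omega>" if q: "q \<in> Q" for q
  proof -
    have "AE \<omega> in ?PG. \<forall>q'\<in>Q \<inter> {q..}. dens {x. q' < \<phi> x} \<omega> \<le> dens {x. q < \<phi> x} \<omega>"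
      using Q(1) by (subst AE_ball_countable) (auto intro!: dens_mono intro: countable_Int1)
    moreover have "AE \<omega> in ?PG. dens {x. q < \<phi> x} \<omega> \<le> dens UNIV \<omega>" by (rule dens_mono) auto
    moreover have "AE \<omega> in ?PG. dens UNIV \<omega> = 1"
    proof (rule PG.density_unique_finite_measure)
      fix A assume "A \<in> sets ?PG"
      then have A: "A \<in> sets G" by (simp add: se)
      have "emeasure ?PG A = ennreal (prob A)"
        using A by (simp add: emeasure_restr_to_subalg[OF G] emeasure_eq_measure)
      then show "(\<integral>\<^sup>+\<omega>. dens UNIV \<omega> * indicator A \<omega> \<partial>?PG) = (\<integral>\<^sup>+\<omega>. 1 * indicator A \<omega> \<partial>?PG)"
        using A dens(2)[of UNIV A] biadditiveD(2)[OF \<nu> ev[OF A]] by (simp add: se)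
    qed (use dens(1)[of UNIV] in \<open>auto cong: measurable_cong_sets simp: se\<close>)
    ultimately show ?thesis
    proof eventually_elim
      fix \<omega> assume "\<forall>q'\<in>Q \<inter> {q..}. dens {x. q' < \<phi> x} \<omega> \<le> dens {x. q < \<phi> x} \<omega>"
        "dens {x. q < \<phi> x} \<omega> \<le> dens UNIV \<omega>" "dens UNIV \<omega> = 1"
      moreover from this(1) q have "H q \<omega> = dens {x. q < \<phi> x} \<omega>"
        unfolding H_def by (intro antisym SUP_least SUP_upper2[of q]) auto
      ultimately show "min 1 (H q \<omega>) = dens {x. q < \<phi> x} \<omega>" by (simp add: min_def)
    qed
  qed
  define S where "S \<omega> = {q \<in> Q. ennreal (U \<omega>) \<le> H q \<omega>}" for \<omega>
  \<comment> \<open>The generalised inverse of the decreasing function \<open>H\<close> at height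
    \<open>U\<close>. If no level qualifies the value is 0, the lower end of the range of
    codes.\<close>
  define V where "V \<omega> = Sup (insert 0 (S \<omega>))" for \<omega>
  have bdd: "bdd_above (insert 0 (S \<omega>))" for \<omega>
    by (rule bdd_aboveI[of _ 1]) (auto simp: S_def Q_def)
  have V_gt: "r < V \<omega> \<longleftrightarrow> r < 0 \<or> (\<exists>q\<in>Q \<inter> {r<..}. ennreal (U \<omega>) \<le> H q \<omega>)" for r \<omega>
    unfolding V_def by (subst less_cSup_iff[OF _ bdd]) (auto simp: S_def)
  define J where "J = sigma_join (sigma_alg_of P U) G"
  have spU: "space (sigma_alg_of P U) = space P" by (simp add: sigma_alg_of_def)
  have UJ [measurable]: "U \<in> borel_measurable J"
    unfolding J_def by (intro sigma_join_measurable(1)[OF spU spG] measurable_sigma_alg_of)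
  have HJ [measurable]: "H q \<in> borel_measurable J" for q
    unfolding J_def by (intro sigma_join_measurable(2)[OF spU spG] H_meas)
  have subJ: "subalgebra P J"
    unfolding J_def by (intro subalgebra_sigma_join subalgebra_sigma_alg_of U G)
  have VJ: "V \<in> borel_measurable J"
  proof (rule borel_measurableI_greater)
    fix r
    show "{\<omega> \<in> space J. r < V \<omega>} \<in> sets J"
      unfolding V_gt using Q(1) by (intro sets.sets_Collect_disj sets.sets_Collect_countable_Bex) (auto intro: countable_Int1)
  qed
  have VP: "V \<in> borel_measurable P" by (rule measurable_from_subalg[OF subJ VJ])
  \<comment> \<open>For fixed \<open>A\<close> the plan is a genuine measure \<open>N\<close> in its
    second argument. Finite measures on the line are determined by the half-lines
    \<open>{r<..}\<close>, so only tails have to be compared.\<close>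
  have law: "emeasure P (A \<inter> V -` B) = ennreal (\<nu> (A, \<phi> -` B))" if A: "A \<in> sets G" and B: "B \<in> sets borel" for A B
  proof -
    have Asub: "A \<subseteq> space P" using sets.sets_into_space[OF A] spG by simp
    obtain N where N: "finite_measure N" "sets N = sets \<mu>" "absolutely_continuous \<mu> N"
      "\<And>C. C \<in> sets \<mu> \<Longrightarrow> measure N C = \<nu> (A, C)"
    proof (rule dominated_additive_measure[OF \<mu>.finite_measure_axioms, of "\<lambda>C. \<nu> (A, C)"])
      show "0 \<le> \<nu> (A, C)" if "C \<in> sets \<mu>" for C
        using biadditiveD(1)[OF \<nu> ev[OF A]] that by simp
      show "\<nu> (A, C \<union> D) = \<nu> (A, C) + \<nu> (A, D)" if "C \<in> sets \<mu>" "D \<in> sets \<mu>" "C \<inter> D = {}" for C D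
        using biadditiveD(4)[OF \<nu> ev[OF A] _ _ that(3)] that(1,2) by simp
      show "\<nu> (A, C) \<le> \<mu>.prob C" if "C \<in> sets \<mu>" for C
        using biadditive_dominated(2)[OF \<nu> ev[OF A], of C] marg[of C] that by simp
    qed (rule that)
    interpret N: finite_measure N by fact
    have spN: "space N = UNIV" using sets_eq_imp_space_eq[OF N(2)] by simp
    have \<phi>N: "\<phi> \<in> borel_measurable N" using \<phi>(1) N(2) by (simp cong: measurable_cong_sets)
    have eN: "emeasure N C = ennreal (\<nu> (A, C))" if "C \<in> sets borel" for C
      using N(4)[of C] that by (simp add: N.emeasure_eq_measure)
    let ?V = "distr (density P (indicator A)) borel V"
    have eV: "emeasure ?V B = emeasure P (A \<inter> V -` B)" if "B \<in> sets borel" for B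
    proof -
      have m: "V -` B \<inter> space P \<in> sets P" using VP that by (rule measurable_sets)
      then have "emeasure ?V B = emeasure P (A \<inter> (V -` B \<inter> space P))"
        using VP that ev[OF A] by (simp add: emeasure_distr emeasure_density flip: indicator_inter_arith)
      also have "A \<inter> (V -` B \<inter> space P) = A \<inter> V -` B" using Asub by auto
      finally show ?thesis .
    qed
    have "?V = distr N borel \<phi>"
    proof (rule measure_eqI_lessThan)
      fix r :: real
      have eP: "emeasure ?V {r<..} = emeasure P {\<omega> \<in> A. r < V \<omega>}"
        by (subst eV) (auto intro!: arg_cong[of _ _ "emeasure P"])
      then show "emeasure ?V {r<..} < \<infinity>" by (simp add: emeasure_eq_measure)
      have eQ: "emeasure (distr N borel \<phi>) {r<..} = emeasure N {x. r < \<phi> x}"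
        using \<phi>N by (simp add: emeasure_distr spN vimage_def)
      show "emeasure ?V {r<..} = emeasure (distr N borel \<phi>) {r<..}"
      proof (cases "r < 0")
        case True
        then have "r < \<phi> x" for x using \<phi>(2)[of x] by auto
        then show ?thesis unfolding eP eQ V_gt using True eN[of UNIV] biadditiveD(2)[OF \<nu> ev[OF A]]
          by (simp add: emeasure_eq_measure)
      next
        case False
        define D where "D = Q \<inter> {r<..}"
        have D: "countable D" using Q(1) by (auto simp: D_def intro: countable_Int1)
        define W where "W q = {\<omega> \<in> A. ennreal (U \<omega>) \<le> H q \<omega>}" for q
        have eq1: "{\<omega> \<in> A. r < V \<omega>} = (\<Union>q\<in>D. W q)"
          using False by (auto simp: V_gt D_def W_def)
        have eq2: "{x. r < \<phi> x} = (\<Union>q\<in>D. {x. q < \<phi> x})"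
        proof (intro set_eqI iffI)
          fix x assume "x \<in> {x. r < \<phi> x}"
          then obtain q where "q \<in> \<rat>" "r < q" "q < \<phi> x" using Rats_dense_in_real[of r "\<phi> x"] by auto
          then show "x \<in> (\<Union>q\<in>D. {x. q < \<phi> x})" using False \<phi>(2)[of x] by (auto simp: D_def Q_def)
        qed (auto simp: D_def)
        show ?thesis
        proof (cases "D = {}")
          case True
          \<comment> \<open>This is the case r \<ge> 1, where both tails are empty.\<close>
          show ?thesis unfolding eP eQ eq1 eq2 True by simp
        next
          case False
          have "emeasure P {\<omega> \<in> A. r < V \<omega>} = (SUP q\<in>D. emeasure P (W q))"
            unfolding eq1
          proof (rule emeasure_countable_chain[OF D False])
            fix q
            show "W q \<in> events"
            proof -
              have [measurable]: "A \<in> events" "H q \<in> borel_measurable P" "U \<in> borel_measurable P"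
                using ev[OF A] measurable_from_subalg[OF subJ HJ] U by auto
              have "W q = {\<omega> \<in> space P. \<omega> \<in> A \<and> ennreal (U \<omega>) \<le> H q \<omega>}"
                using Asub by (auto simp: W_def)
              then show ?thesis by simp
            qed
            fix p
            show "W p \<subseteq> W q \<or>
              W q \<subseteq> W p"
              using H_mono[of p q] H_mono[of q p] linear[of p q] by (auto simp: W_def intro: order_trans)
          qed
          also have "\<dots> = (SUP q\<in>D. emeasure N {x. q < \<phi> x})"
          proof (rule SUP_cong[OF refl])
            fix q assume q: "q \<in> D"
            have "emeasure P (W q) = (\<integral>\<^sup>+\<omega>. min 1 (H q \<omega>) * indicator A \<omega> \<partial>P)"
              unfolding W_def by (rule emeasure_uniform_threshold[OF G U dU ind H_meas A])
            also have "\<dots> = (\<integral>\<^sup>+\<omega>. min 1 (H q \<omega>) * indicator A \<omega> \<partial>?PG)"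
              by (rule nn_integral_subalgebra2[OF G, symmetric]) (use H_meas A in measurable)
            also have "\<dots> = (\<integral>\<^sup>+\<omega>. dens {x. q < \<phi> x} \<omega> * indicator A \<omega> \<partial>?PG)"
              by (rule nn_integral_cong_AE) (use H_AE[of q] q in \<open>auto simp: D_def elim!: eventually_mono\<close>)
            also have "\<dots> = emeasure N {x. q < \<phi> x}"
              by (subst dens(2)[OF _ A]) (simp_all add: eN)
            finally show "emeasure P (W q) = emeasure N {x. q < \<phi> x}" .
          qed
          also have "\<dots> = emeasure N {x. r < \<phi> x}"
            unfolding eq2
          proof (rule emeasure_countable_chain[OF D False, symmetric])
            fix p q :: real
            show "{x. q < \<phi> x} \<in> sets N" by (simp add: N(2))
            show "{x. p < \<phi> x} \<subseteq> {x. q < \<phi> x} \<or> {x. q < \<phi> x} \<subseteq> {x. p < \<phi> x}"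
              using linear[of p q] by auto
          qed
          finally show ?thesis unfolding eP eQ .
        qed
      qed
    qed simp_all
    then have "emeasure P (A \<inter> V -` B) = emeasure (distr N borel \<phi>) B" using eV[OF B] by simp
    also have "\<dots> = ennreal (\<nu> (A, \<phi> -` B))"
      using \<phi>N B measurable_sets[OF \<phi>(1) B] by (simp add: emeasure_distr spN eN)
    finally show ?thesis .
  qed
  show thesis
  proof
    show "(\<lambda>\<omega>. d (V \<omega>)) \<in> sigma_join (sigma_alg_of P U) G \<rightarrow>\<^sub>M borel"
      using measurable_compose[OF VJ d(1)] by (simp add: J_def)
    fix A and C :: "'s set" assume A: "A \<in> sets G" and C: "C \<in> sets borel"
    have dC: "d -` C \<in> sets borel" using measurable_sets[OF d(1) C] by simp
    have D: "\<phi> -` d -` C \<in> sets borel" using measurable_sets[OF \<phi>(1) dC] by simp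
    have "prob (A \<inter> (\<lambda>\<omega>. d (V \<omega>)) -` C) = \<nu> (A, \<phi> -` d -` C)"
      using law[OF A dC] biadditiveD(1)[OF \<nu> ev[OF A] D]
      by (simp add: emeasure_eq_measure vimage_def)
    also have "\<dots> = \<nu> (A, C)"
    proof -
      \<comment> \<open>Decoding fails only on a \<mu>-null set, and the plan at \<open>A\<close> is
        dominated by \<mu>, so \<open>C\<close> may be exchanged for the set of points whose decoded
        code lies in \<open>C\<close>.\<close>
      have null: "\<nu> (A, E) = 0" if "E \<in> sets borel" "E \<subseteq> {x. d (\<phi> x) \<noteq> x}" for E
      proof -
        have "AE x in \<mu>. x \<notin> E" using d(2) that(2) by (auto elim!: eventually_mono)
        then have "\<mu>.prob E = 0" using that(1) by (simp add: \<mu>.prob_eq_0)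
        then show ?thesis using biadditive_dominated(2)[OF \<nu> ev[OF A] that(1)] marg[OF that(1)]
            biadditiveD(1)[OF \<nu> ev[OF A] that(1)] by simp
      qed
      let ?D = "\<phi> -` d -` C"
      have split: "\<nu> (A, E) = \<nu> (A, E \<inter> E') + \<nu> (A, E - E')" if "E \<in> sets borel" "E' \<in> sets borel" for E E'
      proof -
        have "E \<inter> E' \<in> sets borel" "E - E' \<in> sets borel" "(E \<inter> E') \<inter> (E - E') = {}" using that by auto
        from biadditiveD(4)[OF \<nu> ev[OF A] this] show ?thesis by (simp add: Int_Diff_Un)
      qed
      have "\<nu> (A, ?D) = \<nu> (A, ?D \<inter> C) + \<nu> (A, ?D - C)" "\<nu> (A, C) = \<nu> (A, C \<inter> ?D) + \<nu> (A, C - ?D)"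
        by (intro split C D)+
      moreover have "\<nu> (A, ?D - C) = 0" "\<nu> (A, C - ?D) = 0"
        by (rule null; use C D in auto)+
      ultimately show ?thesis by (simp add: Int_commute)
    qed
    finally show "prob (A \<inter> (\<lambda>\<omega>. d (V \<omega>)) -` C) = \<nu> (A, C)" .
  qed
qed

end

section \<open>Couplings obtained from plans, and their cost\<close>

lemma le_of_approx:
  fixes x y c :: real
  assumes x: "\<And>k. x \<le> y + c / real (Suc k)"
  shows "x \<le> y"
proof (rule LIMSEQ_le_const)
  show "(\<lambda>k. y + c / real (Suc k)) \<longlonglongrightarrow> y"
    using tendsto_add[OF tendsto_const LIMSEQ_Suc[OF lim_const_over_n[of c]], of y] by simp
qed (use x in blast)

context transport_setting begin

text \<open>The plan is defined on all events, while the realisation matches it on \<open>G\<close>.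
  As \<open>X\<close> is \<open>G\<close>-measurable, this fixes the joint cell masses of
  \<open>X\<close> and \<open>Y\<close>, hence the cost up to the mesh; as \<open>G\<close> contains
  \<open>M\<close>, the product form on \<open>M\<close> is inherited.\<close>

lemma coupling:
  fixes \<phi> :: "'s \<Rightarrow> real"
  assumes G: "subalgebra P G" and MG: "sets M \<subseteq> sets G" and XG: "X \<in> G \<rightarrow>\<^sub>M borel"
    and U: "U \<in> borel_measurable P"
    and dU: "distr P lborel U = uniform_measure lborel {0..1::real}"
    and ind: "indep_set (sets (sigma_alg_of P U)) (sets G)"
    and \<phi>: "\<phi> \<in> borel_measurable borel" "\<And>x. \<phi> x \<in> {0..1}"
    and d: "d \<in> borel \<rightarrow>\<^sub>M borel" "AE x in \<mu>. d (\<phi> x) = x"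
  obtains Y where "Y \<in> sigma_join (sigma_alg_of P U) G \<rightarrow>\<^sub>M borel"
    "\<And>A C. A \<in> sets M \<Longrightarrow> C \<in> sets borel \<Longrightarrow> prob (A \<inter> Y -` C) = prob A * \<mu>.prob C"
    "\<And>m. (\<integral>\<omega>. seq_cost f m (X \<omega>) (Y \<omega>) \<partial>P) \<le> expectation b"
proof -
  obtain \<nu> where \<nu>: "biadditive \<nu>"
    and prod: "\<And>A C. A \<in> sets M \<Longrightarrow> C \<in> sets borel \<Longrightarrow> \<nu> (A, C) = prob A * \<mu>.prob C"
    and cost: "\<And>m k. cell_cost m k \<nu> \<le> expectation b + 2 / real (Suc k)"
    by (rule exists_plan, rule that)
  have spM: "space P \<in> sets M" using subalg sets.top[of M] by (simp add: subalgebra_def)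
  have marg: "\<nu> (space P, C) = \<mu>.prob C" if "C \<in> sets borel" for C
    unfolding prod[OF spM that] prob_space by simp
  obtain Y where Y: "Y \<in> sigma_join (sigma_alg_of P U) G \<rightarrow>\<^sub>M borel"
    and law: "\<And>A C. A \<in> sets G \<Longrightarrow> C \<in> sets borel \<Longrightarrow> prob (A \<inter> Y -` C) = \<nu> (A, C)"
  proof (rule realise_plan[OF \<nu> _ G U dU ind \<phi> d])
    show "\<nu> (space P, C) = \<mu>.prob C" if "C \<in> sets borel" for C by (rule marg[OF that])
  qed (rule that)
  have Y_P [measurable]: "Y \<in> P \<rightarrow>\<^sub>M borel"
    by (rule measurable_from_subalg[OF subalgebra_sigma_join[OF subalgebra_sigma_alg_of[OF U] G] Y])
  show thesis
  proof
    show "prob (A \<inter> Y -` C) = prob A * \<mu>.prob C" if "A \<in> sets M" "C \<in> sets borel" for A C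
      unfolding law[OF subsetD[OF MG that(1)] that(2)] by (rule prod[OF that])
    fix m
    let ?c = "\<lambda>\<omega>. seq_cost f m (X \<omega>) (Y \<omega>)"
    obtain B where B: "seq_cost f m x y \<le> B" for x y
      using seq_cost_bounded[of f m, OF bounded_f] by metis
    have int: "integrable P ?c"
      by (rule integrable_const_bound[of _ B]) (auto simp: B seq_cost_nonneg)
    show "(\<integral>\<omega>. ?c \<omega> \<partial>P) \<le> expectation b"
    \<comment> \<open>The constant 4 is 2 from the bound on \<open>cell_cost\<close> and 1 for each
      of the two cell representatives.\<close>
    proof (rule le_of_approx[of _ _ 4])
      fix k
      let ?I = "range (cell f m k)" and ?pt = "cell_point f m k"
      define r where "r ij = seq_cost f m (?pt (fst ij)) (?pt (snd ij)) + 2 / real (Suc k)" for ij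
      define p where "p ij = \<nu> (Xcell m k (fst ij), Ycell m k (snd ij))" for ij
      let ?cc = "\<lambda>\<omega>. (cell f m k (X \<omega>), cell f m k (Y \<omega>))"
      have I: "finite ?I" by (rule finite_range_cell[OF bounded_f])
      have Yset: "{\<omega> \<in> space P. cell f m k (Y \<omega>) = j} \<in> events" for j
      proof -
        have "{\<omega> \<in> space P. cell f m k (Y \<omega>) = j} = Y -` Ycell m k j \<inter> space P" by auto
        then show ?thesis using measurable_sets[OF Y_P cell_sets(2)] by simp
      qed
      let ?E = "\<lambda>ij. {\<omega> \<in> space P. ?cc \<omega> = ij}"
      have cset: "?E ij \<in> events" for ij
      proof -
        have "?E ij = Xcell m k (fst ij) \<inter> {\<omega> \<in> space P. cell f m k (Y \<omega>) = snd ij}" by auto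
        then show ?thesis using cell_sets(1) Yset by (simp add: sets.Int)
      qed
      have lawc: "prob (space P \<inter> ?E ij) = p ij" for ij
      proof -
        have "cell f m k \<in> borel \<rightarrow>\<^sub>M count_space UNIV" using f by measurable
        from measurable_sets[OF measurable_compose[OF XG this], of "{fst ij}"]
        have "Xcell m k (fst ij) \<in> sets G"
          using G by (auto simp: vimage_def Int_def conj_commute subalgebra_def)
        from law[OF this cell_sets(2)[of m k "snd ij"]]
        have "prob (Xcell m k (fst ij) \<inter> Y -` Ycell m k (snd ij)) = \<nu> (Xcell m k (fst ij), Ycell m k (snd ij))" .
        moreover have "Xcell m k (fst ij) \<inter> Y -` Ycell m k (snd ij) = space P \<inter> ?E ij"
          by auto
        ultimately show ?thesis unfolding p_def by simp
      qed
      \<comment> \<open>\<open>sum_cells_le_integral\<close> bounds integrals from below, so it is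
        applied to the negated cost.\<close>
      have "(\<Sum>ij\<in>?I \<times> ?I. - r ij * prob (space P \<inter> ?E ij))
          \<le> (\<integral>\<omega>. indicator (space P) \<omega> * - ?c \<omega> \<partial>P)"
      proof (rule sum_cells_le_integral)
        fix \<omega>
        have "?c \<omega> \<le> seq_cost f m (?pt (cell f m k (X \<omega>))) (?pt (cell f m k (Y \<omega>))) + 2 / real (Suc k)"
          using seq_cost_perturb[of f m "X \<omega>" "Y \<omega>" "?pt (cell f m k (X \<omega>))" "?pt (cell f m k (Y \<omega>))"]
            seq_cost_cell_point(1)[of f m "X \<omega>" k] seq_cost_cell_point(1)[of f m "Y \<omega>" k] by linarith
        then show "- r (?cc \<omega>) \<le> - ?c \<omega>" unfolding r_def fst_conv snd_conv by linarith
      qed (use I int cset in auto)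
      also have "\<dots> = - (\<integral>\<omega>. ?c \<omega> \<partial>P)"
        by (subst Bochner_Integration.integral_minus[symmetric], rule Bochner_Integration.integral_cong) auto
      finally have "(\<integral>\<omega>. ?c \<omega> \<partial>P) \<le> (\<Sum>ij\<in>?I \<times> ?I. r ij * prob (space P \<inter> ?E ij))"
        by (simp only: mult_minus_left sum_negf neg_le_iff_le)
      also have "\<dots> = (\<Sum>ij\<in>?I \<times> ?I. r ij * p ij)"
        unfolding lawc ..
      also have "\<dots> = cell_cost m k \<nu> + 2 / real (Suc k) * (\<Sum>ij\<in>?I \<times> ?I. p ij)"
      proof -
        have "cell_cost m k \<nu> = (\<Sum>ij\<in>?I \<times> ?I. p ij * seq_cost f m (?pt (fst ij)) (?pt (snd ij)))"
          unfolding cell_cost_def p_def sum.cartesian_product case_prod_beta ..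
        then show ?thesis
          unfolding sum_distrib_left by (simp add: r_def algebra_simps flip: sum.distrib)
      qed
      also have "(\<Sum>ij\<in>?I \<times> ?I. p ij) = 1"
      proof -
        have "prob (space P) = (\<Sum>ij\<in>?I \<times> ?I. prob (space P \<inter> ?E ij))"
          by (rule measure_cells) (use I cset in auto)
        then show ?thesis unfolding lawc prob_space ..
      qed
      also have "cell_cost m k \<nu> + 2 / real (Suc k) * 1 \<le> expectation b + 4 / real (Suc k)"
        using cost[of m k] by simp
      finally show "(\<integral>\<omega>. ?c \<omega> \<partial>P) \<le> expectation b + 4 / real (Suc k)" by simp
    qed
  qed (rule Y)
qed

end

section \<open>Countable families and Borel codings\<close>

text \<open>The balls of radius 1/(n+1) around the points of finite nets, for all n, form a
  countable base.\<close>

lemma compact_metrizable_imp_second_countable: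
  assumes "compact_space X" "metrizable_space X"
  shows "second_countable X"
proof -
  obtain M d where "Metric_space M d" and X: "X = Metric_space.mtopology M d"
    using assms(2) by (auto simp: metrizable_space_def)
  interpret Metric_space M d by fact
  have "mtotally_bounded M"
    using assms(1) by (intro compactin_imp_mtotally_bounded) (simp add: X compact_space_def)
  then have "\<exists>F. finite F \<and> F \<subseteq> M \<and> M \<subseteq> (\<Union>x\<in>F. mball x (1 / real (Suc n)))" for n
    unfolding mtotally_bounded_def by simp
  then obtain F where F: "finite (F n)" "F n \<subseteq> M" "M \<subseteq> (\<Union>x\<in>F n. mball x (1 / real (Suc n)))" for n
    by metis
  define \<B> where "\<B> = (\<Union>n. (\<lambda>x. mball x (1 / real (Suc n))) ` F n)"
  show ?thesis unfolding second_countable_def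
  proof (intro exI conjI ballI allI impI)
    show "countable \<B>" unfolding \<B>_def using F(1) by (intro countable_UN) (auto intro: countable_finite)
    show "openin X V" if "V \<in> \<B>" for V using that by (auto simp: \<B>_def X)
    fix U z assume Uz: "openin X U \<and> z \<in> U"
    then have "z \<in> M" "\<exists>r>0. mball z r \<subseteq> U" by (auto simp: X openin_mtopology)
    then obtain r where r: "0 < r" "mball z r \<subseteq> U" "z \<in> M" by blast
    obtain n where n: "1 / real (Suc n) < r / 2" using nat_approx_posE[of "r / 2"] r(1) by auto
    obtain x where x: "x \<in> F n" "z \<in> mball x (1 / real (Suc n))" using F(3)[of n] r(3) by blast
    have "mball x (1 / real (Suc n)) \<subseteq> mball z r"
      using x n r(3) by (intro mball_subset) (auto simp: commute)
    with r(2) x show "\<exists>V\<in>\<B>. z \<in> V \<and> V \<subseteq> U" by (intro bexI[of _ "mball x (1 / real (Suc n))"]) (auto simp: \<B>_def)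
  qed
qed

text \<open>For a fixed threshold q the pairs with q < \<bar>u x - u y\<bar> form an open subset of
  K \<times> K, so countably many u cover what the whole family covers. Rational thresholds suffice
  because the inequality is strict.\<close>

lemma countable_subfamily_on_compact:
  fixes \<U> :: "('s::topological_space \<Rightarrow> real) set"
  assumes K: "compact K" "metrizable_space (top_of_set K)"
    and cont: "\<And>u. u \<in> \<U> \<Longrightarrow> continuous_on UNIV u"
  obtains \<V> where "countable \<V>" "\<V> \<subseteq> \<U>"
    "\<And>x y u r. x \<in> K \<Longrightarrow> y \<in> K \<Longrightarrow> u \<in> \<U> \<Longrightarrow> r < \<bar>u x - u y\<bar> \<Longrightarrow> \<exists>v\<in>\<V>. r < \<bar>v x - v y\<bar>"
proof -
  let ?X = "prod_topology (top_of_set K) (top_of_set K)"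
  have "compact_space ?X"
    using K(1) by (simp only: compact_space_prod_topology) (simp add: compact_space_subtopology)
  then have sc: "second_countable ?X"
    using K(2) by (intro compact_metrizable_imp_second_countable) (simp_all only: metrizable_space_prod_topology simp_thms)
  define Ou where "Ou q u = {z \<in> K \<times> K. q < \<bar>u (fst z) - u (snd z)\<bar>}" for q and u :: "'s \<Rightarrow> real"
  have Ou: "openin ?X (Ou q u)" if "u \<in> \<U>" for q u
  proof -
    have u: "continuous_map (top_of_set K) euclideanreal u"
      using cont[OF that] by (auto intro: continuous_on_subset)
    have "continuous_map ?X euclideanreal (u \<circ> fst)" "continuous_map ?X euclideanreal (u \<circ> snd)"
      by (rule continuous_map_compose[OF _ u], rule continuous_map_fst continuous_map_snd)+
    then have "continuous_map ?X euclideanreal (\<lambda>z. \<bar>u (fst z) - u (snd z)\<bar>)"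
      by (intro continuous_map_real_abs continuous_map_diff) (simp_all add: o_def)
    from openin_continuous_map_preimage[OF this, of "{q<..}"] show ?thesis
      by (simp add: Ou_def topspace_prod_topology)
  qed
  have "\<exists>\<V>. countable \<V> \<and> \<V> \<subseteq> \<U> \<and> (\<Union>u\<in>\<U>. Ou q u) \<subseteq> (\<Union>u\<in>\<V>. Ou q u)" for q
  proof -
    have "Lindelof_space (subtopology ?X (\<Union>u\<in>\<U>. Ou q u))"
      by (intro second_countable_imp_Lindelof_space second_countable_subtopology sc)
    moreover have "(\<Union>u\<in>\<U>. Ou q u) \<subseteq> topspace ?X" by (auto simp: Ou_def)
    ultimately have L: "\<And>\<W>. (\<forall>U\<in>\<W>. openin ?X U) \<and> (\<Union>u\<in>\<U>. Ou q u) \<subseteq> \<Union>\<W> \<Longrightarrow>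
        \<exists>V. countable V \<and> V \<subseteq> \<W> \<and> (\<Union>u\<in>\<U>. Ou q u) \<subseteq> \<Union>V"
      by (simp add: Lindelof_space_subtopology_subset)
    obtain V where V: "countable V" "V \<subseteq> Ou q ` \<U>" "(\<Union>u\<in>\<U>. Ou q u) \<subseteq> \<Union>V"
      using L[of "Ou q ` \<U>"] Ou by auto
    then obtain \<V> where "countable \<V>" "\<V> \<subseteq> \<U>" "V = Ou q ` \<V>"
      using countable_subset_image[of V "Ou q" \<U>] by blast
    then show ?thesis using V(3) by auto
  qed
  then obtain \<V> where \<V>: "countable (\<V> q)" "\<V> q \<subseteq> \<U>" "(\<Union>u\<in>\<U>. Ou q u) \<subseteq> (\<Union>u\<in>\<V> q. Ou q u)" for q :: real
    by metis
  show thesis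
  proof
    show "countable (\<Union>q\<in>\<rat>. \<V> q)" using \<V>(1) by (intro countable_UN countable_rat)
    show "(\<Union>q\<in>\<rat>. \<V> q) \<subseteq> \<U>" using \<V>(2) by blast
    fix x y u r assume xy: "x \<in> K" "y \<in> K" "u \<in> \<U>" "r < \<bar>u x - u y\<bar>"
    obtain q where q: "q \<in> \<rat>" "r < q" "q < \<bar>u x - u y\<bar>" using Rats_dense_in_real[OF xy(4)] by blast
    then have "(x, y) \<in> (\<Union>u\<in>\<U>. Ou q u)" using xy by (auto simp: Ou_def)
    then obtain v where "v \<in> \<V> q" "(x, y) \<in> Ou q v" using \<V>(3)[of q] by blast
    then show "\<exists>v\<in>\<Union>q\<in>\<rat>. \<V> q. r < \<bar>v x - v y\<bar>" using q by (force simp: Ou_def)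
  qed
qed

text \<open>Stated for an arbitrary family because it is used twice: for \<open>Lip_c c\<close>, to
  recover the cost, and for continuous functions into [0,1], to separate points. Monotonicity of
  \<open>K\<close> puts any two points into one compact set.\<close>

lemma countable_subfamily:
  fixes \<U> :: "('s::topological_space \<Rightarrow> real) set" and K :: "nat \<Rightarrow> 's set"
  assumes K: "\<And>n. compact (K n)" "incseq K"
    and met: "\<And>K :: 's set. compact K \<Longrightarrow> metrizable_space (top_of_set K)"
    and cont: "\<And>u. u \<in> \<U> \<Longrightarrow> continuous_on UNIV u" and ne: "\<U> \<noteq> {}"
  obtains f :: "nat \<Rightarrow> 's \<Rightarrow> real" where "range f \<subseteq> \<U>"
    "\<And>x y u r. x \<in> (\<Union>n. K n) \<Longrightarrow> y \<in> (\<Union>n. K n) \<Longrightarrow> u \<in> \<U> \<Longrightarrow> r < \<bar>u x - u y\<bar> \<Longrightarrow> \<exists>n. r < \<bar>f n x - f n y\<bar>"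
proof -
  have "\<exists>\<V>. countable \<V> \<and> \<V> \<subseteq> \<U> \<and> (\<forall>x\<in>K n. \<forall>y\<in>K n. \<forall>u\<in>\<U>. \<forall>r. r < \<bar>u x - u y\<bar> \<longrightarrow> (\<exists>v\<in>\<V>. r < \<bar>v x - v y\<bar>))" for n
  proof (rule countable_subfamily_on_compact[OF K(1) met[OF K(1)], of \<U> n])
    fix \<V>
    assume V: "countable \<V>" "\<V> \<subseteq> \<U>"
      "\<And>x y u r. x \<in> K n \<Longrightarrow> y \<in> K n \<Longrightarrow> u \<in> \<U> \<Longrightarrow> r < \<bar>u x - u y\<bar> \<Longrightarrow> \<exists>v\<in>\<V>. r < \<bar>v x - v y\<bar>"
    show ?thesis by (intro exI[of _ \<V>] conjI ballI allI impI V)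
  qed (rule cont)
  then obtain \<V> where \<V>: "countable (\<V> n)" "\<V> n \<subseteq> \<U>"
    "\<forall>x\<in>K n. \<forall>y\<in>K n. \<forall>u\<in>\<U>. \<forall>r. r < \<bar>u x - u y\<bar> \<longrightarrow> (\<exists>v\<in>\<V> n. r < \<bar>v x - v y\<bar>)" for n
    by metis
  obtain u0 where u0: "u0 \<in> \<U>" using ne by blast
  let ?W = "insert u0 (\<Union>n. \<V> n)"
  have W: "countable ?W" "?W \<noteq> {}" using \<V>(1) by auto
  show thesis
  proof
    show "range (from_nat_into ?W) \<subseteq> \<U>" using W \<V>(2) u0 by (auto simp: range_from_nat_into)
    fix x y u r assume xy: "x \<in> (\<Union>n. K n)" "y \<in> (\<Union>n. K n)" "u \<in> \<U>" "r < \<bar>u x - u y\<bar>"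
    then obtain a b where "x \<in> K a" "y \<in> K b" by blast
    then have "x \<in> K (max a b)" "y \<in> K (max a b)"
      using incseqD[OF K(2), of a "max a b"] incseqD[OF K(2), of b "max a b"] by auto
    then obtain v where "v \<in> \<V> (max a b)" "r < \<bar>v x - v y\<bar>" using \<V>(3) xy(3,4) by blast
    moreover then obtain n where "from_nat_into ?W n = v" using from_nat_into_surj[OF W(1), of v] by blast
    ultimately show "\<exists>n. r < \<bar>from_nat_into ?W n x - from_nat_into ?W n y\<bar>" by blast
  qed
qed

text \<open>Base 3 with digits 0 and 1 only avoids the ambiguity of binary expansions: every tail is
  at most half a unit, so each digit is read back by a floor and is a Borel function of the
  code.\<close>

definition ternary :: "(nat \<Rightarrow> bool) \<Rightarrow> real" where
  "ternary \<beta> = (\<Sum>k. of_bool (\<beta> k) / 3 ^ Suc k)"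

lemma ternary_summable: "summable (\<lambda>k. of_bool (\<beta> k) / 3 ^ Suc k :: real)"
proof (rule summable_comparison_test'[of "\<lambda>k. (1/3) ^ Suc k" 0])
  show "summable (\<lambda>k. (1/3) ^ Suc k :: real)"
    by (subst summable_Suc_iff) (simp add: summable_geometric)
qed (simp add: power_divide)

lemma ternary_bounds: "0 \<le> ternary \<beta>" "ternary \<beta> \<le> 1 / 2"
proof -
  show "0 \<le> ternary \<beta>" unfolding ternary_def by (rule suminf_nonneg[OF ternary_summable]) simp
  have s: "(\<lambda>k. (1/3) ^ Suc k :: real) sums (1/2)"
    using sums_mult[OF geometric_sums[of "1/3::real"], of "1/3"] by simp
  have "ternary \<beta> \<le> (\<Sum>k. (1/3) ^ Suc k)" unfolding ternary_def
    by (rule suminf_le[OF _ ternary_summable sums_summable[OF s]]) (auto simp: power_divide)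
  then show "ternary \<beta> \<le> 1 / 2" using sums_unique[OF s] by simp
qed

text \<open>The scaled number is an integer congruent to the digit modulo 3 plus a shifted ternary
  number in [0, 1/2], which the floor removes.\<close>

lemma ternary_digit: "\<lfloor>3 ^ Suc k * ternary \<beta>\<rfloor> mod 3 = of_bool (\<beta> k)"
proof -
  define head :: int where "head = (\<Sum>j<k. of_bool (\<beta> j) * 3 ^ (k - Suc j))"
  have "ternary \<beta> = (\<Sum>j. of_bool (\<beta> (j + Suc k)) / 3 ^ Suc (j + Suc k)) + (\<Sum>j<Suc k. of_bool (\<beta> j) / 3 ^ Suc j)"
    unfolding ternary_def by (rule suminf_split_initial_segment[OF ternary_summable])
  also have "(\<Sum>j. of_bool (\<beta> (j + Suc k)) / 3 ^ Suc (j + Suc k) :: real) = ternary (\<lambda>j. \<beta> (j + Suc k)) / 3 ^ Suc k"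
    unfolding ternary_def
    by (subst suminf_divide[OF ternary_summable, symmetric]) (simp add: power_add mult_ac)
  finally have "3 ^ Suc k * ternary \<beta> = ternary (\<lambda>j. \<beta> (j + Suc k)) + 3 ^ Suc k * (\<Sum>j<Suc k. of_bool (\<beta> j) / 3 ^ Suc j)"
    by (simp add: distrib_left)
  also have "3 ^ Suc k * (\<Sum>j<Suc k. of_bool (\<beta> j) / 3 ^ Suc j :: real) = real_of_int (3 * head + of_bool (\<beta> k))"
  proof -
    have "3 ^ Suc k * (of_bool (\<beta> j) / 3 ^ Suc j) = 3 * (of_bool (\<beta> j) * 3 ^ (k - Suc j) :: real)" if "j < k" for j
    proof -
      have "(3::real) ^ Suc k = 3 * 3 ^ (k - Suc j) * 3 ^ Suc j"
        using that by (simp flip: power_add power_Suc)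
      then show ?thesis by simp
    qed
    then have "3 ^ Suc k * (\<Sum>j<k. of_bool (\<beta> j) / 3 ^ Suc j :: real) = (\<Sum>j<k. 3 * (of_bool (\<beta> j) * 3 ^ (k - Suc j)))"
      unfolding sum_distrib_left by (intro sum.cong) auto
    then show ?thesis by (simp add: head_def sum_distrib_left distrib_left del: power_Suc sum_of_bool_mult_eq)
  qed
  finally have "\<lfloor>3 ^ Suc k * ternary \<beta>\<rfloor> = 3 * head + of_bool (\<beta> k)"
    using ternary_bounds[of "\<lambda>j. \<beta> (j + Suc k)"] by linarith
  then show ?thesis by simp
qed

text \<open>
  A point of \<open>\<Union>n. K n\<close> is coded by the ternary digits that record \<open>q < h i x\<close> for all \<open>i\<close>
  and rational \<open>q\<close>. Decoding is Borel since \<open>h\<close> maps compact sets to compact, hence closed,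
  sets of sequences.
\<close>
lemma borel_coding:
  fixes h :: "nat \<Rightarrow> 's::topological_space \<Rightarrow> real" and K :: "nat \<Rightarrow> 's set"
  assumes K: "\<And>n. compact (K n)" and h: "\<And>i. continuous_on UNIV (h i)" "\<And>i x. h i x \<in> {0..1}"
    and sep: "\<And>x y. x \<in> (\<Union>n. K n) \<Longrightarrow> y \<in> (\<Union>n. K n) \<Longrightarrow> (\<And>i. h i x = h i y) \<Longrightarrow> x = y"
  obtains \<phi> :: "'s \<Rightarrow> real" and d where "\<phi> \<in> borel_measurable borel" "\<And>x. \<phi> x \<in> {0..1}"
    "d \<in> borel \<rightarrow>\<^sub>M borel" "\<And>x. x \<in> (\<Union>n. K n) \<Longrightarrow> d (\<phi> x) = x"
proof -
  have h_meas [measurable]: "h i \<in> borel_measurable borel" for i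
    by (rule borel_measurable_continuous_onI[OF h(1)])
  \<comment> \<open>Each digit position encodes a function index and a rational, so that the digits
    record the Dedekind cuts of all values \<open>h i x\<close> at once.\<close>
  define bit where "bit x k = (case from_nat k of (i, q) \<Rightarrow> of_rat q < h i x)" for x and k :: nat
  define \<phi> where "\<phi> x = ternary (bit x)" for x
  have \<phi>: "\<phi> \<in> borel_measurable borel"
    unfolding \<phi>_def ternary_def bit_def case_prod_beta by measurable
  define Q where "Q = {q::rat. 0 \<le> q \<and> q \<le> 1}"
  have Q: "0 \<in> Q" by (simp add: Q_def)
  define on where "on i q t \<longleftrightarrow> \<lfloor>3 ^ Suc (to_nat (i, q)) * t\<rfloor> mod 3 = 1" for i :: nat and q :: rat and t :: real
  have on: "on i q (\<phi> x) \<longleftrightarrow> of_rat q < h i x" for i q x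
    unfolding on_def \<phi>_def ternary_digit by (simp add: bit_def)
  \<comment> \<open>Recovers \<open>h i x\<close> as a supremum of the rationals below it. A
    rational that is switched off contributes 0, so \<open>H\<close> is bounded and Borel for all t,
    including those that are no code.\<close>
  define H where "H t i = (SUP q\<in>Q. if on i q t then of_rat q else 0 :: real)" for t i
  have H_bdd: "bdd_above ((\<lambda>q. if on i q t then of_rat q else 0 :: real) ` Q)" for i t
    by (rule bdd_aboveI[of _ 1]) (auto simp: Q_def)
  have H_meas: "H \<in> borel_measurable borel"
  proof (rule measurable_coordinatewise_then_product)
    fix i
    have [measurable]: "Measurable.pred borel (on i q)" for q unfolding on_def by measurable
    show "(\<lambda>t. H t i) \<in> borel_measurable borel"
      unfolding H_def
    proof (rule borel_measurable_cSUP)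
      show "bdd_above ((\<lambda>q. if on i q t then of_rat q else 0 :: real) ` Q)" for t by (rule H_bdd)
    qed auto
  qed
  have H: "H (\<phi> x) i = h i x" for x i
  proof (rule antisym)
    show "H (\<phi> x) i \<le> h i x"
      unfolding H_def using Q h(2)[of i x] by (intro cSUP_least) (auto simp: on)
    show "h i x \<le> H (\<phi> x) i"
    proof (rule dense_le)
      fix r assume r: "r < h i x"
      show "r \<le> H (\<phi> x) i"
      proof (cases "r < 0")
        case True
        have "0 \<le> H (\<phi> x) i" unfolding H_def by (rule cSUP_upper2[OF H_bdd Q]) (simp add: on)
        with True show ?thesis by simp
      next
        case False
        obtain q where q: "r < of_rat q" "of_rat q < h i x" using of_rat_dense[OF r] by blast
        moreover have "h i x \<le> 1" using h(2)[of i x] by simp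
        ultimately have "0 \<le> real_of_rat q" "real_of_rat q \<le> 1" using False by linarith+
        then have "q \<in> Q" by (simp add: Q_def)
        then show ?thesis unfolding H_def using q by (intro cSUP_upper2[OF H_bdd]) (auto simp: on)
      qed
    qed
  qed
  define d where "d t = (if \<exists>x\<in>\<Union>n. K n. (\<lambda>i. h i x) = H t then SOME x. x \<in> (\<Union>n. K n) \<and> (\<lambda>i. h i x) = H t
    else undefined)" for t
  have d_eq: "d t = x" if "x \<in> (\<Union>n. K n)" "(\<lambda>i. h i x) = H t" for t x
  proof -
    have ex: "\<exists>x. x \<in> (\<Union>n. K n) \<and> (\<lambda>i. h i x) = H t" using that by blast
    from someI_ex[OF this] that have "(SOME x. x \<in> (\<Union>n. K n) \<and> (\<lambda>i. h i x) = H t) = x"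
      by (intro sep) (auto simp: fun_eq_iff)
    then show ?thesis using that by (auto simp: d_def)
  qed
  have d_undef: "d t = undefined" if "\<not> (\<exists>x\<in>\<Union>n. K n. (\<lambda>i. h i x) = H t)" for t
    using that by (simp add: d_def)
  have im: "(\<Union>n. (\<lambda>x i. h i x) ` (F \<inter> K n)) \<in> sets borel" if F: "closed F" for F
  proof (rule sets.countable_UN, safe)
    fix n
    have "compact (F \<inter> K n)" using compact_Int_closed[OF K[of n] F] by (simp only: Int_commute)
    moreover have "continuous_on (F \<inter> K n) (\<lambda>x i. h i x)"
      by (intro continuous_on_coordinatewise_then_product continuous_on_subset[OF h(1)]) auto
    ultimately have "compact ((\<lambda>x i. h i x) ` (F \<inter> K n))" by (rule compact_continuous_image[rotated])
    then show "(\<lambda>x i. h i x) ` (F \<inter> K n) \<in> sets borel" by (intro borel_closed compact_imp_closed)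
  qed
  have "d \<in> borel \<rightarrow>\<^sub>M borel"
  proof (rule borel_measurableI)
    fix S :: "'s set" assume "open S"
    then have cl: "closed (- S)" by (simp add: closed_def)
    let ?E = "\<lambda>F. H -` (\<Union>n. (\<lambda>x i. h i x) ` (F \<inter> K n))"
    have E: "?E F \<in> sets borel" if "closed F" for F
      using measurable_sets[OF H_meas im[OF that]] by simp
    have E_iff: "t \<in> ?E F \<longleftrightarrow> (\<exists>x\<in>\<Union>n. K n. H t = (\<lambda>i. h i x) \<and> x \<in> F)" for t F
      unfolding vimage_eq UN_iff image_iff by blast
    \<comment> \<open>The preimage is computed from the closed complement of \<open>S\<close>, since
      only closed sets are known to have images that are countable unions of compact sets. The
      second part of the union concerns the t without a decoded point, all of which are sent to
      \<open>undefined\<close>.\<close>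
    have "d -` S = - (?E (- S) \<union> (if undefined \<in> S then {} else - ?E UNIV))"
    proof (rule set_eqI)
      fix t
      show "t \<in> d -` S \<longleftrightarrow> t \<in> - (?E (- S) \<union> (if undefined \<in> S then {} else - ?E UNIV))"
      proof (cases "\<exists>x\<in>\<Union>n. K n. (\<lambda>i. h i x) = H t")
        case True
        then obtain x where x: "x \<in> (\<Union>n. K n)" "(\<lambda>i. h i x) = H t" by blast
        have "t \<in> ?E F \<longleftrightarrow> x \<in> F" for F
        proof
          assume "t \<in> ?E F"
          then obtain x' where x': "x' \<in> (\<Union>n. K n)" "H t = (\<lambda>i. h i x')" "x' \<in> F"
            unfolding E_iff by blast
          then have "x' = x" using d_eq[OF x'(1) x'(2)[symmetric]] d_eq[OF x] by simp
          with x'(3) show "x \<in> F" by simp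
        next
          assume "x \<in> F"
          then show "t \<in> ?E F" unfolding E_iff using x(1) x(2)[symmetric] by blast
        qed
        from this[of "- S"] this[of UNIV] show ?thesis using d_eq[OF x] by auto
      next
        case False
        then have "t \<notin> ?E F" for F unfolding E_iff by fastforce
        from this[of "- S"] this[of UNIV] show ?thesis using d_undef[OF False] by auto
      qed
    qed
    then show "d -` S \<inter> space borel \<in> sets borel" using E[OF cl] E[of UNIV] by auto
  qed
  moreover have "d (\<phi> x) = x" if "x \<in> (\<Union>n. K n)" for x
    by (rule d_eq[OF that]) (simp add: fun_eq_iff H)
  moreover have "\<phi> x \<in> {0..1}" for x using ternary_bounds[of "bit x"] by (simp add: \<phi>_def)
  ultimately show thesis using \<phi> that by blast
qed

text \<open>No separation axiom is assumed. The set of the two points is compact, hence metrizable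
  and Hausdorff as a subspace; this yields an open set containing x but not y, to whose complement
  complete regularity applies.\<close>

lemma separating_function:
  fixes x y :: "'s::topological_space"
  assumes cr: "completely_regular_space (euclidean :: 's topology)"
    and met: "\<And>K :: 's set. compact K \<Longrightarrow> metrizable_space (top_of_set K)" and "x \<noteq> y"
  obtains u :: "'s \<Rightarrow> real" where "continuous_on UNIV u" "\<And>z. u z \<in> {0..1}" "u x = 0" "u y = 1"
proof -
  have "Hausdorff_space (top_of_set {x, y})"
    by (intro metrizable_imp_Hausdorff_space met finite_imp_compact) simp
  then obtain V where "openin (top_of_set {x, y}) V" "x \<in> V" "y \<notin> V"
    using \<open>x \<noteq> y\<close> unfolding Hausdorff_space_def disjnt_def by (metis IntI empty_iff insert_iff topspace_euclidean_subtopology)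
  then obtain W where W: "open W" "x \<in> W" "y \<notin> W" by (auto simp: openin_open)
  then have "closedin euclidean (- W)" "x \<in> topspace euclidean - (- W)" by (auto simp: closed_Compl)
  then obtain u :: "'s \<Rightarrow> real" where "continuous_map euclidean (top_of_set {0..1}) u" "u x = 0" "u ` (- W) \<subseteq> {1}"
    using cr unfolding completely_regular_space_def by blast
  with W(3) have "continuous_on UNIV u" "u z \<in> {0..1}" "u x = 0" "u y = 1" for z
    by (auto simp: continuous_map_in_subtopology)
  then show thesis by (rule that)
qed

lemma completely_regular_compact_closed:
  fixes K :: "'s::topological_space set"
  assumes cr: "completely_regular_space (euclidean :: 's topology)"
    and met: "\<And>K :: 's set. compact K \<Longrightarrow> metrizable_space (top_of_set K)" and "compact K"
  shows "closed K"
proof -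
  have "Hausdorff_space (euclidean :: 's topology)"
    unfolding Hausdorff_space_def
  proof (intro allI impI, elim conjE)
    fix x y :: 's assume "x \<noteq> y"
    obtain u :: "'s \<Rightarrow> real" where u: "continuous_on UNIV u" "u x = 0" "u y = 1"
      by (rule separating_function[OF cr met \<open>x \<noteq> y\<close>])
    have "open (u -` {..<1/2})" "open (u -` {1/2<..})"
      using u(1) by (auto intro!: open_vimage)
    then show "\<exists>U V. openin euclidean U \<and> openin euclidean V \<and> x \<in> U \<and> y \<in> V \<and> disjnt U V"
      using u(2,3) by (intro exI[of _ "u -` {..<1/2}"] exI[of _ "u -` {1/2<..}"]) (auto simp: disjnt_def)
  qed
  then show ?thesis using compactin_imp_closedin[of euclidean K] assms(3) by simp
qed

section \<open>The Kantorovich-Rubinstein functional\<close>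

text \<open>In the applications \<open>f\<close> is built from a countable supremum of measurable
  functions, and \<open>g\<close> is a quantity defined by an uncountable one.\<close>

lemma borel_measurable_completion_AE:
  fixes g :: "'a \<Rightarrow> 'b::topological_space"
  assumes f: "f \<in> borel_measurable N" and ae: "AE x in N. f x = g x"
  shows "g \<in> borel_measurable (completion N)"
proof (rule measurableI)
  fix B :: "'b set" assume B: "B \<in> sets borel"
  show "g -` B \<inter> space (completion N) \<in> sets (completion N)"
  proof (rule completion.in_sets_AE)
    show "f -` B \<inter> space N \<in> sets (completion N)"
      using measurable_sets[OF f B] by (rule sets_completionI_sets)
    show "AE x in completion N. x \<in> f -` B \<inter> space N \<longleftrightarrow> x \<in> g -` B \<inter> space (completion N)"
      using AE_completion[OF ae] by eventually_elim simp
  qed auto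
qed simp

lemma (in prob_space) integrable_kernel_integral:
  fixes G :: "'s::topological_space \<Rightarrow> real"
  assumes \<kappa>: "\<kappa> \<in> M \<rightarrow>\<^sub>M prob_algebra borel" and G: "G \<in> borel_measurable borel" "\<And>x. \<bar>G x\<bar> \<le> b"
  shows "integrable M (\<lambda>w. \<integral>x. G x \<partial>\<kappa> w)"
proof (rule integrable_const_bound[of _ b])
  show "AE w in M. norm (\<integral>x. G x \<partial>\<kappa> w) \<le> b"
  proof (rule AE_I2)
    fix w assume "w \<in> space M"
    then have k: "prob_space (\<kappa> w)" "sets (\<kappa> w) = sets borel"
      using measurable_space[OF \<kappa>] by (auto simp: space_prob_algebra)
    interpret k: prob_space "\<kappa> w" by (rule k(1))
    have "integrable (\<kappa> w) G"
      using G k(2) by (intro k.integrable_const_bound[of _ b]) (auto cong: measurable_cong_sets)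
    then have "(\<integral>x. \<bar>G x\<bar> \<partial>\<kappa> w) \<le> (\<integral>x. b \<partial>\<kappa> w)" by (intro integral_mono) (auto simp: G(2))
    then show "norm (\<integral>x. G x \<partial>\<kappa> w) \<le> b"
      using integral_abs_bound[of "\<kappa> w" G] k.prob_space by (simp del: integral_abs_bound)
  qed
  show "(\<lambda>w. \<integral>x. G x \<partial>\<kappa> w) \<in> borel_measurable M"
    by (rule measurable_compose[OF measurable_prob_algebraD[OF \<kappa>] integral_measurable_subprob_algebra[OF G(1)]])
qed

text \<open>Both sides integrate \<open>G\<close> against the same measure: the image under
  \<open>X\<close> of the law restricted to \<open>E\<close> is the mixture of the kernel over
  \<open>E\<close>, since the two agree on Borel sets by \<open>law\<close>. A constant kernel
  covers the case of an independent variable.\<close>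

lemma (in prob_space) integral_kernel_law:
  fixes X :: "'a \<Rightarrow> 's::topological_space" and G :: "'s \<Rightarrow> real"
  assumes \<kappa>: "\<kappa> \<in> M \<rightarrow>\<^sub>M prob_algebra borel" and X: "X \<in> M \<rightarrow>\<^sub>M borel" and E: "E \<in> events"
    and law: "\<And>B. B \<in> sets borel \<Longrightarrow> prob (E \<inter> X -` B) = (\<integral>w. indicator E w * measure (\<kappa> w) B \<partial>M)"
    and G: "G \<in> borel_measurable borel" "\<And>x. \<bar>G x\<bar> \<le> b"
  shows "(\<integral>w. indicator E w * G (X w) \<partial>M) = (\<integral>w. indicator E w * (\<integral>x. G x \<partial>\<kappa> w) \<partial>M)"
proof -
  let ?ME = "density M (indicator E)"
  have fin: "finite_measure ?ME" using E by (intro finite_measureI) (simp add: emeasure_density)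
  have \<kappa>s: "\<kappa> \<in> M \<rightarrow>\<^sub>M subprob_algebra borel" by (rule measurable_prob_algebraD[OF \<kappa>])
  then have \<kappa>E: "\<kappa> \<in> ?ME \<rightarrow>\<^sub>M subprob_algebra borel" by (simp cong: measurable_cong_sets)
  have XE: "X \<in> ?ME \<rightarrow>\<^sub>M borel" using X by (simp cong: measurable_cong_sets)
  have pr: "prob_space (\<kappa> w)" "sets (\<kappa> w) = sets borel" if "w \<in> space M" for w
    using measurable_space[OF \<kappa> that] by (auto simp: space_prob_algebra)
  have "distr ?ME borel X = ?ME \<bind> \<kappa>"
  proof (rule measure_eqI)
    show "sets (distr ?ME borel X) = sets (?ME \<bind> \<kappa>)"
      using sets_bind[of ?ME \<kappa> borel] pr(2) not_empty by simp
    fix B assume "B \<in> sets (distr ?ME borel X)"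
    then have B: "B \<in> sets borel" by simp
    have mB: "X -` B \<inter> space M \<in> events" by (rule measurable_sets[OF X B])
    have [measurable]: "(\<lambda>w. measure (\<kappa> w) B) \<in> borel_measurable M"
      using measurable_compose[OF \<kappa>s measurable_measure_subprob_algebra[OF B]] by simp
    have int: "integrable M (\<lambda>w. indicator E w * measure (\<kappa> w) B)"
    proof (rule integrable_const_bound[of _ 1])
      show "AE w in M. norm (indicator E w * measure (\<kappa> w) B) \<le> 1"
        using pr(1) by (intro AE_I2) (auto simp: indicator_def prob_space.prob_le_1)
    qed (use E in measurable)
    have "emeasure (distr ?ME borel X) B = emeasure M (E \<inter> (X -` B \<inter> space M))"
      using XE B mB E by (simp add: emeasure_distr emeasure_density flip: indicator_inter_arith)
    also have "E \<inter> (X -` B \<inter> space M) = E \<inter> X -` B" using sets.sets_into_space[OF E] by auto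
    also have "emeasure M (E \<inter> X -` B) = ennreal (\<integral>w. indicator E w * measure (\<kappa> w) B \<partial>M)"
      using law[OF B] by (simp add: emeasure_eq_measure)
    also have "\<dots> = (\<integral>\<^sup>+w. ennreal (indicator E w * measure (\<kappa> w) B) \<partial>M)"
      by (rule nn_integral_eq_integral[symmetric, OF int]) simp
    also have "\<dots> = (\<integral>\<^sup>+w. indicator E w * emeasure (\<kappa> w) B \<partial>M)"
      using pr(1) by (intro nn_integral_cong)
        (auto simp: indicator_def finite_measure.emeasure_eq_measure prob_space.finite_measure)
    also have "\<dots> = (\<integral>\<^sup>+w. emeasure (\<kappa> w) B \<partial>?ME)"
      using E measurable_compose[OF \<kappa>s measurable_emeasure_subprob_algebra[OF B]]
      by (subst nn_integral_density) auto
    also have "\<dots> = emeasure (?ME \<bind> \<kappa>) B"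
      using \<kappa>E B not_empty by (subst emeasure_bind) auto
    finally show "emeasure (distr ?ME borel X) B = emeasure (?ME \<bind> \<kappa>) B" .
  qed
  moreover have dens: "(\<integral>w. F w \<partial>?ME) = (\<integral>w. indicator E w * F w \<partial>M)"
    if "F \<in> borel_measurable M" for F :: "'a \<Rightarrow> real"
  proof -
    have "?ME = density M (\<lambda>w. ennreal (indicator E w))" by (simp add: ennreal_indicator)
    then show ?thesis using integral_density[OF that, of "indicator E"] E by simp
  qed
  ultimately have "(\<integral>x. G x \<partial>distr ?ME borel X) = (\<integral>x. G x \<partial>(?ME \<bind> \<kappa>))" by simp
  moreover have "(\<integral>x. G x \<partial>distr ?ME borel X) = (\<integral>w. indicator E w * G (X w) \<partial>M)"
    unfolding integral_distr[OF XE G(1)] by (rule dens[OF measurable_compose[OF X G(1)]])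
  moreover have "(\<integral>x. G x \<partial>(?ME \<bind> \<kappa>)) = (\<integral>w. (\<integral>x. G x \<partial>\<kappa> w) \<partial>?ME)"
  proof (rule integral_bind[OF G(1) _ \<kappa>E fin])
    have "AE w in ?ME. w \<in> space ?ME" by (rule AE_space)
    then show "AE w in ?ME. emeasure (\<kappa> w) (space (\<kappa> w)) \<le> ennreal 1"
      using pr(1) by (auto elim!: eventually_mono simp: prob_space.emeasure_space_1)
  qed (use G(2) in auto)
  moreover have "(\<integral>w. (\<integral>x. G x \<partial>\<kappa> w) \<partial>?ME) = (\<integral>w. indicator E w * (\<integral>x. G x \<partial>\<kappa> w) \<partial>M)"
    by (rule dens[OF measurable_compose[OF \<kappa>s integral_measurable_subprob_algebra[OF G(1)]]])
  ultimately show ?thesis by simp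
qed

lemma (in prob_space) integral_indep_law:
  fixes Y :: "'a \<Rightarrow> 's::topological_space" and G :: "'s \<Rightarrow> real"
  assumes Y: "Y \<in> M \<rightarrow>\<^sub>M borel" and E: "E \<in> events" and \<mu>: "prob_space \<mu>" "sets \<mu> = sets borel"
    and law: "\<And>B. B \<in> sets borel \<Longrightarrow> prob (E \<inter> Y -` B) = prob E * measure \<mu> B"
    and G: "G \<in> borel_measurable borel" "\<And>x. \<bar>G x\<bar> \<le> b"
  shows "(\<integral>w. indicator E w * G (Y w) \<partial>M) = prob E * (\<integral>x. G x \<partial>\<mu>)"
proof -
  have "(\<lambda>_. \<mu>) \<in> M \<rightarrow>\<^sub>M prob_algebra borel"
    using \<mu> by (intro measurable_const) (simp add: space_prob_algebra)
  from integral_kernel_law[OF this Y E _ G] law E show ?thesis by simp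
qed

lemma ennreal_le_approx:
  assumes "\<And>r. 0 \<le> r \<Longrightarrow> r < a \<Longrightarrow> ennreal r \<le> S"
  shows "ennreal a \<le> S"
proof (rule ccontr)
  assume "\<not> ennreal a \<le> S"
  then obtain s where s: "0 \<le> s" "S = ennreal s" "s < a"
    by (cases S) (auto simp: not_le ennreal_less_iff top.not_eq_extremum)
  then obtain r where "s < r" "r < a" using dense by blast
  then have "ennreal r \<le> ennreal s" using assms[of r] s by auto
  then show False using \<open>s < r\<close> s(1) by (simp add: ennreal_le_iff)
qed

lemma seq_cost_le_Lip:
  assumes "range f \<subseteq> Lip_c c"
  shows "ennreal (seq_cost f m x y) \<le> c x y"
proof -
  have "ennreal \<bar>f n x - f n y\<bar> \<le> c x y" for n
    using assms unfolding Lip_c_def by blast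
  then show ?thesis by (induction m) (auto simp: max_def)
qed

lemma Lip_cD:
  assumes "u \<in> Lip_c c"
  shows "continuous_on UNIV u" "bounded (range u)" "u \<in> borel_measurable borel" "ennreal \<bar>u x - u y\<bar> \<le> c x y"
  using assms by (auto simp: Lip_c_def intro: borel_measurable_continuous_onI)

lemma min_costs_Lip:
  assumes f: "range f \<subseteq> Lip_c c"
  shows "min_costs f \<subseteq> Lip_c c"
proof
  fix G assume G: "G \<in> min_costs f"
  have fn: "f n \<in> Lip_c c" for n using f by blast
  obtain m where m: "\<And>x y. \<bar>G x - G y\<bar> \<le> seq_cost f m x y" using min_costs_Lipschitz[OF G] by metis
  have "ennreal \<bar>G x - G y\<bar> \<le> c x y" for x y
    by (rule order_trans[OF ennreal_leI[OF m] seq_cost_le_Lip[OF f]])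
  moreover have "continuous_on UNIV G" by (rule min_costs_continuous[OF G Lip_cD(1)[OF fn]])
  moreover have "bounded (range G)" by (rule min_costs_bounded[OF G Lip_cD(2)[OF fn]])
  ultimately show "G \<in> Lip_c c" by (simp add: Lip_c_def)
qed

lemma zero_Lip: "(\<lambda>_. 0) \<in> Lip_c c"
  by (auto simp: Lip_c_def bounded_iff)

text \<open>Within this locale the topological hypotheses are present only through their
  consequences: a Borel set \<open>T\<close> of full measure, countably many functions that recover
  \<open>c\<close> on T \<times> T, and a Borel code in [0,1] that can be inverted almost
  everywhere.\<close>

locale cost_coding = \<mu>: prob_space \<mu> for \<mu> :: "'s::topological_space measure" +
  fixes c :: "'s \<Rightarrow> 's \<Rightarrow> ennreal" and T :: "'s set" and f :: "nat \<Rightarrow> 's \<Rightarrow> real"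
    and \<phi> :: "'s \<Rightarrow> real" and d :: "real \<Rightarrow> 's"
  assumes sets_\<mu>: "sets \<mu> = sets borel" and T: "T \<in> sets borel" and AE_T: "AE x in \<mu>. x \<in> T"
    and f_Lip: "range f \<subseteq> Lip_c c"
    and c_eq: "\<And>x y. x \<in> T \<Longrightarrow> y \<in> T \<Longrightarrow> c x y = (SUP m. ennreal (seq_cost f m x y))"
    and \<phi>: "\<phi> \<in> borel_measurable borel" "\<And>x. \<phi> x \<in> {0..1}"
    and d: "d \<in> borel \<rightarrow>\<^sub>M borel" "AE x in \<mu>. d (\<phi> x) = x"
begin

lemma f_n: "f n \<in> Lip_c c" using f_Lip by blast

lemma f_meas: "f n \<in> borel_measurable borel" by (rule Lip_cD(3)[OF f_n])

lemma f_bdd: "bounded (range (f n))" by (rule Lip_cD(2)[OF f_n])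

text \<open>Measurability of \<open>c\<close> itself is not known, but along variables with values
  in \<open>T\<close> it agrees almost everywhere with a countable supremum. This supremum increases
  with m, so a bound uniform in m passes to \<open>c\<close> by monotone convergence.\<close>

lemma cost_of_coupling:
  assumes N: "prob_space N" and X [measurable]: "X \<in> N \<rightarrow>\<^sub>M borel" and Y [measurable]: "Y \<in> N \<rightarrow>\<^sub>M borel"
    and XT: "AE \<omega> in N. X \<omega> \<in> T" and YT: "AE \<omega> in N. Y \<omega> \<in> T"
  shows "(\<lambda>\<omega>. c (X \<omega>) (Y \<omega>)) \<in> borel_measurable (completion N)"
    and "AE \<omega> in N. c (X \<omega>) (Y \<omega>) = (SUP m. ennreal (seq_cost f m (X \<omega>) (Y \<omega>)))"
    and "(\<And>m. (\<integral>\<omega>. seq_cost f m (X \<omega>) (Y \<omega>) \<partial>N) \<le> t) \<Longrightarrow> (\<integral>\<^sup>+\<omega>. c (X \<omega>) (Y \<omega>) \<partial>N) \<le> ennreal t"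
proof -
  interpret N: prob_space N by fact
  note [measurable] = f_meas
  show ae: "AE \<omega> in N. c (X \<omega>) (Y \<omega>) = (SUP m. ennreal (seq_cost f m (X \<omega>) (Y \<omega>)))"
    using XT YT by eventually_elim (rule c_eq)
  show "(\<lambda>\<omega>. c (X \<omega>) (Y \<omega>)) \<in> borel_measurable (completion N)"
    by (rule borel_measurable_completion_AE[of "\<lambda>\<omega>. SUP m. ennreal (seq_cost f m (X \<omega>) (Y \<omega>))"])
      (use ae in \<open>auto elim!: eventually_mono\<close>)
  assume t: "\<And>m. (\<integral>\<omega>. seq_cost f m (X \<omega>) (Y \<omega>) \<partial>N) \<le> t"
  have "(\<integral>\<^sup>+\<omega>. c (X \<omega>) (Y \<omega>) \<partial>N) = (\<integral>\<^sup>+\<omega>. (SUP m. ennreal (seq_cost f m (X \<omega>) (Y \<omega>))) \<partial>N)"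
    by (rule nn_integral_cong_AE[OF ae])
  also have "\<dots> = (SUP m. \<integral>\<^sup>+\<omega>. ennreal (seq_cost f m (X \<omega>) (Y \<omega>)) \<partial>N)"
    by (rule nn_integral_monotone_convergence_SUP)
      (auto simp: incseq_def le_fun_def intro!: ennreal_leI seq_cost_mono)
  also have "\<dots> \<le> ennreal t"
  proof (rule SUP_least)
    fix m
    obtain B where B: "seq_cost f m x y \<le> B" for x y
      using seq_cost_bounded[of f m, OF f_bdd] by metis
    have "integrable N (\<lambda>\<omega>. seq_cost f m (X \<omega>) (Y \<omega>))"
      by (rule N.integrable_const_bound[of _ B]) (auto simp: B seq_cost_nonneg)
    then have "(\<integral>\<^sup>+\<omega>. ennreal (seq_cost f m (X \<omega>) (Y \<omega>)) \<partial>N) = ennreal (\<integral>\<omega>. seq_cost f m (X \<omega>) (Y \<omega>) \<partial>N)"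
      by (intro nn_integral_eq_integral) (auto simp: seq_cost_nonneg)
    also have "\<dots> \<le> ennreal t" by (rule ennreal_leI[OF t])
    finally show "(\<integral>\<^sup>+\<omega>. ennreal (seq_cost f m (X \<omega>) (Y \<omega>)) \<partial>N) \<le> ennreal t" .
  qed
  finally show "(\<integral>\<^sup>+\<omega>. c (X \<omega>) (Y \<omega>) \<partial>N) \<le> ennreal t" .
qed


text \<open>The supremum runs over a countable set, so it is measurable along a kernel and can be
  taken inside almost-everywhere statements.\<close>

definition kr_coded :: "'s measure \<Rightarrow> ennreal" where
  "kr_coded \<kappa> = (SUP G\<in>min_costs f. ennreal \<bar>(\<integral>x. G x \<partial>\<kappa>) - \<mu>.expectation G\<bar>)"

lemma kr_coded_le: "kr_coded \<kappa> \<le> kr_dist c \<kappa> \<mu>"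
  unfolding kr_coded_def kr_dist_def by (rule SUP_subset_mono[OF min_costs_Lip[OF f_Lip]]) simp

text \<open>
  The coupling theorem for the trivial sub-\<open>\<sigma>\<close>-algebra on \<open>\<kappa> \<Otimes> U(0,1)\<close> produces a coupling whose
  cost only involves the countable family of potentials; it bounds the whole supremum.
\<close>
lemma kr_dist_eq_kr_coded:
  assumes \<kappa>: "prob_space \<kappa>" "sets \<kappa> = sets borel" and \<kappa>T: "AE x in \<kappa>. x \<in> T"
  shows "kr_dist c \<kappa> \<mu> = kr_coded \<kappa>"
proof (rule antisym[OF _ kr_coded_le])
  show "kr_dist c \<kappa> \<mu> \<le> kr_coded \<kappa>"
  proof (cases "kr_coded \<kappa>")
    case top
    then show ?thesis by simp
  next
    case (real t)
    \<comment> \<open>The second factor supplies the uniform variable required by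
      \<open>coupling\<close>, independent of the first coordinate.\<close>
    let ?U = "uniform_measure lborel {0..1::real}"
    let ?N = "\<kappa> \<Otimes>\<^sub>M ?U"
    interpret \<kappa>: prob_space \<kappa> by fact
    interpret U: prob_space ?U by (rule prob_space_uniform_measure) auto
    interpret pp: pair_prob_space \<kappa> ?U ..
    have pN: "prob_space ?N" by (rule pp.P.prob_space_axioms)
    have sp\<kappa>: "space \<kappa> = UNIV" using sets_eq_imp_space_eq[OF \<kappa>(2)] by simp
    have spN: "space ?N = UNIV" by (simp add: space_pair_measure sp\<kappa>)
    have fst_m: "fst \<in> ?N \<rightarrow>\<^sub>M borel" using measurable_fst[of \<kappa> ?U] \<kappa>(2) by (simp cong: measurable_cong_sets)
    have snd_m: "snd \<in> ?N \<rightarrow>\<^sub>M borel" using measurable_snd[of \<kappa> ?U] by (simp cong: measurable_cong_sets)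
    have dfst: "distr ?N borel fst = \<kappa>"
      using U.distr_pair_fst[of \<kappa>] \<kappa>(2) by (simp cong: distr_cong)
    have rect: "emeasure ?N (B \<times> A) = emeasure \<kappa> B * emeasure ?U A" if "A \<in> sets borel" "B \<in> sets borel" for A B
      using that \<kappa>(2) by (intro U.emeasure_pair_measure_Times) auto
    have dsnd: "distr ?N lborel snd = ?U"
    proof (rule measure_eqI)
      fix A assume "A \<in> sets (distr ?N lborel snd)"
      then have A: "A \<in> sets borel" by simp
      have "snd -` A \<inter> space ?N = UNIV \<times> A" by (auto simp: spN)
      then show "emeasure (distr ?N lborel snd) A = emeasure ?U A"
        using A snd_m rect[OF A, of UNIV] \<kappa>.emeasure_space_1 sp\<kappa>
        by (simp add: emeasure_distr del: emeasure_uniform_measure)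
    qed simp
    let ?G = "sigma_alg_of ?N fst" let ?M = "sigma (space ?N) {}"
    have sM: "sets ?M = {{}, space ?N}" by (simp add: sigma_sets_empty_eq)
    have subG: "subalgebra ?N ?G" by (rule subalgebra_sigma_alg_of[OF fst_m])
    have subM: "subalgebra ?N ?M"
    proof -
      have "{{}, space ?N} \<subseteq> sets ?N"
        by (intro insert_subsetI sets.empty_sets sets.top empty_subsetI)
      moreover have "space ?M = space ?N" by (simp add: space_measure_of_conv)
      ultimately show ?thesis unfolding subalgebra_def sM by (intro conjI)
    qed
    have ind: "prob_space.indep_set ?N (sets (sigma_alg_of ?N snd)) (sets ?G)"
    proof (rule prob_space.indep_setI[OF pN])
      show "sets (sigma_alg_of ?N snd) \<subseteq> pp.P.events" "sets ?G \<subseteq> pp.P.events"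
        using subalgebra_sigma_alg_of[OF snd_m] subG by (auto simp: subalgebra_def)
      fix a b assume "a \<in> sets (sigma_alg_of ?N snd)" "b \<in> sets ?G"
      then obtain A B where "A \<in> sets borel" "a = snd -` A" "B \<in> sets borel" "b = fst -` B"
        unfolding sigma_alg_of_def by (auto simp: sets_vimage_algebra2 spN)
      then have AB: "A \<in> sets borel" "a = UNIV \<times> A" "B \<in> sets borel" "b = B \<times> UNIV" by auto
      then have "a \<inter> b = B \<times> A" by auto
      with rect[of A B] rect[of A UNIV] rect[of UNIV B] AB \<kappa>.emeasure_space_1 U.emeasure_space_1 sp\<kappa>
      show "pp.P.prob (a \<inter> b) = pp.P.prob a * pp.P.prob b"
        by (simp add: measure_def enn2real_mult mult.commute del: emeasure_uniform_measure)
    qed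
    \<comment> \<open>Over the trivial \<sigma>-algebra \<open>budget\<close> only concerns the
      whole space, where it holds because \<open>t\<close> is the supremum over
      \<open>min_costs f\<close>.\<close>
    interpret ts: transport_setting ?N \<mu> ?M fst f "\<lambda>_. t"
    proof unfold_locales
      fix G E assume G: "G \<in> min_costs f" and E: "E \<in> sets ?M"
      have Gm: "G \<in> borel_measurable borel" by (rule min_costs_measurable[OF G f_meas])
      have "(\<integral>\<omega>. G (fst \<omega>) \<partial>?N) = (\<integral>x. G x \<partial>\<kappa>)"
        using integral_distr[OF fst_m Gm] by (simp add: dfst)
      moreover have "(\<integral>x. G x \<partial>\<kappa>) - \<mu>.expectation G \<le> t"
      proof -
        have "ennreal \<bar>(\<integral>x. G x \<partial>\<kappa>) - \<mu>.expectation G\<bar> \<le> ennreal t"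
          unfolding real(2)[symmetric] kr_coded_def using G by (rule SUP_upper)
        then show ?thesis using real(1) by (simp add: ennreal_le_iff)
      qed
      ultimately show "(\<integral>\<omega>. indicator E \<omega> * G (fst \<omega>) \<partial>?N) - pp.P.prob E * \<mu>.expectation G
          \<le> (\<integral>\<omega>. indicator E \<omega> * t \<partial>?N)"
        using E pp.P.prob_space unfolding sM by (auto simp: spN)
    qed (use fst_m sets_\<mu> f_meas f_bdd subM in auto)
    obtain Y where Y: "Y \<in> sigma_join (sigma_alg_of ?N snd) ?G \<rightarrow>\<^sub>M borel"
      and law: "\<And>A C. A \<in> sets ?M \<Longrightarrow> C \<in> sets borel \<Longrightarrow> pp.P.prob (A \<inter> Y -` C) = pp.P.prob A * \<mu>.prob C"
      and cost: "\<And>m. (\<integral>\<omega>. seq_cost f m (fst \<omega>) (Y \<omega>) \<partial>?N) \<le> (\<integral>\<omega>. t \<partial>?N)"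
    proof (rule ts.coupling[OF subG _ _ snd_m dsnd ind \<phi> d])
      show "sets ?M \<subseteq> sets ?G" unfolding sM using sets.top[of ?G] by (auto simp: sigma_alg_of_def)
      show "fst \<in> ?G \<rightarrow>\<^sub>M borel" by (rule measurable_sigma_alg_of)
    qed (rule that)
    have Ym: "Y \<in> ?N \<rightarrow>\<^sub>M borel"
      by (rule measurable_from_subalg[OF prob_space.subalgebra_sigma_join[OF pN subalgebra_sigma_alg_of[OF snd_m] subG] Y])
    have dY: "distr ?N borel Y = \<mu>"
    proof (rule measure_eqI)
      fix C assume "C \<in> sets (distr ?N borel Y)"
      then have C: "C \<in> sets borel" by simp
      have "pp.P.prob (Y -` C) = \<mu>.prob C"
        using law[OF _ C, of "space ?N"] pp.P.prob_space unfolding sM by (simp add: spN)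
      then show "emeasure (distr ?N borel Y) C = emeasure \<mu> C"
        using Ym C by (simp add: emeasure_distr spN pp.P.emeasure_eq_measure \<mu>.emeasure_eq_measure)
    qed (simp add: sets_\<mu>)
    have XT: "AE \<omega> in ?N. fst \<omega> \<in> T" 
      using AE_distr_iff[OF fst_m, of "\<lambda>x. x \<in> T"] T \<kappa>T unfolding dfst by simp
    have YT: "AE \<omega> in ?N. Y \<omega> \<in> T" 
      using AE_distr_iff[OF Ym, of "\<lambda>x. x \<in> T"] T AE_T unfolding dY by simp
    have le_t: "(\<integral>\<^sup>+\<omega>. c (fst \<omega>) (Y \<omega>) \<partial>?N) \<le> ennreal t"
      by (rule cost_of_coupling(3)[OF pN fst_m Ym XT YT]) (use cost pp.P.prob_space in simp)
    show ?thesis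
      unfolding kr_dist_def real(2)
    proof (rule SUP_least)
      fix u assume u: "u \<in> Lip_c c"
      obtain B where B: "\<bar>u x\<bar> \<le> B" for x using Lip_cD(2)[OF u] by (auto simp: bounded_iff)
      note [measurable] = Lip_cD(3)[OF u] fst_m Ym
      have int: "integrable ?N (\<lambda>\<omega>. u (fst \<omega>))" "integrable ?N (\<lambda>\<omega>. u (Y \<omega>))"
        by (rule pp.P.integrable_const_bound[of _ B]; simp add: B)+
      \<comment> \<open>The easy direction of duality, for an arbitrary \<open>u\<close> in
        \<open>Lip_c c\<close>: the coupling was built from the countable family alone, yet its cost
        bounds every such difference.\<close>
      have "(\<integral>x. u x \<partial>\<kappa>) - (\<integral>x. u x \<partial>\<mu>) = (\<integral>\<omega>. u (fst \<omega>) - u (Y \<omega>) \<partial>?N)"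
        using integral_distr[OF fst_m Lip_cD(3)[OF u]] integral_distr[OF Ym Lip_cD(3)[OF u]] int
        by (simp add: dfst dY)
      then have "ennreal \<bar>(\<integral>x. u x \<partial>\<kappa>) - (\<integral>x. u x \<partial>\<mu>)\<bar> = ennreal (norm (\<integral>\<omega>. u (fst \<omega>) - u (Y \<omega>) \<partial>?N))" by simp
      also have "\<dots> \<le> (\<integral>\<^sup>+\<omega>. norm (u (fst \<omega>) - u (Y \<omega>)) \<partial>?N)"
        by (rule integral_norm_bound_ennreal) (use int in simp)
      also have "\<dots> \<le> (\<integral>\<^sup>+\<omega>. c (fst \<omega>) (Y \<omega>) \<partial>?N)"
        by (rule nn_integral_mono) (use Lip_cD(4)[OF u] in simp)
      finally show "ennreal \<bar>(\<integral>x. u x \<partial>\<kappa>) - (\<integral>x. u x \<partial>\<mu>)\<bar> \<le> ennreal t" using le_t by (rule order_trans)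
    qed
  qed
qed

lemma kr_coded_measurable:
  assumes \<kappa>: "\<kappa> \<in> M \<rightarrow>\<^sub>M prob_algebra borel"
  shows "(\<lambda>\<omega>. kr_coded (\<kappa> \<omega>)) \<in> borel_measurable M"
proof -
  have "(\<lambda>\<omega>. \<integral>x. G x \<partial>\<kappa> \<omega>) \<in> borel_measurable M" if "G \<in> min_costs f" for G
    by (rule measurable_compose[OF measurable_prob_algebraD[OF \<kappa>]
          integral_measurable_subprob_algebra[OF min_costs_measurable[OF that f_meas]]])
  then show ?thesis unfolding kr_coded_def
    by (intro borel_measurable_SUP countable_min_costs) auto
qed

text \<open>The easy half of duality conditionally on \<open>M\<close>: the gap between the means of
  a potential is the conditional expectation of G(X) - G(Y), whose absolute value is at most the
  conditional expectation of the cost.\<close>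

lemma kr_coded_le_cost:
  assumes P: "prob_space P" and sub: "subalgebra P M" and \<kappa>: "\<kappa> \<in> M \<rightarrow>\<^sub>M prob_algebra borel"
    and X [measurable]: "X \<in> P \<rightarrow>\<^sub>M borel" and Y [measurable]: "Y \<in> P \<rightarrow>\<^sub>M borel"
    and XT: "AE \<omega> in P. X \<omega> \<in> T" and YT: "AE \<omega> in P. Y \<omega> \<in> T"
    and lawX: "\<And>E B. E \<in> sets M \<Longrightarrow> B \<in> sets borel \<Longrightarrow>
      measure P (E \<inter> X -` B) = (\<integral>\<omega>. indicator E \<omega> * measure (\<kappa> \<omega>) B \<partial>P)"
    and lawY: "\<And>E B. E \<in> sets M \<Longrightarrow> B \<in> sets borel \<Longrightarrow> measure P (E \<inter> Y -` B) = measure P E * \<mu>.prob B"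
  shows "(\<integral>\<^sup>+\<omega>. kr_coded (\<kappa> \<omega>) \<partial>P) \<le> (\<integral>\<^sup>+\<omega>. c (X \<omega>) (Y \<omega>) \<partial>P)"
proof -
  interpret P: prob_space P by fact
  interpret S: finite_measure_subalgebra P M by unfold_locales (rule sub)
  note [measurable] = f_meas
  have \<kappa>P: "\<kappa> \<in> P \<rightarrow>\<^sub>M prob_algebra borel" by (rule measurable_from_subalg[OF sub \<kappa>])
  define cc where "cc \<omega> = (SUP m. ennreal (seq_cost f m (X \<omega>) (Y \<omega>)))" for \<omega>
  have cc [measurable]: "cc \<in> borel_measurable P" unfolding cc_def by measurable
  have c_cc: "AE \<omega> in P. c (X \<omega>) (Y \<omega>) = cc \<omega>"
    unfolding cc_def by (rule cost_of_coupling(2)[OF P X Y XT YT])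
  have int_c: "(\<integral>\<^sup>+\<omega>. c (X \<omega>) (Y \<omega>) \<partial>P) = (\<integral>\<^sup>+\<omega>. cc \<omega> \<partial>P)"
    by (rule nn_integral_cong_AE[OF c_cc])
  show ?thesis
  proof (cases "(\<integral>\<^sup>+\<omega>. cc \<omega> \<partial>P) = \<infinity>")
    case True
    then show ?thesis by (simp add: int_c)
  next
    case False
    have fin: "AE \<omega> in P. cc \<omega> \<noteq> \<infinity>" by (rule nn_integral_PInf_AE[OF cc False])
    \<comment> \<open>Infinite total cost having been split off, the cost has an integrable real
      version, whose conditional expectation is the common bound for all potentials.\<close>
    define R where "R \<omega> = enn2real (cc \<omega>)" for \<omega>
    have RR: "AE \<omega> in P. ennreal (R \<omega>) = cc \<omega>"
      using fin by eventually_elim (simp add: R_def less_top)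
    have [measurable]: "R \<in> borel_measurable P" unfolding R_def by measurable
    have nnR: "(\<integral>\<^sup>+\<omega>. ennreal (R \<omega>) \<partial>P) = (\<integral>\<^sup>+\<omega>. cc \<omega> \<partial>P)"
      by (rule nn_integral_cong_AE[OF RR])
    have R: "integrable P R"
      by (rule integrableI_nonneg) (use nnR False in \<open>auto simp: R_def less_top\<close>)
    let ?h = "real_cond_exp P M R"
    have le: "AE \<omega> in P. ennreal \<bar>(\<integral>x. G x \<partial>\<kappa> \<omega>) - \<mu>.expectation G\<bar> \<le> ennreal (?h \<omega>)" if G: "G \<in> min_costs f" for G
    proof -
      note Gm [measurable] = min_costs_measurable[OF G f_meas]
      have G_Lip: "G \<in> Lip_c c" using min_costs_Lip[OF f_Lip] G by blast
      obtain B where B: "\<bar>G x\<bar> \<le> B" for x using Lip_cD(2)[OF G_Lip] by (auto simp: bounded_iff)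
      have int: "integrable P (\<lambda>\<omega>. G (X \<omega>))" "integrable P (\<lambda>\<omega>. G (Y \<omega>))"
        by (rule P.integrable_const_bound[of _ B]; simp add: B)+
      let ?g = "\<lambda>\<omega>. \<integral>x. G x \<partial>\<kappa> \<omega>"
      define D where "D \<omega> = ?g \<omega> - \<mu>.expectation G" for \<omega>
      have mk: "?g \<in> borel_measurable M"
        by (rule measurable_compose[OF measurable_prob_algebraD[OF \<kappa>] integral_measurable_subprob_algebra[OF Gm]])
      note mkP [measurable] = measurable_from_subalg[OF sub mk]
      have intk: "integrable P ?g"
        by (rule P.integrable_kernel_integral[OF \<kappa>P Gm B])
      have D: "integrable P D" "D \<in> borel_measurable M"
        unfolding D_def using intk mk by auto
      have D_eq: "AE \<omega> in P. real_cond_exp P M (\<lambda>\<omega>. G (X \<omega>) - G (Y \<omega>)) \<omega> = D \<omega>"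
      proof (rule S.real_cond_exp_charact)
        fix E assume E: "E \<in> sets M"
        then have EP: "E \<in> P.events" using sub by (auto simp: subalgebra_def)
        have iE: "integrable P (\<lambda>\<omega>. indicator E \<omega> * F \<omega>)" if "integrable P F" for F :: "_ \<Rightarrow> real"
          using integrable_mult_indicator[OF EP that] by simp
        have "(\<integral>\<omega>\<in>E. (G (X \<omega>) - G (Y \<omega>)) \<partial>P) = (\<integral>\<omega>. indicator E \<omega> * G (X \<omega>) \<partial>P) - (\<integral>\<omega>. indicator E \<omega> * G (Y \<omega>) \<partial>P)"
          unfolding set_lebesgue_integral_def using iE[OF int(1)] iE[OF int(2)]
          by (simp add: right_diff_distrib)
        also have "(\<integral>\<omega>. indicator E \<omega> * G (X \<omega>) \<partial>P) = (\<integral>\<omega>. indicator E \<omega> * ?g \<omega> \<partial>P)"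
          by (rule P.integral_kernel_law[OF \<kappa>P X EP lawX[OF E] Gm B])
        also have "(\<integral>\<omega>. indicator E \<omega> * G (Y \<omega>) \<partial>P) = P.prob E * \<mu>.expectation G"
          by (rule P.integral_indep_law[OF Y EP \<mu>.prob_space_axioms sets_\<mu> lawY[OF E] Gm B])
        also have "(\<integral>\<omega>. indicator E \<omega> * ?g \<omega> \<partial>P) - P.prob E * \<mu>.expectation G = (\<integral>\<omega>\<in>E. D \<omega> \<partial>P)"
        proof -
          have "(\<integral>\<omega>. indicator E \<omega> * \<mu>.expectation G \<partial>P) = P.prob E * \<mu>.expectation G"
            using EP by simp
          then show ?thesis
            unfolding set_lebesgue_integral_def D_def using iE[OF intk] iE[of "\<lambda>_. \<integral>x. G x \<partial>\<mu>"]
            by (simp add: right_diff_distrib Int_absorb2[OF sets.sets_into_space[OF EP]])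
        qed
        finally show "(\<integral>\<omega>\<in>E. (G (X \<omega>) - G (Y \<omega>)) \<partial>P) = (\<integral>\<omega>\<in>E. D \<omega> \<partial>P)" .
      qed (use int D in auto)
      have abs_le: "AE \<omega> in P. \<bar>G (X \<omega>) - G (Y \<omega>)\<bar> \<le> R \<omega>"
        using c_cc RR
      proof eventually_elim
        fix \<omega> assume "c (X \<omega>) (Y \<omega>) = cc \<omega>" "ennreal (R \<omega>) = cc \<omega>"
        then have "ennreal \<bar>G (X \<omega>) - G (Y \<omega>)\<bar> \<le> ennreal (R \<omega>)" using Lip_cD(4)[OF G_Lip, of "X \<omega>" "Y \<omega>"] by simp
        then show "\<bar>G (X \<omega>) - G (Y \<omega>)\<bar> \<le> R \<omega>" by (simp add: R_def ennreal_le_iff)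
      qed
      have "AE \<omega> in P. real_cond_exp P M (\<lambda>\<omega>. G (X \<omega>) - G (Y \<omega>)) \<omega> \<le> ?h \<omega>"
        by (rule S.real_cond_exp_mono) (use abs_le int R in \<open>auto elim!: eventually_mono\<close>)
      moreover have "AE \<omega> in P. real_cond_exp P M (\<lambda>\<omega>. (-1) * (G (X \<omega>) - G (Y \<omega>))) \<omega> \<le> ?h \<omega>"
        by (rule S.real_cond_exp_mono) (use abs_le int R in \<open>auto elim!: eventually_mono\<close>)
      moreover have "AE \<omega> in P. real_cond_exp P M (\<lambda>\<omega>. (-1) * (G (X \<omega>) - G (Y \<omega>))) \<omega>
          = (-1) * real_cond_exp P M (\<lambda>\<omega>. G (X \<omega>) - G (Y \<omega>)) \<omega>"
        by (rule S.real_cond_exp_cmult) (use int in auto)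
      ultimately show ?thesis using D_eq
        by eventually_elim (auto simp: D_def intro!: ennreal_leI abs_leI)
    qed
    \<comment> \<open>Here countability is essential: the exceptional sets of the single potentials
      are united before the supremum is formed.\<close>
    have "AE \<omega> in P. \<forall>G\<in>min_costs f. ennreal \<bar>(\<integral>x. G x \<partial>\<kappa> \<omega>) - \<mu>.expectation G\<bar> \<le> ennreal (?h \<omega>)"
      by (subst AE_ball_countable[OF countable_min_costs]) (use le in blast)
    then have "AE \<omega> in P. kr_coded (\<kappa> \<omega>) \<le> ennreal (?h \<omega>)"
      by eventually_elim (auto simp: kr_coded_def intro!: SUP_least)
    then have "(\<integral>\<^sup>+\<omega>. kr_coded (\<kappa> \<omega>) \<partial>P) \<le> (\<integral>\<^sup>+\<omega>. ennreal (?h \<omega>) \<partial>P)"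
      by (rule nn_integral_mono_AE)
    also have "\<dots> = ennreal (\<integral>\<omega>. ?h \<omega> \<partial>P)"
      by (rule nn_integral_eq_integral[OF S.real_cond_exp_int(1)[OF R]])
        (rule S.real_cond_exp_pos, auto simp: R_def)
    also have "\<dots> = ennreal (\<integral>\<omega>. R \<omega> \<partial>P)" by (simp add: S.real_cond_exp_int(2)[OF R])
    also have "\<dots> = (\<integral>\<^sup>+\<omega>. ennreal (R \<omega>) \<partial>P)"
      by (rule nn_integral_eq_integral[symmetric, OF R]) (simp add: R_def)
    finally show ?thesis unfolding nnR int_c .
  qed
qed

end

section \<open>Reduction of the topological hypotheses to countable and coded data\<close>

lemma radon_cost_coding:
  fixes c :: "'s::topological_space \<Rightarrow> 's \<Rightarrow> ennreal" and \<mu> :: "'s measure"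
  assumes cr: "completely_regular_space (euclidean :: 's topology)" and radon: "radon_space TYPE('s)"
    and met: "\<And>K :: 's set. compact K \<Longrightarrow> metrizable_space (top_of_set K)"
    and c: "\<And>x y. c x y = (SUP u\<in>Lip_c c. ennreal \<bar>u x - u y\<bar>)"
    and \<mu>: "prob_space \<mu>" "sets \<mu> = sets borel"
  obtains T f \<phi> d where "cost_coding \<mu> c T f \<phi> d"
proof -
  interpret \<mu>: prob_space \<mu> by fact
  have sp: "space \<mu> = UNIV" using sets_eq_imp_space_eq[OF \<mu>(2)] by simp
  have compact_meas: "K \<in> sets borel" if "compact K" for K :: "'s set"
    using completely_regular_compact_closed[OF cr met that] by (rule borel_closed)
  \<comment> \<open>Inner regularity of the whole space, whose mass 1 strictly exceeds the
    threshold.\<close>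
  have "\<exists>K. compact K \<and> 1 - 1 / real (Suc n) < \<mu>.prob K" for n
  proof -
    have "emeasure \<mu> UNIV = (SUP K \<in> {K. K \<subseteq> UNIV \<and> compact K}. emeasure \<mu> K)"
      by (rule radon[unfolded radon_space_def, rule_format]) (simp_all add: \<mu>(2) \<mu>.finite_measure_axioms)
    moreover have "ennreal (1 - 1 / real (Suc n)) < emeasure \<mu> UNIV"
      using \<mu>.emeasure_space_1 by (simp add: sp ennreal_less_one_iff)
    ultimately obtain K where "compact K" "ennreal (1 - 1 / real (Suc n)) < emeasure \<mu> K"
      by (auto simp: less_SUP_iff)
    then show ?thesis by (auto simp: \<mu>.emeasure_eq_measure ennreal_less_iff)
  qed
  then obtain K0 where K0: "compact (K0 n)" "1 - 1 / real (Suc n) < \<mu>.prob (K0 n)" for n by metis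
  define K where "K n = (\<Union>i\<le>n. K0 i)" for n :: nat
  have K: "compact (K n)" "incseq K" for n
  proof -
    show "compact (K n)" unfolding K_def using K0(1) by (intro compact_UN) auto
    show "incseq K" unfolding K_def incseq_def by (intro allI impI UN_mono) auto
  qed
  define T where "T = (\<Union>n. K n)"
  have T: "T \<in> sets borel" unfolding T_def by (intro sets.countable_UN) (auto intro: compact_meas K)
  have "1 \<le> \<mu>.prob T"
  proof (rule le_of_approx)
    fix n
    have "\<mu>.prob (K0 n) \<le> \<mu>.prob T"
      using T \<mu>(2) by (intro \<mu>.finite_measure_mono) (auto simp: T_def K_def)
    with K0(2)[of n] show "1 \<le> \<mu>.prob T + 1 / real (Suc n)" by linarith
  qed
  then have "\<mu>.prob T = 1" using \<mu>.prob_le_1[of T] by linarith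
  then have AE_T: "AE x in \<mu>. x \<in> T" using T \<mu>(2) by (simp add: \<mu>.prob_eq_1)
  obtain f :: "nat \<Rightarrow> 's \<Rightarrow> real" where f: "range f \<subseteq> Lip_c c"
    "\<And>x y u r. x \<in> (\<Union>n. K n) \<Longrightarrow> y \<in> (\<Union>n. K n) \<Longrightarrow> u \<in> Lip_c c \<Longrightarrow> r < \<bar>u x - u y\<bar> \<Longrightarrow> \<exists>n. r < \<bar>f n x - f n y\<bar>"
  proof (rule countable_subfamily[of K "Lip_c c"])
    show "metrizable_space (top_of_set K)" if "compact K" for K :: "'s set" by (rule met[OF that])
    show "Lip_c c \<noteq> {}" using zero_Lip by blast
    show "continuous_on UNIV u" if "u \<in> Lip_c c" for u by (rule Lip_cD(1)[OF that])
  qed (rule K, rule K, rule that)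
  \<comment> \<open>A second countable family, for building the code. It cannot be taken from
    \<open>f\<close>, as \<open>c\<close> may vanish at pairs of distinct points.\<close>
  let ?\<H> = "{u :: 's \<Rightarrow> real. continuous_on UNIV u \<and> (\<forall>x. u x \<in> {0..1})}"
  obtain h :: "nat \<Rightarrow> 's \<Rightarrow> real" where h: "range h \<subseteq> ?\<H>"
    "\<And>x y u r. x \<in> (\<Union>n. K n) \<Longrightarrow> y \<in> (\<Union>n. K n) \<Longrightarrow> u \<in> ?\<H> \<Longrightarrow> r < \<bar>u x - u y\<bar> \<Longrightarrow> \<exists>n. r < \<bar>h n x - h n y\<bar>"
  proof (rule countable_subfamily[of K ?\<H>])
    show "metrizable_space (top_of_set K)" if "compact K" for K :: "'s set" by (rule met[OF that])
    show "continuous_on UNIV u" if "u \<in> ?\<H>" for u using that by blast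
    have "(\<lambda>_. 0) \<in> ?\<H>" by simp
    then show "?\<H> \<noteq> {}" by blast
  qed (rule K, rule K, rule that)
  have hn: "continuous_on UNIV (h n)" "h n x \<in> {0..1}" for n x using h(1) by auto
  have sep: "x = y" if "x \<in> (\<Union>n. K n)" "y \<in> (\<Union>n. K n)" "\<And>i. h i x = h i y" for x y
  proof (rule ccontr)
    assume "x \<noteq> y"
    obtain u :: "'s \<Rightarrow> real" where u: "continuous_on UNIV u" "\<And>z. u z \<in> {0..1}" "u x = 0" "u y = 1"
    proof (rule separating_function[OF cr _ \<open>x \<noteq> y\<close>])
      show "metrizable_space (top_of_set K)" if "compact K" for K :: "'s set" by (rule met[OF that])
    qed (rule that)
    then have "\<exists>n. 0 < \<bar>h n x - h n y\<bar>" by (intro h(2)[OF that(1,2), of u]) auto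
    then show False using that(3) by simp
  qed
  obtain \<phi> :: "'s \<Rightarrow> real" and d where \<phi>d: "\<phi> \<in> borel_measurable borel" "\<And>x. \<phi> x \<in> {0..1}"
    "d \<in> borel \<rightarrow>\<^sub>M borel" "\<And>x. x \<in> (\<Union>n. K n) \<Longrightarrow> d (\<phi> x) = x"
  proof (rule borel_coding[of K h])
    show "x = y" if "x \<in> (\<Union>n. K n)" "y \<in> (\<Union>n. K n)" "\<And>i. h i x = h i y" for x y
      by (rule sep[OF that])
  qed ((rule K hn)+, rule that)
  have "cost_coding \<mu> c T f \<phi> d"
  proof unfold_locales
    fix x y assume xy: "x \<in> T" "y \<in> T"
    show "c x y = (SUP m. ennreal (seq_cost f m x y))"
    proof (rule antisym)
      show "(SUP m. ennreal (seq_cost f m x y)) \<le> c x y"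
        by (intro SUP_least seq_cost_le_Lip f(1))
      show "c x y \<le> (SUP m. ennreal (seq_cost f m x y))"
        unfolding c[of x y]
      proof (rule SUP_least, rule ennreal_le_approx)
        fix u r assume "u \<in> Lip_c c" "0 \<le> r" "r < \<bar>u x - u y\<bar>"
        then obtain n where "r < \<bar>f n x - f n y\<bar>" using f(2)[OF xy[unfolded T_def]] by blast
        then have "r \<le> seq_cost f n x y" using abs_le_seq_cost[of n n f x y] by simp
        then show "ennreal r \<le> (SUP m. ennreal (seq_cost f m x y))"
          by (intro SUP_upper2[of n] ennreal_leI) auto
      qed
    qed
  next
    show "AE x in \<mu>. d (\<phi> x) = x" using AE_T by eventually_elim (rule \<phi>d(4), simp add: T_def)
  qed (fact \<mu>(2) T AE_T f(1) \<phi>d)+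
  then show thesis by (rule that)
qed

text \<open>With zero cost all potentials are constant and the budget 0 suffices.
  \<open>coupling\<close> then reduces to the existence of an independent copy, which is all that is
  needed when \<tau> is infinite.\<close>

lemma (in cost_coding) transport_setting_zero_cost:
  fixes P M :: "'w measure" and X :: "'w \<Rightarrow> 's"
  assumes P: "prob_space P" and sub: "subalgebra P M" and X: "X \<in> P \<rightarrow>\<^sub>M borel"
  shows "transport_setting P \<mu> M X (\<lambda>_ _. 0) (\<lambda>_. 0)"
proof -
  interpret P: prob_space P by fact
  have zero: "seq_cost (\<lambda>_ _. 0) m x y = 0" for m and x y :: 's by (induction m) auto
  show ?thesis
  proof unfold_locales
    fix G :: "'s \<Rightarrow> real" and E assume G: "G \<in> min_costs (\<lambda>_ _. 0)" and E: "E \<in> sets M"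
    have "G x = G y" for x y using min_costs_Lipschitz[OF G] zero by (metis abs_le_zero_iff eq_iff_diff_eq_0)
    then have "G = (\<lambda>_. G undefined)" by blast
    then obtain g where "G = (\<lambda>_. g)" by blast
    then show "(\<integral>\<omega>. indicator E \<omega> * G (X \<omega>) \<partial>P) - P.prob E * (\<integral>y. G y \<partial>\<mu>)
        \<le> (\<integral>\<omega>. indicator E \<omega> * 0 \<partial>P)"
      using E sub \<mu>.prob_space by (simp add: subalgebra_def subset_iff Int_absorb2 sets.sets_into_space)
  qed (use sub X sets_\<mu> in \<open>auto simp: bounded_iff\<close>)
qed

theorem corollary3p2:
  fixes P M :: "'w measure"
    and c :: "'s::topological_space \<Rightarrow> 's \<Rightarrow> ennreal"
    and X :: "'w \<Rightarrow> 's"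
    and \<kappa> :: "'w \<Rightarrow> 's measure"
    and U :: "'w \<Rightarrow> real"
  assumes "prob_space P"
    and "subalgebra P M"
    and "completely_regular_space (euclidean :: 's topology)"
    and "radon_space TYPE('s)"
    and "\<forall>K :: 's set. compact K \<longrightarrow> metrizable_space (top_of_set K)"
    and "\<forall>x y. c x y = (SUP u \<in> Lip_c c. ennreal \<bar>u x - u y\<bar>)"
    and "X \<in> P \<rightarrow>\<^sub>M borel"
    and "\<exists>x0. (\<integral>\<^sup>+x. c x x0 \<partial>distr P borel X) < \<infinity>"
    and "regular_cond_distr P M X \<kappa>"
    and "U \<in> P \<rightarrow>\<^sub>M restrict_space borel {0..1}"
    and "prob_space.indep_set P (sets (sigma_alg_of P U)) (sets (sigma_join (sigma_alg_of P X) M))"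
    and "distr P lborel U = uniform_measure lborel {0..1}"
  shows "(\<lambda>\<omega>. kr_dist c (\<kappa> \<omega>) (distr P borel X)) \<in> borel_measurable (completion P) \<and>
    (\<exists>Xs :: 'w \<Rightarrow> 's.
        Xs \<in> sigma_join (sigma_alg_of P U) (sigma_join (sigma_alg_of P X) M) \<rightarrow>\<^sub>M borel \<and>
        prob_space.indep_set P (sets (sigma_alg_of P Xs)) (sets M) \<and>
        distr P borel Xs = distr P borel X \<and>
        (\<lambda>\<omega>. c (X \<omega>) (Xs \<omega>)) \<in> borel_measurable (completion P) \<and>
        tau_c c P X \<kappa> = (\<integral>\<^sup>+\<omega>. c (X \<omega>) (Xs \<omega>) \<partial>completion P))"
proof -
  note P = assms(1) and sub = assms(2) and X = assms(7) and dU = assms(12)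
  interpret P: prob_space P by fact
  interpret S: finite_measure_subalgebra P M by unfold_locales (rule sub)
  let ?\<mu> = "distr P borel X"
  have \<mu>: "prob_space ?\<mu>" by (rule P.prob_space_distr[OF X])
  obtain T f \<phi> d where "cost_coding ?\<mu> c T f \<phi> d"
    by (rule radon_cost_coding[OF assms(3,4) _ _ \<mu>]) (use assms(5,6) in auto)
  interpret cc: cost_coding ?\<mu> c T f \<phi> d by fact
  have \<kappa>: "\<kappa> \<in> M \<rightarrow>\<^sub>M prob_algebra borel"
    and cond: "\<And>B. B \<in> sets borel \<Longrightarrow> AE \<omega> in P. measure (\<kappa> \<omega>) B = real_cond_exp P M (indicat_real (X -` B \<inter> space P)) \<omega>"
    using assms(9) unfolding regular_cond_distr_def by auto
  have \<kappa>P: "\<kappa> \<in> P \<rightarrow>\<^sub>M prob_algebra borel" by (rule measurable_from_subalg[OF sub \<kappa>])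
  have \<kappa>_prob: "prob_space (\<kappa> \<omega>)" "sets (\<kappa> \<omega>) = sets borel" if "\<omega> \<in> space P" for \<omega>
    using measurable_space[OF \<kappa>P that] by (auto simp: space_prob_algebra)
  have ev: "E \<in> P.events" if "E \<in> sets M" for E using sub that by (auto simp: subalgebra_def)
  \<comment> \<open>The conditional law is given by an almost-everywhere identity for each
    \<open>B\<close>; integrated over events of \<open>M\<close> it carries no exceptional
    sets.\<close>
  have lawX: "P.prob (E \<inter> X -` B) = (\<integral>\<omega>. indicator E \<omega> * measure (\<kappa> \<omega>) B \<partial>P)"
    if E: "E \<in> sets M" and B: "B \<in> sets borel" for E B
  proof -
    have XB: "X -` B \<inter> space P \<in> P.events" by (rule measurable_sets[OF X B])
    have "E \<inter> X -` B = E \<inter> (X -` B \<inter> space P)" using sets.sets_into_space[OF ev[OF E]] by auto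
    then have "P.prob (E \<inter> X -` B) = (\<integral>\<omega>\<in>E. indicat_real (X -` B \<inter> space P) \<omega> \<partial>P)"
      unfolding set_lebesgue_integral_def using XB ev[OF E]
      by (simp add: indicator_inter_arith[symmetric] sets.Int)
    also have "\<dots> = (\<integral>\<omega>\<in>E. real_cond_exp P M (indicat_real (X -` B \<inter> space P)) \<omega> \<partial>P)"
      by (rule S.real_cond_exp_intA[OF _ E]) (use XB in simp)
    also have "\<dots> = (\<integral>\<omega>. indicator E \<omega> * measure (\<kappa> \<omega>) B \<partial>P)"
      unfolding set_lebesgue_integral_def
    proof (rule integral_cong_AE)
      show "(\<lambda>\<omega>. indicator E \<omega> * measure (\<kappa> \<omega>) B) \<in> borel_measurable P"
        using ev[OF E] measurable_compose[OF measurable_prob_algebraD[OF \<kappa>P] measurable_measure_subprob_algebra[OF B]]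
        by simp
      show "AE \<omega> in P. indicat_real E \<omega> *\<^sub>R real_cond_exp P M (indicat_real (X -` B \<inter> space P)) \<omega> =
          indicat_real E \<omega> * measure (\<kappa> \<omega>) B"
        using cond[OF B] by eventually_elim simp
    qed (use ev[OF E] in measurable)
    finally show ?thesis .
  qed
  have XT: "AE \<omega> in P. X \<omega> \<in> T" using AE_distr_iff[OF X, of "\<lambda>x. x \<in> T"] cc.T cc.AE_T by simp
  \<comment> \<open>\<open>kr_dist_eq_kr_coded\<close> requires the conditional law to be carried by
    \<open>T\<close>. This holds almost surely because \<open>X\<close> lies in \<open>T\<close>
    almost surely.\<close>
  have \<kappa>T: "AE \<omega> in P. AE x in \<kappa> \<omega>. x \<in> T"
  proof -
    have "AE \<omega> in P. real_cond_exp P M (indicat_real (X -` T \<inter> space P)) \<omega> = real_cond_exp P M (\<lambda>_. 1) \<omega>"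
      by (rule S.real_cond_exp_cong)
        (use XT measurable_sets[OF X cc.T] in \<open>auto simp: indicator_def elim!: eventually_mono\<close>)
    moreover have "AE \<omega> in P. real_cond_exp P M (\<lambda>_. 1) \<omega> = 1"
      by (rule S.real_cond_exp_F_meas) auto
    ultimately show ?thesis using cond[OF cc.T] AE_space
    proof eventually_elim
      case (elim \<omega>)
      interpret k: prob_space "\<kappa> \<omega>" by (rule \<kappa>_prob(1)[OF elim(4)])
      show ?case using elim cc.T by (simp add: k.prob_eq_1[symmetric] \<kappa>_prob(2))
    qed
  qed
  have kr_AE: "AE \<omega> in P. cc.kr_coded (\<kappa> \<omega>) = kr_dist c (\<kappa> \<omega>) ?\<mu>"
    using \<kappa>T AE_space by eventually_elim (metis cc.kr_dist_eq_kr_coded \<kappa>_prob)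
  have kr_meas: "(\<lambda>\<omega>. cc.kr_coded (\<kappa> \<omega>)) \<in> borel_measurable P" by (rule cc.kr_coded_measurable[OF \<kappa>P])
  have tau: "tau_c c P X \<kappa> = (\<integral>\<^sup>+\<omega>. cc.kr_coded (\<kappa> \<omega>) \<partial>P)"
    unfolding tau_c_def nn_integral_completion
    by (rule nn_integral_cong_AE) (use kr_AE in \<open>auto elim!: eventually_mono\<close>)
  let ?G = "sigma_join (sigma_alg_of P X) M"
  have spM: "space M = space P" and spX: "space (sigma_alg_of P X) = space P"
    using sub by (simp_all add: subalgebra_def sigma_alg_of_def)
  have subG: "subalgebra P ?G" by (rule P.subalgebra_sigma_join[OF subalgebra_sigma_alg_of[OF X] sub])
  have XG: "X \<in> ?G \<rightarrow>\<^sub>M borel" by (rule sigma_join_measurable(1)[OF spX spM measurable_sigma_alg_of])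
  have MG: "sets M \<subseteq> sets ?G"
  proof
    fix E assume "E \<in> sets M"
    have "(\<lambda>\<omega>. \<omega>) \<in> ?G \<rightarrow>\<^sub>M M" by (rule sigma_join_measurable(2)[OF spX spM]) simp
    from measurable_sets[OF this \<open>E \<in> sets M\<close>] have "E \<inter> space ?G \<in> sets ?G" by simp
    moreover have "E \<inter> space ?G = E"
      using sets.sets_into_space[OF \<open>E \<in> sets M\<close>] subG spM by (auto simp: subalgebra_def)
    ultimately show "E \<in> sets ?G" by simp
  qed
  have U: "U \<in> borel_measurable P" using assms(10) by (simp add: measurable_restrict_space2_iff)
  \<comment> \<open>The cost bound is demanded only for finite \<tau>: for infinite \<tau> every
    independent copy is optimal, since its cost is at least \<tau>.\<close>
  have "\<exists>Y. Y \<in> sigma_join (sigma_alg_of P U) ?G \<rightarrow>\<^sub>M borel \<and>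
    (\<forall>E\<in>sets M. \<forall>C\<in>sets borel. P.prob (E \<inter> Y -` C) = P.prob E * measure ?\<mu> C) \<and>
    (tau_c c P X \<kappa> < \<infinity> \<longrightarrow> (\<forall>m. (\<integral>\<omega>. seq_cost f m (X \<omega>) (Y \<omega>) \<partial>P) \<le> enn2real (tau_c c P X \<kappa>)))"
  proof (cases "tau_c c P X \<kappa> < \<infinity>")
    case False
    interpret ts: transport_setting P ?\<mu> M X "\<lambda>_ _. 0" "\<lambda>_. 0"
      by (rule cc.transport_setting_zero_cost[OF P sub X])
    show ?thesis
    proof (rule ts.coupling[OF subG MG XG U dU assms(11) cc.\<phi> cc.d])
      fix Y
      assume Y: "Y \<in> sigma_join (sigma_alg_of P U) ?G \<rightarrow>\<^sub>M borel"
        "\<And>E C. E \<in> sets M \<Longrightarrow> C \<in> sets borel \<Longrightarrow> P.prob (E \<inter> Y -` C) = P.prob E * measure ?\<mu> C"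
      show ?thesis by (intro exI[of _ Y] conjI ballI impI Y; use False in simp)
    qed
  next
    case True
    define b where "b \<omega> = enn2real (cc.kr_coded (\<kappa> \<omega>))" for \<omega>
    have fin: "AE \<omega> in P. cc.kr_coded (\<kappa> \<omega>) \<noteq> \<infinity>"
      by (rule nn_integral_PInf_AE[OF kr_meas]) (use True tau in auto)
    have b_kr: "AE \<omega> in P. ennreal (b \<omega>) = cc.kr_coded (\<kappa> \<omega>)"
      using fin by eventually_elim (simp add: b_def less_top)
    have b0: "0 \<le> b \<omega>" for \<omega> by (simp add: b_def)
    have b_meas: "b \<in> borel_measurable P" unfolding b_def by (rule borel_measurable_enn2real[OF kr_meas])
    have nnb: "(\<integral>\<^sup>+\<omega>. ennreal (b \<omega>) \<partial>P) = tau_c c P X \<kappa>"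
      unfolding tau by (rule nn_integral_cong_AE[OF b_kr])
    have b: "integrable P b"
      by (rule integrableI_nonneg) (use nnb True b_meas b0 in auto)
    have int_b: "(\<integral>\<omega>. b \<omega> \<partial>P) = enn2real (tau_c c P X \<kappa>)"
      unfolding nnb[symmetric] by (rule integral_eq_nn_integral) (use b_meas b0 in auto)
    interpret ts: transport_setting P ?\<mu> M X f b
    proof unfold_locales
      fix G E assume G: "G \<in> min_costs f" and E: "E \<in> sets M"
      note Gm = min_costs_measurable[OF G cc.f_meas]
      obtain B where B: "\<bar>G x\<bar> \<le> B" for x
        using min_costs_bounded[OF G cc.f_bdd] by (auto simp: bounded_iff)
      have iE: "integrable P (\<lambda>\<omega>. indicator E \<omega> * F \<omega>)" if "integrable P F" for F :: "_ \<Rightarrow> real"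
        using integrable_mult_indicator[OF ev[OF E] that] by simp
      let ?g = "\<lambda>\<omega>. \<integral>x. G x \<partial>\<kappa> \<omega>"
      have gap: "AE \<omega> in P. ?g \<omega> - (\<integral>x. G x \<partial>?\<mu>) \<le> b \<omega>"
        using b_kr
      proof eventually_elim
        case (elim \<omega>)
        have "ennreal \<bar>?g \<omega> - (\<integral>x. G x \<partial>?\<mu>)\<bar> \<le> ennreal (b \<omega>)"
          unfolding elim cc.kr_coded_def using G by (rule SUP_upper)
        then show ?case by (simp add: b_def ennreal_le_iff)
      qed
      have intk: "integrable P ?g"
        by (rule P.integrable_kernel_integral[OF \<kappa>P Gm B])
      \<comment> \<open>Disintegration over an event of \<open>M\<close> replaces G(X) by its mean
        under the conditional law; \<open>gap\<close> then gives the budget inequality under the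
        integral.\<close>
      have "(\<integral>\<omega>. indicator E \<omega> * G (X \<omega>) \<partial>P) - P.prob E * (\<integral>x. G x \<partial>?\<mu>) =
          (\<integral>\<omega>. indicator E \<omega> * ?g \<omega> \<partial>P) - (\<integral>\<omega>. indicator E \<omega> * (\<integral>x. G x \<partial>?\<mu>) \<partial>P)"
        using P.integral_kernel_law[OF \<kappa>P X ev[OF E] lawX[OF E] Gm B]
        by (simp add: Int_absorb2[OF sets.sets_into_space[OF ev[OF E]]])
      also have "\<dots> = (\<integral>\<omega>. indicator E \<omega> * (?g \<omega> - (\<integral>x. G x \<partial>?\<mu>)) \<partial>P)"
        unfolding right_diff_distrib using iE[OF intk] iE[of "\<lambda>_. \<integral>x. G x \<partial>?\<mu>"]
        by (subst Bochner_Integration.integral_diff) auto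
      also have "\<dots> \<le> (\<integral>\<omega>. indicator E \<omega> * b \<omega> \<partial>P)"
        by (rule integral_mono_AE)
          (use iE[OF b] iE[OF Bochner_Integration.integrable_diff[OF intk]] gap in \<open>auto simp: indicator_def elim!: eventually_mono\<close>)
      finally show "(\<integral>\<omega>. indicator E \<omega> * G (X \<omega>) \<partial>P) - P.prob E * (\<integral>x. G x \<partial>?\<mu>) \<le> (\<integral>\<omega>. indicator E \<omega> * b \<omega> \<partial>P)" .
    qed (use sub X b cc.f_meas cc.f_bdd in auto)
    show ?thesis
    proof (rule ts.coupling[OF subG MG XG U dU assms(11) cc.\<phi> cc.d])
      fix Y
      assume Y: "Y \<in> sigma_join (sigma_alg_of P U) ?G \<rightarrow>\<^sub>M borel"
        "\<And>E C. E \<in> sets M \<Longrightarrow> C \<in> sets borel \<Longrightarrow> P.prob (E \<inter> Y -` C) = P.prob E * measure ?\<mu> C"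
        "\<And>m. (\<integral>\<omega>. seq_cost f m (X \<omega>) (Y \<omega>) \<partial>P) \<le> (\<integral>\<omega>. b \<omega> \<partial>P)"
      show ?thesis by (intro exI[of _ Y] conjI ballI impI allI Y Y(3)[unfolded int_b])
    qed
  qed
  then obtain Y where Y: "Y \<in> sigma_join (sigma_alg_of P U) ?G \<rightarrow>\<^sub>M borel"
    and lawY: "\<And>E C. E \<in> sets M \<Longrightarrow> C \<in> sets borel \<Longrightarrow> P.prob (E \<inter> Y -` C) = P.prob E * measure ?\<mu> C"
    and cost: "\<And>m. tau_c c P X \<kappa> < \<infinity> \<Longrightarrow> (\<integral>\<omega>. seq_cost f m (X \<omega>) (Y \<omega>) \<partial>P) \<le> enn2real (tau_c c P X \<kappa>)"
    by blast
  have YP: "Y \<in> P \<rightarrow>\<^sub>M borel"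
    by (rule measurable_from_subalg[OF P.subalgebra_sigma_join[OF subalgebra_sigma_alg_of[OF U] subG] Y])
  have prob_Y: "P.prob (Y -` C \<inter> space P) = measure ?\<mu> C" if "C \<in> sets borel" for C
    using lawY[OF sets.top that] P.prob_space by (simp add: spM Int_commute)
  have dY: "distr P borel Y = ?\<mu>"
  proof (rule measure_eqI)
    fix C assume "C \<in> sets (distr P borel Y)"
    then have C: "C \<in> sets borel" by simp
    then show "emeasure (distr P borel Y) C = emeasure ?\<mu> C"
      using prob_Y[OF C] YP by (simp add: emeasure_distr P.emeasure_eq_measure cc.\<mu>.emeasure_eq_measure)
  qed simp
  have YT: "AE \<omega> in P. Y \<omega> \<in> T" 
    using AE_distr_iff[OF YP, of "\<lambda>x. x \<in> T"] cc.T cc.AE_T unfolding dY by simp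
  have indep: "P.indep_set (sets (sigma_alg_of P Y)) (sets M)"
  proof (rule P.indep_setI)
    show "sets (sigma_alg_of P Y) \<subseteq> P.events" using subalgebra_sigma_alg_of[OF YP] by (simp add: subalgebra_def)
    show "sets M \<subseteq> P.events" using ev by blast
    fix a E assume "a \<in> sets (sigma_alg_of P Y)" and E: "E \<in> sets M"
    then obtain C where C: "C \<in> sets borel" "a = Y -` C \<inter> space P"
      unfolding sigma_alg_of_def by (auto simp: sets_vimage_algebra2)
    have "a \<inter> E = E \<inter> Y -` C" using sets.sets_into_space[OF ev[OF E]] C(2) by auto
    then show "P.prob (a \<inter> E) = P.prob a * P.prob E"
      using lawY[OF E C(1)] prob_Y[OF C(1)] C(2) by simp
  qed
  have "tau_c c P X \<kappa> = (\<integral>\<^sup>+\<omega>. c (X \<omega>) (Y \<omega>) \<partial>P)"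
  proof (rule antisym)
    show "tau_c c P X \<kappa> \<le> (\<integral>\<^sup>+\<omega>. c (X \<omega>) (Y \<omega>) \<partial>P)"
      unfolding tau by (rule cc.kr_coded_le_cost[OF P sub \<kappa> X YP XT YT lawX lawY])
    show "(\<integral>\<^sup>+\<omega>. c (X \<omega>) (Y \<omega>) \<partial>P) \<le> tau_c c P X \<kappa>"
    proof (cases "tau_c c P X \<kappa> < \<infinity>")
      case True
      from cc.cost_of_coupling(3)[OF P X YP XT YT cost[OF True]] True
      show ?thesis by simp
    next
      case False
      then show ?thesis by (simp add: less_top[symmetric])
    qed
  qed
  moreover have "(\<lambda>\<omega>. kr_dist c (\<kappa> \<omega>) ?\<mu>) \<in> borel_measurable (completion P)"
    by (rule borel_measurable_completion_AE[OF kr_meas kr_AE])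
  moreover have "(\<lambda>\<omega>. c (X \<omega>) (Y \<omega>)) \<in> borel_measurable (completion P)"
    by (rule cc.cost_of_coupling(1)[OF P X YP XT YT])
  ultimately show ?thesis
    unfolding nn_integral_completion by (intro conjI exI[of _ Y] Y indep dY)
qed

end
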